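(* Let $d\ge 2$ and let $\mathbf{k}:\mathbb{Z}^d\to[0,1]$ satisfy $\mathbf{k}(x)=o(|x|^{-2})$ as $|x|\to\infty$. Let $\Lambda=(\Lambda_R)_{R\in\mathbb{N}}$ be any exhaustion of $\mathbb{Z}^d$ and fix any $x_0\in E_{\mathbf{k}}$. Then the limit $$a(x)=\lim_{R\to\infty}\frac{\mathbb{P}_x[\tau(\Lambda_R^c)<\tau(\Delta)]}{\mathbb{P}_{x_0}[\tau(\Lambda_R^c)<\tau(\Delta)]}$$ exists for all $x\in\mathbb{Z}^d$ and does not depend on the exhaustion $\Lambda$. The function $a$ is positive on $E_{\mathbf{k}}$, zero on $\mathbb{Z}^d\setminus E_{\mathbf{k}}$, and massive harmonic on $E_{\mathbf{k}}$. Hence the killed random walk conditioned to survive is well-defined.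
   Context: $|\cdot|$ is the Euclidean norm; $x\sim y$ means $|x-y|=1$. An exhaustion of $\mathbb{Z}^d$ is an increasing sequence $(\Lambda_R)_{R\in\mathbb{N}}$ of finite subsets of $\mathbb{Z}^d$ such that every $x\in\mathbb{Z}^d$ belongs to $\Lambda_R$ for some $R$; $\Lambda_R^c=\mathbb{Z}^d\setminus\Lambda_R$. Killed random walk (KRW): given $\mathbf{k}:\mathbb{Z}^d\to[0,1]$, $S^{\mathbf{k}}$ is the Markov chain on $\mathbb{Z}^d\cup\{\Delta\}$ ($\Delta$ an additional cemetery state) with transition probabilities $Q(\Delta,\Delta)=1$, $Q(x,\Delta)=\mathbf{k}(x)$ and $Q(x,y)=\frac{1-\mathbf{k}(x)}{2d}\mathbf 1_{x\sim y}$ for $x,y\in\mathbb{Z}^d$. $\mathbb{P}_x$ is the law of the chain started at $x$. For $A\subset\mathbb{Z}^d\cup\{\Delta\}$, $\tau(A)=\inf\{n\ge 0: S^{\mathbf{k}}_n\in A\}$, and $\tau(\Delta)=\tau(\{\Delta\})$ is the killing time. $E_{\mathbf{k}}\subset\mathbb{Z}^d$ is the set of $x$ from which there is a nearest-neighbour path $x=x_0,x_1,x_2,\dots$ with $\mathbf{k}(x_i)<1$ for all $i\ge0$ and $|x_i|\to\infty$. It is a standing assumption that $E_{\mathbf{k}}$ is connected. A function $a$ is massive harmonic at $x$ (respectively on a set, if at all its points) if $a(x)=\frac{1-\mathbf{k}(x)}{2d}\sum_{y\sim x}a(y)$. The KRW conditioned to survive is said to be well-defined if for any exhaustion $\Lambda$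 and any $x\in E_{\mathbf{k}}$, the KRW started at $x$ and conditioned on $\{\tau(\Lambda_R^c)<\tau(\Delta)\}$ converges in distribution as $R\to\infty$ (i.e. for each fixed $n$ the law of the first steps $(S_0^{\mathbf{k}},\dots,S_n^{\mathbf{k}})$ converges) to a Markov chain on $E_{\mathbf{k}}$ which does not depend on the exhaustion. *)

theory Defs
  imports "HOL-Probability.Probability" "HOL-Library.Landau_Symbols"
begin

section \<open>The lattice\<close>

definition enorm :: "int ^ 'd \<Rightarrow> real"
  where "enorm x = norm (\<chi> i. real_of_int (x $ i))"

definition adj :: "int ^ 'd \<Rightarrow> int ^ 'd \<Rightarrow> bool"  (infix \<open>\<sim>\<^sub>Z\<close> 50)
  where "x \<sim>\<^sub>Z y \<longleftrightarrow> enorm (x - y) = 1"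

definition exhaustion :: "(nat \<Rightarrow> (int ^ 'd) set) \<Rightarrow> bool"
  where "exhaustion \<Lambda> \<longleftrightarrow> incseq \<Lambda> \<and> (\<forall>R. finite (\<Lambda> R)) \<and> (\<forall>x. \<exists>R. x \<in> \<Lambda> R)"

definition lattice_connected :: "(int ^ 'd) set \<Rightarrow> bool"
  where "lattice_connected A \<longleftrightarrow>
    (\<forall>x\<in>A. \<forall>y\<in>A. (x, y) \<in> {(u, v). u \<in> A \<and> v \<in> A \<and> u \<sim>\<^sub>Z v}\<^sup>*)"

definition survival_set :: "(int ^ 'd \<Rightarrow> real) \<Rightarrow> (int ^ 'd) set"
  where "survival_set k = {x. \<exists>p :: nat \<Rightarrow> int ^ 'd. p 0 = x \<and> (\<forall>i. p i \<sim>\<^sub>Z p (Suc i)) \<and>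
    (\<forall>i. k (p i) < 1) \<and> filterlim (\<lambda>i. enorm (p i)) at_top sequentially}"

definition massive_harmonic_at :: "(int ^ 'd \<Rightarrow> real) \<Rightarrow> (int ^ 'd \<Rightarrow> real) \<Rightarrow> int ^ 'd \<Rightarrow> bool"
  where "massive_harmonic_at k a x \<longleftrightarrow>
    a x = (1 - k x) / (2 * real CARD('d)) * (\<Sum>y | x \<sim>\<^sub>Z y. a y)"

lemma adj_iff: "x \<sim>\<^sub>Z y \<longleftrightarrow> (\<exists>i. y = x + axis i 1 \<or> y = x - axis i (1::int))"
proof
  assume "x \<sim>\<^sub>Z y"
  define z where "z = x - y"
  have "(\<Sum>i\<in>UNIV. (real_of_int (z $ i))\<^sup>2) = 1"
    using \<open>x \<sim>\<^sub>Z y\<close> by (simp add: adj_def enorm_def norm_vec_def L2_set_def z_def)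
  then have "real_of_int (\<Sum>i\<in>UNIV. (z $ i)\<^sup>2) = 1" by simp
  then have s: "(\<Sum>i\<in>UNIV. (z $ i)\<^sup>2) = 1" by linarith
  then have "\<exists>i. z $ i \<noteq> 0"
    by (rule contrapos_pp) simp
  then obtain i where i: "z $ i \<noteq> 0" by blast
  have "(\<Sum>i\<in>UNIV. (z $ i)\<^sup>2) = (z $ i)\<^sup>2 + (\<Sum>j\<in>UNIV - {i}. (z $ j)\<^sup>2)"
    by (rule sum.remove) auto
  moreover have "(z $ i)\<^sup>2 \<ge> 1" using i by (simp add: int_one_le_iff_zero_less)
  moreover have "(\<Sum>j\<in>UNIV - {i}. (z $ j)\<^sup>2) \<ge> 0" by (simp add: sum_nonneg)
  ultimately have "(z $ i)\<^sup>2 = 1" and "(\<Sum>j\<in>UNIV - {i}. (z $ j)\<^sup>2) = 0" using s by linarith+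
  then have "z $ i = 1 \<or> z $ i = -1" and "\<forall>j. j \<noteq> i \<longrightarrow> z $ j = 0"
    by (auto simp: power2_eq_1_iff sum_nonneg_eq_0_iff)
  then have "z = axis i 1 \<or> z = - axis i 1" by (auto simp: vec_eq_iff axis_def)
  moreover have "y = x - z" by (simp add: z_def)
  ultimately show "\<exists>i. y = x + axis i 1 \<or> y = x - axis i 1"
    by (metis diff_minus_eq_add)
next
  assume "\<exists>i. y = x + axis i 1 \<or> y = x - axis i 1"
  then obtain i where "y = x + axis i 1 \<or> y = x - axis i 1" by blast
  then have *: "(real_of_int ((x - y) $ j))\<^sup>2 = (if j = i then 1 else 0)" for j by (auto simp: axis_def)
  then show "x \<sim>\<^sub>Z y" unfolding adj_def enorm_def norm_vec_def L2_set_def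
    by (simp del: vector_minus_component)
qed

lemma card_neighbours:
  fixes x :: "int ^ 'd"
  shows "finite {y. x \<sim>\<^sub>Z y}" "card {y. x \<sim>\<^sub>Z y} = 2 * CARD('d)"
proof -
  let ?f = "\<lambda>i. x + axis i 1" and ?g = "\<lambda>i. x - axis i 1"
  have *: "{y. x \<sim>\<^sub>Z y} = range ?f \<union> range ?g" by (auto simp: adj_iff)
  show "finite {y. x \<sim>\<^sub>Z y}" unfolding * by simp
  have "inj ?f" "inj ?g" by (auto simp: inj_def axis_eq_axis)
  moreover have "range ?f \<inter> range ?g = {}"
  proof -
    have "axis i 1 \<noteq> - axis j (1::int)" for i j :: 'd
      by (auto simp: vec_eq_iff axis_def intro!: exI[of _ i])
    then show ?thesis by (auto simp: algebra_simps add_eq_0_iff) 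
  qed
  ultimately show "card {y. x \<sim>\<^sub>Z y} = 2 * CARD('d)"
    unfolding * by (simp add: card_Un_disjoint card_image)
qed

section \<open>Discrete-time Markov chains on a discrete state space\<close>

text \<open>
  The law of the chain with transition kernel \<open>K\<close> started at \<open>s\<close>, as a measure on infinite
  trajectories, comes from the Ionescu-Tulcea theorem: \<open>chain_step K s n \<omega>\<close> is the conditional
  law of the \<open>n\<close>-th state given the states \<open>\<omega> 0, \<dots>, \<omega> (n - 1)\<close>; see
  \<open>emeasure_chain_law_path\<close> for the resulting finite-dimensional laws.
\<close>

definition chain_step :: "('s \<Rightarrow> 's pmf) \<Rightarrow> 's \<Rightarrow> nat \<Rightarrow> (nat \<Rightarrow> 's) \<Rightarrow> 's measure"
  where "chain_step K s n \<omega> = measure_pmf (case n of 0 \<Rightarrow> return_pmf s | Suc m \<Rightarrow> K (\<omega> m))"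

interpretation MC: Ionescu_Tulcea "chain_step K s" "\<lambda>_. count_space UNIV"
  for K :: "'s \<Rightarrow> 's pmf" and s :: 's
proof (rule Ionescu_Tulcea.intro)
  fix n
  show "chain_step K s n \<in> PiM {0..<n} (\<lambda>_. count_space UNIV) \<rightarrow>\<^sub>M subprob_algebra (count_space UNIV)"
  proof (cases n)
    case 0
    then show ?thesis unfolding chain_step_def by simp
  next
    case (Suc m)
    have "(\<lambda>\<omega>. \<omega> m) \<in> PiM {0..<n} (\<lambda>_. count_space UNIV) \<rightarrow>\<^sub>M (count_space UNIV :: 's measure)"
      using Suc by (intro measurable_component_singleton) auto
    moreover have "(\<lambda>s. measure_pmf (K s)) \<in> count_space UNIV \<rightarrow>\<^sub>M subprob_algebra (count_space UNIV)"
      by (simp add: measure_pmf_in_subprob_space)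
    ultimately have "(\<lambda>\<omega>. measure_pmf (K (\<omega> m))) \<in> PiM {0..<n} (\<lambda>_. count_space UNIV) \<rightarrow>\<^sub>M subprob_algebra (count_space UNIV)"
      by (rule measurable_compose)
    then show ?thesis unfolding chain_step_def Suc by simp
  qed
next
  show "prob_space (chain_step K s i x)" for i x
    by (simp only: chain_step_def prob_space_measure_pmf)
qed

definition chain_law :: "('s \<Rightarrow> 's pmf) \<Rightarrow> 's \<Rightarrow> (nat \<Rightarrow> 's) measure"
  where "chain_law K s = MC.PF.lim K s"

lemma space_chain_law: "space (chain_law K s) = UNIV"
  by (simp add: chain_law_def space_PiM)

lemma sets_chain_law: "sets (chain_law K s) = sets (PiM UNIV (\<lambda>_. count_space UNIV))"
  by (simp add: chain_law_def)

lemma prob_space_chain_law: "prob_space (chain_law K s)"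
proof
  interpret CI: prob_space "MC.CI K s {}" by (rule MC.PF.prob_space_P) auto
  have "prod_emb UNIV (\<lambda>_. count_space (UNIV :: 'a set)) {} (space (MC.CI K s {})) = UNIV"
    by (auto simp: prod_emb_def MC.CI_def space_PiM)
  moreover have "space (MC.CI K s {}) \<in> sets (PiM {} (\<lambda>_. count_space (UNIV :: 'a set)))"
    by (simp add: MC.CI_def)
  ultimately show "emeasure (chain_law K s) (space (chain_law K s)) = 1"
    using MC.lim[of "{}" "space (MC.CI K s {})" K s] CI.emeasure_space_1
    by (simp add: space_chain_law) (simp add: chain_law_def)
qed

lemma emeasure_C_path:
  "emeasure (MC.C K s 0 (Suc n) (\<lambda>_. undefined)) {restrict p {0..<Suc n}} =
    indicator {s} (p 0) * (\<Prod>i<n. ennreal (pmf (K (p i)) (p (Suc i))))"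
proof -
  let ?M = "\<lambda>n. PiM {0..<n} (\<lambda>_. count_space (UNIV :: 'a set))"
  have sing: "{restrict p {0..<n}} \<in> sets (?M n)" for n
  proof -
    have "{restrict p {0..<n}} = PiE {0..<n} (\<lambda>i. {p i})"
      by (auto simp: PiE_iff extensional_def restrict_def fun_eq_iff)
    then show ?thesis by (simp add: sets_PiM_I_finite)
  qed
  have start: "(\<lambda>_. undefined) \<in> space (?M 0)" by (auto simp: space_PiM)
  have step: "emeasure (MC.C K s 0 (Suc n) (\<lambda>_. undefined)) {restrict p {0..<Suc n}} =
      emeasure (MC.C K s 0 n (\<lambda>_. undefined)) {restrict p {0..<n}} * emeasure (chain_step K s n p) {p n}" for n
  proof -
    have "emeasure (MC.C K s 0 (Suc n) (\<lambda>_. undefined)) {restrict p {0..<Suc n}} =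
      (\<integral>\<^sup>+\<omega>. emeasure (MC.eP K s n \<omega>) {restrict p {0..<Suc n}} \<partial>MC.C K s 0 n (\<lambda>_. undefined))"
    proof -
      have "space (MC.C K s 0 n (\<lambda>_. undefined)) \<noteq> {}"
        by (rule prob_space.not_empty[OF MC.prob_space_C[OF start]])
      moreover have "MC.eP K s n \<in> MC.C K s 0 n (\<lambda>_. undefined) \<rightarrow>\<^sub>M subprob_algebra (?M (Suc n))"
        by (subst measurable_cong_sets[OF MC.sets_C[OF start] refl]) (simp only: add_0 MC.measurable_eP)
      ultimately show ?thesis
        using emeasure_bind[OF _ _ sing[of "Suc n"]] by (simp only: MC.C.simps add_0)
    qed
    also have "\<dots> = (\<integral>\<^sup>+\<omega>. emeasure (chain_step K s n p) {p n} * indicator {restrict p {0..<n}} \<omega>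
        \<partial>MC.C K s 0 n (\<lambda>_. undefined))"
    proof (rule nn_integral_cong)
      fix \<omega> assume "\<omega> \<in> space (MC.C K s 0 n (\<lambda>_. undefined))"
      then have \<omega>: "\<omega> \<in> space (?M n)" using MC.space_C[OF start, of K s n] by simp
      then have \<omega>_ext: "\<omega> \<in> extensional {0..<n}" by (simp add: space_PiM PiE_def)
      have "fun_upd \<omega> n x = restrict p {0..<Suc n} \<longleftrightarrow> \<omega> = restrict p {0..<n} \<and> x = p n" for x
      proof
        assume eq: "fun_upd \<omega> n x = restrict p {0..<Suc n}"
        have "\<omega> i = restrict p {0..<n} i" for i
          using fun_cong[OF eq, of i] \<omega>_ext by (cases "i < n") (auto simp: extensional_def)
        moreover have "x = p n" using fun_cong[OF eq, of n] by simp
        ultimately show "\<omega> = restrict p {0..<n} \<and> x = p n" by blast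
      next
        assume "\<omega> = restrict p {0..<n} \<and> x = p n"
        then show "fun_upd \<omega> n x = restrict p {0..<Suc n}"
          by (intro ext) (simp add: less_Suc_eq)
      qed
      then have *: "(\<lambda>x. fun_upd \<omega> n x) -` {restrict p {0..<Suc n}} = 
          (if \<omega> = restrict p {0..<n} then {p n} else {})"
        by (simp add: vimage_def)
      have "emeasure (MC.eP K s n \<omega>) {restrict p {0..<Suc n}} =
          emeasure (chain_step K s n \<omega>) ((\<lambda>x. fun_upd \<omega> n x) -` {restrict p {0..<Suc n}})"
        using MC.emeasure_eP[OF \<omega> sing[of "Suc n"]] by simp
      also have "\<dots> = emeasure (chain_step K s n p) {p n} * indicator {restrict p {0..<n}} \<omega>"
        unfolding * by (auto simp: chain_step_def split: nat.split)
      finally show "emeasure (MC.eP K s n \<omega>) {restrict p {0..<Suc n}} =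
          emeasure (chain_step K s n p) {p n} * indicator {restrict p {0..<n}} \<omega>" .
    qed
    also have "\<dots> = emeasure (MC.C K s 0 n (\<lambda>_. undefined)) {restrict p {0..<n}} * emeasure (chain_step K s n p) {p n}"
      using sing[of n] MC.sets_C[OF start, of K s n]
      by (subst nn_integral_cmult_indicator) (simp_all only: add_0 mult.commute)
    finally show ?thesis .
  qed
  show ?thesis
  proof (induction n)
    case 0
    have "emeasure (MC.C K s 0 0 (\<lambda>_. undefined)) {restrict p {0..<0}} = 1"
      by (simp only: MC.C.simps emeasure_return[OF sing]) (simp add: restrict_def)
    moreover have "emeasure (chain_step K s 0 p) {p 0} = indicator {s} (p 0)"
      by (simp add: chain_step_def indicator_def)
    ultimately show ?case by (simp only: step lessThan_0 prod.empty mult_1_left mult_1_right)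
  next
    case (Suc n)
    have "emeasure (chain_step K s (Suc n) p) {p (Suc n)} = ennreal (pmf (K (p n)) (p (Suc n)))"
      by (simp add: chain_step_def emeasure_pmf_single)
    then show ?case
      by (simp only: step[of "Suc n"] Suc.IH prod.lessThan_Suc mult.assoc)
  qed
qed

lemma emeasure_chain_law_path:
  "emeasure (chain_law K s) {\<omega>. \<forall>i\<le>n. \<omega> i = p i} =
    indicator {s} (p 0) * (\<Prod>i<n. ennreal (pmf (K (p i)) (p (Suc i))))"
proof -
  let ?X = "{restrict p {0..<Suc n}}"
  have "?X = PiE {0..<Suc n} (\<lambda>i. {p i})"
    by (auto simp: PiE_iff extensional_def restrict_def fun_eq_iff)
  then have X: "?X \<in> sets (PiM {0..<Suc n} (\<lambda>_. count_space UNIV))"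
    by (simp add: sets_PiM_I_finite)
  have "{\<omega>. \<forall>i\<le>n. \<omega> i = p i} = prod_emb UNIV (\<lambda>_. count_space UNIV) {0..<Suc n} ?X"
    by (auto simp: prod_emb_def fun_eq_iff less_Suc_eq_le restrict_def) metis
  then have "emeasure (chain_law K s) {\<omega>. \<forall>i\<le>n. \<omega> i = p i} = emeasure (MC.CI K s {0..<Suc n}) ?X"
    unfolding chain_law_def using MC.lim[OF _ X, of K s] by simp
  also have "\<dots> = emeasure (MC.C K s 0 (Suc n) (\<lambda>_. undefined)) ?X"
    by (subst MC.emeasure_CI[of _ "Suc n", OF _ X]) (auto simp: prod_emb_id)
  finally show ?thesis by (simp only: emeasure_C_path)
qed

definition hitting_time :: "'s set \<Rightarrow> (nat \<Rightarrow> 's) \<Rightarrow> enat"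
  where "hitting_time A \<omega> = Inf (enat ` {n. \<omega> n \<in> A})"

lemma measurable_hitting_time:
  "hitting_time A \<in> PiM UNIV (\<lambda>_. count_space UNIV) \<rightarrow>\<^sub>M count_space UNIV"
proof -
  have [measurable]: "Measurable.pred (PiM UNIV (\<lambda>_. count_space UNIV)) (\<lambda>\<omega>. \<omega> n \<in> A)" for n
    by (rule measurable_compose[OF measurable_component_singleton[of n]]) auto
  have "(\<lambda>\<omega>. INF n. (if \<omega> n \<in> A then enat n else \<infinity>)) \<in> PiM UNIV (\<lambda>_. count_space UNIV) \<rightarrow>\<^sub>M count_space UNIV"
    by measurable
  also have "(\<lambda>\<omega>. INF n. (if \<omega> n \<in> A then enat n else \<infinity>)) = hitting_time A"
    by (intro ext antisym)
       (auto simp: hitting_time_def intro!: INF_greatest Inf_greatest intro: Inf_lower INF_lower2)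
  finally show ?thesis .
qed

definition first_steps :: "nat \<Rightarrow> (nat \<Rightarrow> 's) \<Rightarrow> 's list"
  where "first_steps n \<omega> = map \<omega> [0..<Suc n]"

lemma measurable_first_steps:
  "first_steps n \<in> PiM UNIV (\<lambda>_. count_space UNIV) \<rightarrow>\<^sub>M count_space (UNIV :: ('s :: countable) list set)"
  unfolding first_steps_def
proof (induction n)
  case 0 show ?case by simp measurable
next
  case (Suc n)
  note Suc[measurable]
  have "(\<lambda>\<omega>. map \<omega> [0..<Suc n] @ [\<omega> (Suc n)]) \<in>
     PiM UNIV (\<lambda>_. count_space UNIV) \<rightarrow>\<^sub>M count_space (UNIV :: ('s :: countable) list set)"
    by measurable
  then show ?case by simp
qed

text \<open>
  Weak convergence on a discrete space, where every bounded function is bounded continuous.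
\<close>

definition conv_in_dist :: "(nat \<Rightarrow> 'b measure) \<Rightarrow> 'b measure \<Rightarrow> bool"
  where "conv_in_dist \<mu> \<nu> \<longleftrightarrow>
    (\<forall>f :: 'b \<Rightarrow> real. bounded (range f) \<longrightarrow> (\<lambda>R. \<integral>x. f x \<partial>\<mu> R) \<longlonglongrightarrow> (\<integral>x. f x \<partial>\<nu>))"

section \<open>The killed random walk\<close>

text \<open>
  \<open>None\<close> is the cemetery state.  The function below is \<open>Q\<close>; by \<open>pmf_krw_kernel\<close> it is a
  genuine transition kernel whenever \<open>k\<close> takes values in \<open>{0..1}\<close>.
\<close>

fun krw_prob :: "(int ^ 'd \<Rightarrow> real) \<Rightarrow> (int ^ 'd) option \<Rightarrow> (int ^ 'd) option \<Rightarrow> real" where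
  "krw_prob k None None = 1"
| "krw_prob k None (Some y) = 0"
| "krw_prob k (Some x) None = k x"
| "krw_prob k (Some x) (Some y) = (1 - k x) / (2 * real CARD('d)) * of_bool (x \<sim>\<^sub>Z y)"

definition krw_kernel :: "(int ^ 'd \<Rightarrow> real) \<Rightarrow> (int ^ 'd) option \<Rightarrow> (int ^ 'd) option pmf"
  where "krw_kernel k s = embed_pmf (krw_prob k s)"

lemma pmf_krw_kernel:
  fixes k :: "int ^ 'd \<Rightarrow> real"
  assumes "\<And>x. k x \<in> {0..1}"
  shows "pmf (krw_kernel k s) t = krw_prob k s t"
proof -
  have nonneg: "krw_prob k s t \<ge> 0" for t
    using assms by (cases "(k, s, t)" rule: krw_prob.cases) auto
  have "(\<integral>\<^sup>+t. ennreal (krw_prob k s t) \<partial>count_space UNIV) = 1"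
  proof (cases s)
    case None
    have "(\<integral>\<^sup>+t. ennreal (krw_prob k s t) \<partial>count_space UNIV) =
        (\<Sum>t\<in>{None}. ennreal (krw_prob k s t))"
    proof (rule nn_integral_count_space')
      fix t show "t \<notin> {None} \<Longrightarrow> ennreal (krw_prob k s t) = 0" by (cases t) (auto simp: None)
    qed auto
    then show ?thesis by (simp add: None)
  next
    case (Some x)
    let ?N = "{y. x \<sim>\<^sub>Z y}"
    have "(\<integral>\<^sup>+t. ennreal (krw_prob k s t) \<partial>count_space UNIV) =
        (\<Sum>t\<in>insert None (Some ` ?N). ennreal (krw_prob k s t))"
    proof (rule nn_integral_count_space')
      show "finite (insert None (Some ` ?N))" by (simp add: card_neighbours)
      fix t show "t \<notin> insert None (Some ` ?N) \<Longrightarrow> ennreal (krw_prob k s t) = 0"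
        by (cases t) (auto simp: Some)
    qed auto
    also have "\<dots> = ennreal (\<Sum>t\<in>insert None (Some ` ?N). krw_prob k s t)"
      by (rule sum_ennreal) (rule nonneg)
    also have "(\<Sum>t\<in>insert None (Some ` ?N). krw_prob k s t) = k x + (\<Sum>y\<in>?N. krw_prob k s (Some y))"
      by (subst sum.insert) (auto simp: card_neighbours Some sum.reindex)
    also have "\<dots> = 1" by (simp add: Some card_neighbours)
    finally show ?thesis by simp
  qed
  then show ?thesis unfolding krw_kernel_def by (intro pmf_embed_pmf nonneg)
qed

definition krw :: "(int ^ 'd \<Rightarrow> real) \<Rightarrow> int ^ 'd \<Rightarrow> (nat \<Rightarrow> (int ^ 'd) option) measure"
  where "krw k x = chain_law (krw_kernel k) (Some x)"

text \<open>
  The complement of \<open>L\<close> is taken in the lattice, so it does not contain the cemetery state.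
\<close>

definition exits_alive :: "(int ^ 'd) set \<Rightarrow> (nat \<Rightarrow> (int ^ 'd) option) set"
  where "exits_alive L = {\<omega>. hitting_time (Some ` (- L)) \<omega> < hitting_time {None} \<omega>}"

lemma sets_exits_alive: "exits_alive L \<in> sets (krw k x)"
proof -
  have [measurable]: "hitting_time A \<in> borel_measurable (PiM UNIV (\<lambda>_. count_space UNIV))" for A :: "'b set"
    by (rule measurable_compose[OF measurable_hitting_time]) auto
  have "{\<omega> \<in> space (PiM UNIV (\<lambda>_. count_space UNIV)). hitting_time (Some ` (- L)) \<omega> < hitting_time {None} \<omega>}
      \<in> sets (PiM UNIV (\<lambda>_. count_space UNIV))"
    by measurable
  then show ?thesis by (simp add: krw_def sets_chain_law exits_alive_def space_PiM)
qed

text \<open>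
  Here \<open>uniform_measure M A\<close> is \<open>M\<close> conditioned on \<open>A\<close>.  The limiting chain on the survival set
  is given by one kernel \<open>K\<close>, the same for all starting points and exhaustions (its values
  off the survival set are irrelevant).
\<close>

definition conditioned_to_survive_well_defined :: "(int ^ 'd \<Rightarrow> real) \<Rightarrow> bool"
  where "conditioned_to_survive_well_defined k \<longleftrightarrow>
    (\<exists>K :: int ^ 'd \<Rightarrow> (int ^ 'd) pmf.
      (\<forall>y\<in>survival_set k. set_pmf (K y) \<subseteq> survival_set k) \<and>
      (\<forall>\<Lambda>. exhaustion \<Lambda> \<longrightarrow> (\<forall>x\<in>survival_set k. \<forall>n.
        conv_in_dist
          (\<lambda>R. distr (uniform_measure (krw k x) (exits_alive (\<Lambda> R))) (count_space UNIV) (first_steps n))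
          (distr (chain_law K x) (count_space UNIV) (\<lambda>\<omega>. first_steps n (Some \<circ> \<omega>))))))"

end

theory Submission
  imports Defs
begin

text \<open>
  Write \<open>h\<^sub>L(x)\<close> for the probability that the walk from \<open>x\<close> leaves \<open>L\<close> alive. It is massive
  harmonic on \<open>L\<close>, so everything reduces to comparing two positive massive harmonic functions
  \<open>u\<close>, \<open>v\<close> on a large cube. If Harnack's inequality holds on each shell \<open>|x|\<^sub>\<infinity> = n\<close> with a constant
  that does not depend on \<open>n\<close>, then the oscillation of \<open>u / v\<close> on the shell of size \<open>n\<close> is at most
  \<open>\<theta> < 1\<close> times its oscillation on the shell of size \<open>2 n\<close>; hence the ratios
  \<open>h\<^sub>L(x) / h\<^sub>L(x\<^sub>0)\<close> are Cauchy as \<open>L\<close> grows, uniformly over the choice of \<open>L\<close>. The conditioned walk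
  converges to the Doob transform by the limit.

  Harnack's inequality is elementary. With \<open>q = |x|\<^sup>2\<close> and \<open>t = (s - q)\<^sub>+\<close>, in the continuum
  \<open>d/ds [s\<^sup>-\<^sup>\<alpha> t\<^sup>3] = s\<^sup>-\<^sup>\<alpha>\<^sup>-\<^sup>1 \<Delta>(t\<^sup>4) / 16\<close> for \<open>\<alpha> = d/2 + 3\<close>, so the averages
  \<open>M(s) = s\<^sup>-\<^sup>\<alpha> \<Sum> t\<^sup>3 u\<close> are monotone in \<open>s\<close> for sub- and superharmonic \<open>u\<close>. On the lattice
  this survives up to relative errors that are summable in \<open>s\<close>, and a potential of size
  \<open>O(1/S)\<close> costs only a bounded factor up to \<open>s = S\<close>. This bounds \<open>u\<close> at the centre of a ball
  above and below by the same averages.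
\<close>

section \<open>Discrete Laplacian of the bump functions\<close>

text \<open>Near the origin the killing can be strong, even certain, so no Harnack inequality is
  available across the centre. It is proved only around points of a shell, at distance of order n
  from the origin, where k is O(n^-2): over a ball of radius comparable to n such a potential costs
  a bounded factor, and one constant serves every scale. The minimum principle, valid for every k
  with values in [0,1], then carries ratio bounds from a shell to the whole cube inside it.
  Dimension at least 2 lets a chain of small balls run around the shell; in dimension 1 a shell
  consists of two distant points. The exponent \<alpha> is fixed by scaling: the sum of t^3 over the
  lattice ball q < s grows like s^(d/2+3), so M(s) is, up to a constant, a weighted average of u.
  The parameters s and S are squared radii throughout, so a potential of size O(1/S) is one of
  inverse square order at the scale of the ball.\<close>

definition sqn :: "int ^ 'd \<Rightarrow> int"
  where "sqn x = (\<Sum>i\<in>UNIV. (x $ i)\<^sup>2)"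

definition lap :: "(int ^ 'd \<Rightarrow> real) \<Rightarrow> int ^ 'd \<Rightarrow> real"
  where "lap u x = (\<Sum>i\<in>UNIV. u (x + axis i 1) + u (x - axis i 1) - 2 * u x)"

lemma sqn_nonneg [simp]: "sqn x \<ge> 0"
  by (simp add: sqn_def sum_nonneg)

lemma sqn_zero [simp]: "sqn 0 = 0"
  by (simp add: sqn_def)

lemma enorm_squared: "(enorm x)\<^sup>2 = real_of_int (sqn x)"
  by (simp add: enorm_def norm_vec_def L2_set_def sqn_def sum_nonneg)

lemma component_le_sqn: "(x $ i)\<^sup>2 \<le> sqn x"
  unfolding sqn_def by (rule member_le_sum) auto

lemma sqn_add_le: "sqn (x + y) \<le> 2 * sqn x + 2 * sqn y"
proof -
  have "(x $ i + y $ i)\<^sup>2 \<le> 2 * (x $ i)\<^sup>2 + 2 * (y $ i)\<^sup>2" for i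
    using sum_squares_ge_zero[of "x $ i - y $ i" 0] by (simp add: power2_eq_square algebra_simps)
  then have "sqn (x + y) \<le> (\<Sum>i\<in>UNIV. 2 * (x $ i)\<^sup>2 + 2 * (y $ i)\<^sup>2)"
    unfolding sqn_def by (intro sum_mono) simp
  then show ?thesis by (simp add: sqn_def sum.distrib sum_distrib_left)
qed

lemma sqn_add_axis: "sqn (x + axis i c) = sqn x + 2 * c * x $ i + c\<^sup>2"
proof -
  have "sqn (x + axis i c) = (x $ i + c)\<^sup>2 + (\<Sum>j\<in>UNIV - {i}. (x $ j)\<^sup>2)"
    unfolding sqn_def by (subst sum.remove[of _ i]) (auto simp: axis_def intro!: sum.cong)
  also have "(\<Sum>j\<in>UNIV - {i}. (x $ j)\<^sup>2) = sqn x - (x $ i)\<^sup>2"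
    unfolding sqn_def by (subst (2) sum.remove[of _ i]) auto
  finally show ?thesis by (simp add: power2_eq_square algebra_simps)
qed

lemma axis_uminus: "axis i (- c :: int) = - axis i c"
  by (simp add: axis_def vec_eq_iff)

lemma sqn_diff_axis: "sqn (x - axis i 1) = sqn x - 2 * x $ i + 1"
  using sqn_add_axis[of x i "-1"] by (simp add: axis_uminus)

lemma finite_vec_components:
  assumes "\<And>i. finite (A i)"
  shows "finite {x :: 'a ^ 'd. \<forall>i. x $ i \<in> A i}"
proof (rule finite_subset)
  show "{x :: 'a ^ 'd. \<forall>i. x $ i \<in> A i} \<subseteq> vec_lambda ` (PiE UNIV A)"
    by (force intro!: image_eqI[where x = "vec_nth x" for x])
  show "finite (vec_lambda ` (PiE UNIV A))"
    using assms by (intro finite_imageI finite_PiE) auto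
qed

lemma finite_sqn_le: "finite {x :: int ^ 'd. sqn x \<le> m}"
proof (rule finite_subset)
  show "{x :: int ^ 'd. sqn x \<le> m} \<subseteq> {x. \<forall>i. x $ i \<in> {-m..m}}"
  proof safe
    fix x :: "int ^ 'd" and i assume "sqn x \<le> m"
    then have "(x $ i)\<^sup>2 \<le> m" using component_le_sqn[of x i] by simp
    moreover have "\<bar>x $ i\<bar> * 1 \<le> \<bar>x $ i\<bar> * \<bar>x $ i\<bar>"
    proof (cases "x $ i = 0")
      case False
      then show ?thesis by (intro mult_left_mono) auto
    qed simp
    then have "\<bar>x $ i\<bar> \<le> (x $ i)\<^sup>2"
      by (simp add: power2_eq_square)
    ultimately show "x $ i \<in> {-m..m}" by auto
  qed
qed (rule finite_vec_components, simp)

lemma finite_sqn_less: "finite {x :: int ^ 'd. sqn x < m}"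
  by (rule finite_subset[OF _ finite_sqn_le[of m]]) auto

lemma sum_shift:
  fixes g u :: "int ^ 'd \<Rightarrow> real"
  assumes "finite D" and "\<And>y. g y \<noteq> 0 \<Longrightarrow> y \<in> D \<and> y - e \<in> D"
  shows "(\<Sum>x\<in>D. u x * g (x + e)) = (\<Sum>y\<in>D. u (y - e) * g y)"
proof -
  let ?A = "{y\<in>D. g y \<noteq> 0}"
  have "(\<Sum>y\<in>D. u (y - e) * g y) = (\<Sum>y\<in>?A. u (y - e) * g y)"
    using assms(1) by (intro sum.mono_neutral_right) auto
  also have "\<dots> = (\<Sum>x\<in>(\<lambda>y. y - e) ` ?A. u x * g (x + e))"
    by (subst sum.reindex) (auto simp: inj_on_def)
  also have "\<dots> = (\<Sum>x\<in>D. u x * g (x + e))"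
  proof (rule sum.mono_neutral_left)
    show "\<forall>x\<in>D - (\<lambda>y. y - e) ` ?A. u x * g (x + e) = 0"
    proof
      fix x assume x: "x \<in> D - (\<lambda>y. y - e) ` ?A"
      have "g (x + e) = 0"
      proof (rule ccontr)
        assume "g (x + e) \<noteq> 0"
        then have "x + e \<in> ?A" using assms(2) by blast
        then have "x + e - e \<in> (\<lambda>y. y - e) ` ?A" by (rule imageI)
        then show False using x by simp
      qed
      then show "u x * g (x + e) = 0" by simp
    qed
  qed (use assms in auto)
  finally show ?thesis by simp
qed

text \<open>The condition on \<open>g\<close> keeps its support one step away from the edge of
  \<open>D\<close>, so that no boundary terms arise.\<close>

lemma sum_by_parts:
  fixes g u :: "int ^ 'd \<Rightarrow> real"
  assumes D: "finite D"
    and g: "\<And>y. g y \<noteq> 0 \<Longrightarrow> y \<in> D \<and> (\<forall>i. y + axis i 1 \<in> D \<and> y - axis i 1 \<in> D)"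
  shows "(\<Sum>x\<in>D. u x * lap g x) = (\<Sum>x\<in>D. g x * lap u x)"
proof -
  have 1: "(\<Sum>x\<in>D. u x * g (x + axis i 1)) = (\<Sum>x\<in>D. g x * u (x - axis i 1))" for i
    using sum_shift[of D g "axis i 1" u] D g by (simp add: mult.commute)
  have 2: "(\<Sum>x\<in>D. u x * g (x - axis i 1)) = (\<Sum>x\<in>D. g x * u (x + axis i 1))" for i
    using sum_shift[of D g "- axis i 1" u] D g by (simp add: mult.commute)
  have "(\<Sum>x\<in>D. u x * lap g x) = (\<Sum>i\<in>UNIV. \<Sum>x\<in>D. u x * (g (x + axis i 1) + g (x - axis i 1) - 2 * g x))"
    unfolding lap_def sum_distrib_left by (rule sum.swap)
  also have "\<dots> = (\<Sum>i\<in>UNIV. (\<Sum>x\<in>D. u x * g (x + axis i 1)) + (\<Sum>x\<in>D. u x * g (x - axis i 1)) - (\<Sum>x\<in>D. 2 * u x * g x))"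
    by (simp add: algebra_simps sum.distrib sum_subtractf)
  also have "\<dots> = (\<Sum>i\<in>UNIV. (\<Sum>x\<in>D. g x * u (x - axis i 1)) + (\<Sum>x\<in>D. g x * u (x + axis i 1)) - (\<Sum>x\<in>D. 2 * u x * g x))"
    by (simp only: 1 2)
  also have "\<dots> = (\<Sum>i\<in>UNIV. \<Sum>x\<in>D. g x * (u (x + axis i 1) + u (x - axis i 1) - 2 * u x))"
    by (simp add: algebra_simps sum.distrib sum_subtractf)
  also have "\<dots> = (\<Sum>x\<in>D. g x * lap u x)"
    unfolding lap_def sum_distrib_left by (rule sum.swap)
  finally show ?thesis .
qed

section \<open>Bump functions and the discrete form of the derivative identity\<close>

definition bump :: "nat \<Rightarrow> int ^ 'd \<Rightarrow> real"
  where "bump s x = max 0 (real s - of_int (sqn x))"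

lemma bump_nonneg [simp]: "bump s x \<ge> 0"
  by (simp add: bump_def)

lemma bump_le: "bump s x \<le> real s"
  by (simp add: bump_def)

text \<open>The even expansion of the untruncated powers contains 2 y^4. When |y| > \<tau>, one of
  the two terms is cut to 0, which loses (|y| - \<tau>)^4 \<le> y^4; giving up one y^4 pays for
  this.\<close>

lemma quartic_lower:
  fixes \<tau> y :: real
  assumes "\<tau> \<ge> 0"
  shows "2 * \<tau>^4 + 12 * \<tau>\<^sup>2 * y\<^sup>2 + y^4 \<le> max 0 (\<tau> + y) ^ 4 + max 0 (\<tau> - y) ^ 4"
proof -
  have main: "2 * \<tau>^4 + 12 * \<tau>\<^sup>2 * z\<^sup>2 + z^4 \<le> max 0 (\<tau> + z) ^ 4 + max 0 (\<tau> - z) ^ 4" if "z \<ge> 0" for z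
  proof -
    have e: "(\<tau> + z)^4 + (\<tau> - z)^4 = 2 * \<tau>^4 + 12 * \<tau>\<^sup>2 * z\<^sup>2 + 2 * z^4" by algebra
    show ?thesis
    proof (cases "\<tau> \<ge> z")
      case True
      have "0 \<le> z ^ 4" by simp
      then show ?thesis using True assms that e by (simp add: max_def)
    next
      case False
      have "(z - \<tau>)^4 \<le> z^4" using False assms by (intro power_mono) auto
      moreover have "(z - \<tau>)^4 = (\<tau> - z)^4" by algebra
      ultimately show ?thesis using False assms that e by (simp add: max_def)
    qed
  qed
  show ?thesis
  proof (cases "y \<ge> 0")
    case False
    then show ?thesis using main[of "- y"] by (simp add: add.commute)
  qed (rule main)
qed

lemma quartic_upper:
  fixes \<tau> y :: real
  shows "max 0 (\<tau> + y) ^ 4 + max 0 (\<tau> - y) ^ 4 \<le> 2 * \<tau>^4 + 12 * \<tau>\<^sup>2 * y\<^sup>2 + 2 * y^4"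
proof -
  have "max 0 z ^ 4 \<le> z ^ 4" for z :: real by (auto simp: max_def)
  from this[of "\<tau> + y"] this[of "\<tau> - y"]
  have "max 0 (\<tau> + y) ^ 4 + max 0 (\<tau> - y) ^ 4 \<le> (\<tau> + y)^4 + (\<tau> - y)^4" by simp
  also have "\<dots> = 2 * \<tau>^4 + 12 * \<tau>\<^sup>2 * y\<^sup>2 + 2 * y^4" by algebra
  finally show ?thesis .
qed

lemma sum_fourth_powers_ge:
  fixes x :: "int ^ 'd"
  shows "(of_int (sqn x))\<^sup>2 / real CARD('d) \<le> (\<Sum>i\<in>UNIV. (real_of_int (x $ i))^4)"
proof -
  have "(\<Sum>i\<in>UNIV. (real_of_int (x $ i))\<^sup>2 * 1)\<^sup>2 \<le> (\<Sum>i\<in>UNIV. ((real_of_int (x $ i))\<^sup>2)\<^sup>2) * (\<Sum>i\<in>(UNIV::'d set). 1\<^sup>2)"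
    by (rule Cauchy_Schwarz_ineq_sum)
  moreover have "(\<Sum>i\<in>UNIV. (real_of_int (x $ i))\<^sup>2 * 1) = of_int (sqn x)"
    by (simp add: sqn_def)
  ultimately show ?thesis by (simp add: divide_le_eq flip: power_mult)
qed

lemma sum_fourth_powers_le:
  fixes x :: "int ^ 'd"
  shows "(\<Sum>i\<in>UNIV. (real_of_int (x $ i))^4) \<le> (of_int (sqn x))\<^sup>2"
proof -
  have "(\<Sum>i\<in>UNIV. (real_of_int (x $ i))^4) \<le> (\<Sum>i\<in>UNIV. (real_of_int (x $ i))\<^sup>2 * of_int (sqn x))"
  proof (rule sum_mono)
    fix i
    have "(real_of_int (x $ i))\<^sup>2 * (real_of_int (x $ i))\<^sup>2 \<le> (real_of_int (x $ i))\<^sup>2 * of_int (sqn x)"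
      using component_le_sqn[of x i] by (intro mult_left_mono) (auto simp flip: of_int_power)
    then show "(real_of_int (x $ i))^4 \<le> (real_of_int (x $ i))\<^sup>2 * of_int (sqn x)"
      by (simp flip: power_add)
  qed
  also have "\<dots> = (of_int (sqn x))\<^sup>2"
    unfolding power2_eq_square[of "of_int (sqn x)"] by (simp add: sqn_def flip: sum_distrib_right)
  finally show ?thesis .
qed

text \<open>A step along an axis changes q by 1 + 2 x_i or 1 - 2 x_i, so the two neighbouring values
  are symmetric about t - 1 and not about t. This shift is one source of the lower-order errors
  below.\<close>

lemma lap_bump4:
  "lap (\<lambda>y. bump s y ^ 4) x = (\<Sum>i\<in>UNIV.
    max 0 ((real s - of_int (sqn x) - 1) + 2 * of_int (x $ i)) ^ 4 +
    max 0 ((real s - of_int (sqn x) - 1) - 2 * of_int (x $ i)) ^ 4 - 2 * bump s x ^ 4)"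
  unfolding lap_def
proof (rule sum.cong[OF refl])
  fix i
  have "bump s (x + axis i 1) = max 0 ((real s - of_int (sqn x) - 1) - 2 * of_int (x $ i))"
    "bump s (x - axis i 1) = max 0 ((real s - of_int (sqn x) - 1) + 2 * of_int (x $ i))"
    by (simp_all add: bump_def sqn_add_axis sqn_diff_axis algebra_simps)
  then show "bump s (x + axis i 1) ^ 4 + bump s (x - axis i 1) ^ 4 - 2 * bump s x ^ 4 =
    max 0 ((real s - of_int (sqn x) - 1) + 2 * of_int (x $ i)) ^ 4 +
    max 0 ((real s - of_int (sqn x) - 1) - 2 * of_int (x $ i)) ^ 4 - 2 * bump s x ^ 4" by simp
qed

text \<open>
  The discretisation error \<open>q t\<close> on the right is not of relative size \<open>O(1/s)\<close>; it is absorbed by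
  the fourth-order term \<open>q\<^sup>2 / d\<close> of the discrete Laplacian, which has the favourable sign.
  Since \<open>s\<close> and \<open>q\<close> are integers, the boundary layer \<open>0 < t < 1\<close> does not occur.
\<close>

lemma bump_difference_upper:
  fixes x :: "int ^ 'd"
  defines "d \<equiv> real CARD('d)"
  assumes s: "real s \<ge> 16 * d"
  shows "16 * real s * (bump (Suc s) x ^ 3 - bump s x ^ 3) - 16 * (d / 2 + 3) * bump s x ^ 3
    \<le> lap (\<lambda>y. bump s y ^ 4) x + (400 * d + 64) * (bump s x)\<^sup>2"
proof -
  define t where "t = int s - sqn x"
  define q where "q = real_of_int (sqn x)"
  define F where "F = (\<Sum>i\<in>UNIV. (real_of_int (x $ i))^4)"
  have d1: "d \<ge> 1" unfolding d_def by (simp add: Suc_leI)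
  have q0: "q \<ge> 0" by (simp add: q_def)
  have sq: "real s = q + real_of_int t" by (simp add: q_def t_def)
  have F: "F \<ge> q\<^sup>2 / d" unfolding F_def d_def q_def by (rule sum_fourth_powers_ge)
  have b: "bump s x = max 0 (real_of_int t)" "bump (Suc s) x = max 0 (real_of_int t + 1)"
    by (simp_all add: bump_def t_def algebra_simps)
  have rt: "real s - of_int (sqn x) - 1 = real_of_int t - 1" by (simp add: t_def)
  consider "t \<ge> 1" | "t = 0" | "t \<le> -1" by linarith
  then show ?thesis
  proof cases
    case 1
    define \<tau> where "\<tau> = real_of_int t"
    have \<tau>: "\<tau> \<ge> 1" using 1 by (simp add: \<tau>_def)
    have b: "bump s x = \<tau>" "bump (Suc s) x = \<tau> + 1" using b 1 by (auto simp: \<tau>_def)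
    have "lap (\<lambda>y. bump s y ^ 4) x \<ge> (\<Sum>i\<in>UNIV. 2 * (\<tau> - 1)^4 + 12 * (\<tau> - 1)\<^sup>2 * (2 * of_int (x $ i))\<^sup>2
        + (2 * of_int (x $ i))^4 - 2 * \<tau>^4)"
      unfolding lap_bump4 rt b \<tau>_def[symmetric]
      using \<tau> by (intro sum_mono diff_right_mono quartic_lower) simp
    also have "(\<Sum>i\<in>UNIV. 2 * (\<tau> - 1)^4 + 12 * (\<tau> - 1)\<^sup>2 * (2 * of_int (x $ i))\<^sup>2
        + (2 * of_int (x $ i))^4 - 2 * \<tau>^4) = d * (2 * (\<tau> - 1)^4 - 2 * \<tau>^4) + 48 * (\<tau> - 1)\<^sup>2 * q + 16 * F"
      by (simp add: sum.distrib sum_subtractf power_mult_distrib d_def q_def F_def sqn_def sum_distrib_left algebra_simps)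
    finally have L: "lap (\<lambda>y. bump s y ^ 4) x \<ge> d * (2 * (\<tau> - 1)^4 - 2 * \<tau>^4) + 48 * (\<tau> - 1)\<^sup>2 * q + 16 * F" .
    have "2 * (\<tau> - 1)^4 - 2 * \<tau>^4 = - 8 * \<tau>^3 + (8 * \<tau> * (\<tau> - 1) + 4 * \<tau>\<^sup>2 + 2)" by algebra
    moreover have "8 * \<tau> * (\<tau> - 1) + 4 * \<tau>\<^sup>2 + 2 \<ge> 0" using \<tau> by simp
    ultimately have a1: "d * (2 * (\<tau> - 1)^4 - 2 * \<tau>^4) \<ge> d * (- 8 * \<tau>^3)"
      using d1 by (intro mult_left_mono) linarith+
    have "(\<tau> - 1)\<^sup>2 \<ge> \<tau>\<^sup>2 - 2 * \<tau>" by (simp add: power2_eq_square algebra_simps)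
    then have a2: "48 * (\<tau> - 1)\<^sup>2 * q \<ge> 48 * (\<tau>\<^sup>2 - 2 * \<tau>) * q" using q0 by (intro mult_right_mono) auto
    \<comment> \<open>This square absorbs the discretisation error 160 q \<tau>: 96 q \<tau> is lost
      when (\<tau> - 1)^2 is replaced by \<tau>^2 - 2 \<tau>, and 64 q \<tau> comes from the
      lower-order part of the difference of cubes.\<close>
    have "0 \<le> (4 * q - 20 * d * \<tau>)\<^sup>2 / d" using d1 by simp
    also have "\<dots> = 16 * (q\<^sup>2 / d) - 160 * q * \<tau> + 400 * d * \<tau>\<^sup>2"
      using d1 by (simp add: field_simps power2_eq_square)
    finally have a3: "160 * q * \<tau> \<le> 16 * F + 400 * d * \<tau>\<^sup>2" using F by linarith
    have "16 * real s * (bump (Suc s) x ^ 3 - bump s x ^ 3) - 16 * (d / 2 + 3) * bump s x ^ 3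
      = 48 * q * \<tau>\<^sup>2 - 8 * d * \<tau>^3 + 16 * (q + \<tau>) * (3 * \<tau> + 1)"
      unfolding b sq \<tau>_def[symmetric] by (simp add: field_simps power2_eq_square power3_eq_cube)
    also have "16 * (q + \<tau>) * (3 * \<tau> + 1) \<le> 16 * (q + \<tau>) * (4 * \<tau>)"
      using q0 \<tau> by (intro mult_left_mono) auto
    finally show ?thesis using L a1 a2 a3 unfolding b
      by (simp add: algebra_simps power2_eq_square)
  next
    \<comment> \<open>On the sphere q = s the cube of the bump jumps from 0 to 1, so the left side
      is 16 s. The Laplacian is at least q^2 / d there, which is at least 16 q = 16 s because s
      \<ge> 16 d.\<close>
    case 2
    have b: "bump s x = 0" "bump (Suc s) x = 1" using b 2 by auto
    have "lap (\<lambda>y. bump s y ^ 4) x \<ge> (\<Sum>i\<in>UNIV. (real_of_int (x $ i))^4)"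
      unfolding lap_bump4 rt b 2
    proof (rule sum_mono)
      fix i :: 'd
      define m where "m = \<bar>x $ i\<bar>"
      have "(real_of_int (x $ i))^4 = (real_of_int m)^4" by (simp add: m_def flip: power_abs)
      moreover have "real_of_int m \<le> max 0 (-1 + 2 * real_of_int m)"
      proof (cases "m = 0")
        case False
        then have "m \<ge> 1" by (simp add: m_def)
        then have "real_of_int m \<ge> 1" by simp
        then show ?thesis by simp
      qed simp
      then have "(real_of_int m)^4 \<le> max 0 (-1 + 2 * real_of_int m)^4"
        by (intro power_mono) (auto simp: m_def)
      moreover have "max 0 (-1 + 2 * real_of_int m)^4 \<le> max 0 (-1 + 2 * real_of_int (x $ i))^4 + max 0 (-1 - 2 * real_of_int (x $ i))^4"
        by (cases "x $ i \<ge> 0") (auto simp: m_def)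
      ultimately show "(real_of_int (x $ i))^4 \<le> max 0 (real_of_int 0 - 1 + 2 * real_of_int (x $ i))^4
          + max 0 (real_of_int 0 - 1 - 2 * real_of_int (x $ i))^4 - 2 * 0 ^ 4" by simp
    qed
    then have "lap (\<lambda>y. bump s y ^ 4) x \<ge> q\<^sup>2 / d" using F unfolding F_def by linarith
    moreover have "q\<^sup>2 / d \<ge> 16 * q"
    proof -
      have "q \<ge> 16 * d" using s sq 2 by simp
      then have "q * q \<ge> q * (16 * d)" using q0 by (intro mult_left_mono)
      then show ?thesis using d1 by (simp add: field_simps power2_eq_square)
    qed
    ultimately show ?thesis unfolding b using sq 2 by simp
  next
    case 3
    then have b: "bump s x = 0" "bump (Suc s) x = 0" using b by auto
    have "lap (\<lambda>y. bump s y ^ 4) x \<ge> 0" unfolding lap_bump4 b by (intro sum_nonneg) simp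
    then show ?thesis unfolding b by simp
  qed
qed

text \<open>The expansion of \<open>bump_difference_upper\<close> with the estimates reversed. The
  fourth-order terms now stand on the unfavourable side and are kept as the error 32 q^2. Beyond q =
  4 s the Laplacian vanishes, since no neighbour of such a point lies in the ball q < s.\<close>

lemma bump_difference_lower:
  fixes x :: "int ^ 'd"
  defines "d \<equiv> real CARD('d)"
  assumes s: "s \<ge> 2"
  shows "lap (\<lambda>y. bump s y ^ 4) x - 12 * d * (bump s x)\<^sup>2 - (if sqn x \<le> 4 * int s then 32 * (of_int (sqn x))\<^sup>2 else 0)
    \<le> 16 * real s * (bump (Suc s) x ^ 3 - bump s x ^ 3) - 16 * (d / 2 + 3) * bump s x ^ 3"
proof -
  define t where "t = int s - sqn x"
  define q where "q = real_of_int (sqn x)"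
  define F where "F = (\<Sum>i\<in>UNIV. (real_of_int (x $ i))^4)"
  have d1: "d \<ge> 1" unfolding d_def by (simp add: Suc_leI)
  have q0: "q \<ge> 0" by (simp add: q_def)
  have sq: "real s = q + real_of_int t" by (simp add: q_def t_def)
  have F: "F \<le> q\<^sup>2" unfolding F_def q_def by (rule sum_fourth_powers_le)
  have b: "bump s x = max 0 (real_of_int t)" "bump (Suc s) x = max 0 (real_of_int t + 1)"
    by (simp_all add: bump_def t_def algebra_simps)
  have rt: "real s - of_int (sqn x) - 1 = real_of_int t - 1" by (simp add: t_def)
  show ?thesis
  proof (cases "t \<ge> 1")
    case True
    define \<tau> where "\<tau> = real_of_int t"
    have \<tau>: "\<tau> \<ge> 1" using True by (simp add: \<tau>_def)
    have b: "bump s x = \<tau>" "bump (Suc s) x = \<tau> + 1" using b True by (auto simp: \<tau>_def)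
    have "lap (\<lambda>y. bump s y ^ 4) x \<le> (\<Sum>i\<in>UNIV. 2 * (\<tau> - 1)^4 + 12 * (\<tau> - 1)\<^sup>2 * (2 * of_int (x $ i))\<^sup>2
        + 2 * (2 * of_int (x $ i))^4 - 2 * \<tau>^4)"
      unfolding lap_bump4 rt b \<tau>_def[symmetric]
      by (intro sum_mono diff_right_mono quartic_upper)
    also have "\<dots> = d * (2 * (\<tau> - 1)^4 - 2 * \<tau>^4) + 48 * (\<tau> - 1)\<^sup>2 * q + 32 * F"
      by (simp add: sum.distrib sum_subtractf power_mult_distrib d_def q_def F_def sqn_def sum_distrib_left algebra_simps)
    finally have L: "lap (\<lambda>y. bump s y ^ 4) x \<le> d * (2 * (\<tau> - 1)^4 - 2 * \<tau>^4) + 48 * (\<tau> - 1)\<^sup>2 * q + 32 * F" .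
    have "2 * (\<tau> - 1)^4 - 2 * \<tau>^4 = - 8 * \<tau>^3 + 12 * \<tau>\<^sup>2 - (8 * \<tau> - 2)" by algebra
    then have a1: "d * (2 * (\<tau> - 1)^4 - 2 * \<tau>^4) \<le> d * (- 8 * \<tau>^3 + 12 * \<tau>\<^sup>2)"
      using d1 \<tau> by (intro mult_left_mono) linarith+
    have "(\<tau> - 1)\<^sup>2 \<le> \<tau>\<^sup>2" using \<tau> by (intro power_mono) auto
    then have a2: "48 * (\<tau> - 1)\<^sup>2 * q \<le> 48 * \<tau>\<^sup>2 * q" using q0 by (intro mult_right_mono) auto
    have "16 * real s * (bump (Suc s) x ^ 3 - bump s x ^ 3) - 16 * (d / 2 + 3) * bump s x ^ 3
      = 48 * q * \<tau>\<^sup>2 - 8 * d * \<tau>^3 + 16 * (q + \<tau>) * (3 * \<tau> + 1)"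
      unfolding b sq \<tau>_def[symmetric] by (simp add: field_simps power2_eq_square power3_eq_cube)
    moreover have "16 * (q + \<tau>) * (3 * \<tau> + 1) \<ge> 0" using q0 \<tau> by simp
    moreover have "sqn x \<le> 4 * int s" using True s unfolding t_def by linarith
    ultimately show ?thesis using L a1 a2 F unfolding b q_def[symmetric]
      by (simp add: algebra_simps)
  next
    case False
    then have b0: "bump s x = 0" using b by auto
    have "lap (\<lambda>y. bump s y ^ 4) x \<le> (if sqn x \<le> 4 * int s then 32 * (of_int (sqn x))\<^sup>2 else 0)"
    proof (cases "sqn x \<le> 4 * int s")
      case True
      have "lap (\<lambda>y. bump s y ^ 4) x \<le> (\<Sum>i\<in>UNIV. 16 * (real_of_int (x $ i))^4)"
        unfolding lap_bump4 rt b0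
      proof (rule sum_mono)
        fix i :: 'd
        define m where "m = \<bar>x $ i\<bar>"
        have "(real_of_int (x $ i))^4 = (real_of_int m)^4" by (simp add: m_def flip: power_abs)
        moreover have "max 0 (real_of_int t - 1 + 2 * real_of_int m)^4 \<le> (2 * real_of_int m)^4"
          using False by (intro power_mono) (auto simp: m_def)
        moreover have "max 0 (real_of_int t - 1 + 2 * real_of_int (x $ i))^4 + max 0 (real_of_int t - 1 - 2 * real_of_int (x $ i))^4 \<le> max 0 (real_of_int t - 1 + 2 * real_of_int m)^4"
          using False by (cases "x $ i \<ge> 0") (auto simp: m_def max_def)
        ultimately show "max 0 (real_of_int t - 1 + 2 * real_of_int (x $ i))^4
          + max 0 (real_of_int t - 1 - 2 * real_of_int (x $ i))^4 - 2 * 0 ^ 4 \<le> 16 * (real_of_int (x $ i))^4"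
          by (simp add: power_mult_distrib)
      qed
      also have "\<dots> = 16 * F" by (simp add: F_def sum_distrib_left)
      also have "\<dots> \<le> 32 * q\<^sup>2" using F zero_le_power2[of q] by linarith
      finally show ?thesis using True by (simp add: q_def)
    next
      case far: False
      have "\<bar>2 * x $ i\<bar> \<le> sqn x - int s" for i
      proof -
        \<comment> \<open>From q > 4 s follows q - s \<ge> 3 q / 4, hence (q - s)^2 \<ge> 9 q^2 / 16
          \<ge> 4 q, because s \<ge> 2 forces q \<ge> 9.\<close>
        have *: "4 * sqn x \<le> (sqn x - int s)\<^sup>2"
        proof -
          have "sqn x \<ge> 9" using far s by linarith
          have "4 * (sqn x - int s) \<ge> 3 * sqn x" using far by (simp add: right_diff_distrib)
          with \<open>sqn x \<ge> 9\<close> have "(3 * sqn x)\<^sup>2 \<le> (4 * (sqn x - int s))\<^sup>2" by (intro power_mono) auto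
          moreover have "64 * sqn x \<le> (3 * sqn x)\<^sup>2" using \<open>sqn x \<ge> 9\<close> by (simp add: power2_eq_square)
          moreover have "(4 * (sqn x - int s))\<^sup>2 = 16 * (sqn x - int s)\<^sup>2"
            unfolding power_mult_distrib by simp
          ultimately show ?thesis by linarith
        qed
        have "(2 * x $ i)\<^sup>2 \<le> (sqn x - int s)\<^sup>2"
          using * component_le_sqn[of x i] by (simp add: power_mult_distrib)
        then have "\<bar>2 * x $ i\<bar> \<le> \<bar>sqn x - int s\<bar>" by (simp only: abs_le_square_iff)
        then show ?thesis using far s by linarith
      qed
      then have *: "\<bar>2 * real_of_int (x $ i)\<bar> \<le> - t" for i
        unfolding t_def by (metis (no_types, lifting) minus_diff_eq of_int_abs of_int_le_iff of_int_mult of_int_numeral)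
      have "lap (\<lambda>y. bump s y ^ 4) x = (\<Sum>i\<in>(UNIV :: 'd set). 0)"
        unfolding lap_bump4 rt b0
      proof (rule sum.cong[OF refl])
        fix i :: 'd
        have "real_of_int t - 1 + 2 * real_of_int (x $ i) \<le> 0" "real_of_int t - 1 - 2 * real_of_int (x $ i) \<le> 0"
          using *[of i] abs_ge_self[of "2 * real_of_int (x $ i)"] abs_ge_minus_self[of "2 * real_of_int (x $ i)"] by simp_all
        note z = this[THEN max_absorb1]
        show "max 0 (real_of_int t - 1 + 2 * real_of_int (x $ i))^4 + max 0 (real_of_int t - 1 - 2 * real_of_int (x $ i))^4 - 2 * 0 ^ 4 = 0"
          by (simp only: z)
      qed
      then show ?thesis using far by simp
    qed
    moreover have "0 \<le> 16 * real s * (bump (Suc s) x ^ 3 - bump s x ^ 3) - 16 * (d / 2 + 3) * bump s x ^ 3"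
      by (simp add: b0)
    moreover have "12 * d * (bump s x)\<^sup>2 = 0" by (simp add: b0)
    ultimately show ?thesis by linarith
  qed
qed

section \<open>Harnack inequality on balls\<close>

text \<open>A discrete substitute for s^-\<alpha>, comparable to it. The product form makes the
  recursion \<open>wt_Suc\<close> exact, so that differencing the weight creates no error
  term.\<close>

definition wt :: "real \<Rightarrow> nat \<Rightarrow> real"
  where "wt \<alpha> s = (\<Prod>j\<in>{1..<s}. inverse (1 + \<alpha> / real j))"

lemma wt_pos: "\<alpha> \<ge> 0 \<Longrightarrow> wt \<alpha> s > 0"
  unfolding wt_def by (intro prod_pos) (auto intro!: add_pos_nonneg)

lemma wt_Suc: "s \<ge> 1 \<Longrightarrow> \<alpha> \<ge> 0 \<Longrightarrow> wt \<alpha> s = (1 + \<alpha> / real s) * wt \<alpha> (Suc s)"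
proof -
  assume "s \<ge> 1" "\<alpha> \<ge> 0"
  then have "wt \<alpha> (Suc s) = wt \<alpha> s * inverse (1 + \<alpha> / real s)"
    by (simp add: wt_def prod.atLeastLessThan_Suc)
  moreover have "1 + \<alpha> / real s > 0" using \<open>\<alpha> \<ge> 0\<close> by (intro add_pos_nonneg) auto
  ultimately show ?thesis by (simp add: field_simps)
qed

lemma wt_Suc_le: "s \<ge> 1 \<Longrightarrow> \<alpha> \<ge> 0 \<Longrightarrow> wt \<alpha> (Suc s) \<le> wt \<alpha> s"
proof -
  assume "s \<ge> 1" "\<alpha> \<ge> 0"
  then have "1 * wt \<alpha> (Suc s) \<le> (1 + \<alpha> / real s) * wt \<alpha> (Suc s)"
    using wt_pos[of \<alpha> "Suc s"] by (intro mult_right_mono) auto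
  then show ?thesis using wt_Suc[OF \<open>s \<ge> 1\<close> \<open>\<alpha> \<ge> 0\<close>] by simp
qed

text \<open>Each factor between s and r is at most exp(\<alpha> / s). For r a fixed multiple of s
  the total is a constant, which makes averages over comparable balls comparable.\<close>

lemma wt_doubling:
  assumes "s \<ge> 1" "\<alpha> \<ge> 0" "s \<le> r"
  shows "wt \<alpha> s \<le> exp (\<alpha> * (real r - real s) / real s) * wt \<alpha> r"
  using \<open>s \<le> r\<close>
proof (induction r rule: dec_induct)
  case (step r)
  have "1 + \<alpha> / real r \<le> 1 + \<alpha> / real s" using assms step by (intro add_left_mono divide_left_mono) auto
  also have "\<dots> \<le> exp (\<alpha> / real s)" by (rule exp_ge_add_one_self)
  finally have "1 + \<alpha> / real r \<le> exp (\<alpha> / real s)" .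
  then have "(1 + \<alpha> / real r) * wt \<alpha> (Suc r) \<le> exp (\<alpha> / real s) * wt \<alpha> (Suc r)"
    using wt_pos[of \<alpha> "Suc r"] assms by (intro mult_right_mono) auto
  then have "wt \<alpha> r \<le> exp (\<alpha> / real s) * wt \<alpha> (Suc r)"
    using wt_Suc[of r \<alpha>] assms step by simp
  then have "exp (\<alpha> * (real r - real s) / real s) * wt \<alpha> r \<le>
      exp (\<alpha> * (real r - real s) / real s) * (exp (\<alpha> / real s) * wt \<alpha> (Suc r))"
    by (intro mult_left_mono) auto
  also have "\<dots> = exp (\<alpha> * (real r - real s) / real s + \<alpha> / real s) * wt \<alpha> (Suc r)"
    by (simp add: exp_add)
  also have "\<alpha> * (real r - real s) / real s + \<alpha> / real s = \<alpha> * (real (Suc r) - real s) / real s"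
    using assms by (simp add: field_simps)
  finally show ?case using step.IH by linarith
qed simp

text \<open>The average M(s) of the overview, centred at the origin; other centres are reached
  through \<open>lap_translate\<close>.\<close>

definition mass :: "(int ^ 'd \<Rightarrow> real) \<Rightarrow> nat \<Rightarrow> real"
  where "mass u s = wt (real CARD('d) / 2 + 3) s * (\<Sum>x | sqn x < int s. bump s x ^ 3 * u x)"

lemma bump_eq_0: "\<not> sqn x < int s \<Longrightarrow> bump s x = 0"
  unfolding bump_def by simp

lemma mass_eq:
  fixes u :: "int ^ 'd \<Rightarrow> real"
  assumes "finite D" "{x. sqn x < int s} \<subseteq> D"
  shows "mass u s = wt (real CARD('d) / 2 + 3) s * (\<Sum>x\<in>D. bump s x ^ 3 * u x)"
  unfolding mass_def using assms
  by (intro arg_cong[where f = "(*) _"] sum.mono_neutral_left) (auto simp: bump_eq_0)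

lemma mass_nonneg: "(\<And>x. u x \<ge> 0) \<Longrightarrow> mass u s \<ge> 0"
  unfolding mass_def by (intro mult_nonneg_nonneg sum_nonneg less_imp_le[OF wt_pos]) auto

text \<open>Integrality of s and q excludes a point where the bump grows by an amount strictly
  between 0 and 1.\<close>

lemma bump_Suc_cases:
  obtains "bump (Suc s) x = bump s x + 1" | "bump s x = 0" "bump (Suc s) x = 0"
proof (cases "sqn x \<le> int s")
  case True
  then have "real_of_int (sqn x) \<le> real s" by linarith
  then show ?thesis using that(1) by (simp add: bump_def)
next
  case False
  then show ?thesis using that(2) by (simp add: bump_eq_0)
qed

text \<open>The recursion of the weight produces exactly the pointwise expression that
  \<open>bump_difference_upper\<close> and \<open>bump_difference_lower\<close> estimate.\<close>

lemma mass_difference: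
  fixes u :: "int ^ 'd \<Rightarrow> real"
  defines "\<alpha> \<equiv> real CARD('d) / 2 + 3"
  assumes "finite D" "{x. sqn x \<le> int s} \<subseteq> D" "s \<ge> 1"
  shows "mass u (Suc s) - mass u s = wt \<alpha> (Suc s) / (16 * real s) *
    (\<Sum>x\<in>D. u x * (16 * real s * (bump (Suc s) x ^ 3 - bump s x ^ 3) - 16 * \<alpha> * bump s x ^ 3))"
proof -
  have "\<alpha> \<ge> 0" by (simp add: \<alpha>_def)
  have "mass u (Suc s) = wt \<alpha> (Suc s) * (\<Sum>x\<in>D. bump (Suc s) x ^ 3 * u x)"
    unfolding \<alpha>_def using assms by (intro mass_eq) auto
  moreover have "mass u s = (1 + \<alpha> / real s) * wt \<alpha> (Suc s) * (\<Sum>x\<in>D. bump s x ^ 3 * u x)"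
    using assms wt_Suc[OF \<open>s \<ge> 1\<close> \<open>\<alpha> \<ge> 0\<close>] unfolding \<alpha>_def by (subst mass_eq[of D]) auto
  ultimately have "mass u (Suc s) - mass u s = wt \<alpha> (Suc s) * ((\<Sum>x\<in>D. bump (Suc s) x ^ 3 * u x)
      - (\<Sum>x\<in>D. bump s x ^ 3 * u x) - \<alpha> / real s * (\<Sum>x\<in>D. bump s x ^ 3 * u x))"
    by (simp add: algebra_simps)
  also have "\<dots> = wt \<alpha> (Suc s) / (16 * real s) * (16 * real s * (\<Sum>x\<in>D. bump (Suc s) x ^ 3 * u x)
      - 16 * real s * (\<Sum>x\<in>D. bump s x ^ 3 * u x) - 16 * \<alpha> * (\<Sum>x\<in>D. bump s x ^ 3 * u x))"
    using \<open>s \<ge> 1\<close> by (simp add: field_simps)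
  finally show ?thesis
    by (simp add: sum_distrib_left algebra_simps sum_subtractf sum.distrib)
qed

text \<open>A neighbour of the support satisfies q \<le> 2 s. The larger domain 4 s is chosen to
  agree with the region where \<open>bump_difference_lower\<close> has its error.\<close>

lemma bump_sum_by_parts:
  assumes "s \<ge> 1"
  shows "(\<Sum>x | sqn x \<le> 4 * int s. u x * lap (\<lambda>y. bump s y ^ 4) x) =
    (\<Sum>x | sqn x \<le> 4 * int s. bump s x ^ 4 * lap u x)"
proof (rule sum_by_parts[OF finite_sqn_le])
  fix y :: "int ^ 'a" assume "bump s y ^ 4 \<noteq> 0"
  then have y: "sqn y < int s" using bump_eq_0[of y s] by auto
  have *: "sqn (y + axis i c) \<le> 4 * int s" if "\<bar>c\<bar> = 1" for i and c :: int
  proof -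
    have "sqn (axis i c) = 1" using sqn_add_axis[of 0 i c] that by (auto simp: abs_if split: if_splits)
    then have "sqn (y + axis i c) \<le> 2 * sqn y + 2" using sqn_add_le[of y "axis i c"] by simp
    then show ?thesis using y by linarith
  qed
  show "y \<in> {x. sqn x \<le> 4 * int s} \<and> (\<forall>i. y + axis i 1 \<in> {x. sqn x \<le> 4 * int s} \<and> y - axis i 1 \<in> {x. sqn x \<le> 4 * int s})"
    using y *[of 1] *[of "-1"] by (auto simp: axis_uminus)
qed

text \<open>The error is a sum of t^2 u, which near the boundary of the ball is not dominated by t^3
  u / s. But 3 t^2 \<le> (t + 1)^3 - t^3, so this sum is bounded by the increment of the average
  itself plus a term of order mass / s. The increment reappears with a coefficient at most 1/2 and
  is absorbed on the left; what remains is a relative error of order s^-2.\<close>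

lemma mass_superharmonic_step:
  fixes u :: "int ^ 'd \<Rightarrow> real"
  defines "d \<equiv> real CARD('d)"
  assumes u: "\<And>x. u x \<ge> 0" and s: "real s \<ge> 20 * d" and \<kappa>: "\<kappa> \<ge> 0"
    and lap: "\<And>x. sqn x < int s \<Longrightarrow> lap u x \<le> \<kappa> * u x"
  shows "mass u (Suc s) \<le> (1 + \<kappa> / 8 + (400 * d + 64) * (d / 2 + 3) / 24 / (real s)\<^sup>2) * mass u s"
proof -
  define \<alpha> where "\<alpha> = d / 2 + 3"
  define c where "c = 400 * d + 64"
  define D :: "(int ^ 'd) set" where "D = {x. sqn x \<le> 4 * int s}"
  define W where "W = wt \<alpha> (Suc s)"
  define S2 where "S2 = (\<Sum>x\<in>D. u x * (bump s x)\<^sup>2)"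
  define S3 where "S3 = (\<Sum>x\<in>D. bump s x ^ 3 * u x)"
  define \<delta> where "\<delta> = mass u (Suc s) - mass u s"
  have d1: "d \<ge> 1" unfolding d_def by (simp add: Suc_leI)
  have s0: "real s > 0" using s d1 by linarith
  then have s1: "s \<ge> 1" by linarith
  have \<alpha>0: "\<alpha> \<ge> 0" using d1 by (simp add: \<alpha>_def)
  have W0: "W > 0" unfolding W_def by (rule wt_pos[OF \<alpha>0])
  have D: "finite D" "{x. sqn x \<le> int s} \<subseteq> D" by (auto simp: D_def finite_sqn_le)
  have S3_0: "S3 \<ge> 0" unfolding S3_def by (intro sum_nonneg) (simp add: u)
  have m: "mass u s = wt \<alpha> s * S3"
    unfolding S3_def \<alpha>_def d_def using D by (intro mass_eq) auto
  then have WS3: "W * S3 \<le> mass u s"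
    using wt_Suc_le[OF s1 \<alpha>0] S3_0 unfolding W_def by (simp add: mult_right_mono)
  have m0: "mass u s \<ge> 0" by (rule mass_nonneg[OF u])
  have \<delta>: "\<delta> = W / (16 * real s) *
      (\<Sum>x\<in>D. u x * (16 * real s * (bump (Suc s) x ^ 3 - bump s x ^ 3) - 16 * \<alpha> * bump s x ^ 3))"
    unfolding \<delta>_def W_def \<alpha>_def d_def by (rule mass_difference[OF D s1])
  have "(\<Sum>x\<in>D. u x * (16 * real s * (bump (Suc s) x ^ 3 - bump s x ^ 3) - 16 * \<alpha> * bump s x ^ 3))
      \<le> (\<Sum>x\<in>D. u x * (lap (\<lambda>y. bump s y ^ 4) x + c * (bump s x)\<^sup>2))"
    unfolding \<alpha>_def c_def d_def using s d1
    by (intro sum_mono mult_left_mono u bump_difference_upper) (simp add: d_def)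
  also have "\<dots> = (\<Sum>x\<in>D. u x * lap (\<lambda>y. bump s y ^ 4) x) + c * S2"
    by (simp add: S2_def sum.distrib sum_distrib_left algebra_simps)
  also have "(\<Sum>x\<in>D. u x * lap (\<lambda>y. bump s y ^ 4) x) = (\<Sum>x\<in>D. bump s x ^ 4 * lap u x)"
    unfolding D_def by (rule bump_sum_by_parts[OF s1])
  also have "\<dots> \<le> (\<Sum>x\<in>D. \<kappa> * real s * (bump s x ^ 3 * u x))"
  proof (rule sum_mono)
    fix x
    show "bump s x ^ 4 * lap u x \<le> \<kappa> * real s * (bump s x ^ 3 * u x)"
    proof (cases "sqn x < int s")
      case True
      have "bump s x ^ 4 * lap u x \<le> bump s x ^ 4 * (\<kappa> * u x)"
        using lap[OF True] by (intro mult_left_mono) auto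
      also have "\<dots> = bump s x * (bump s x ^ 3 * (\<kappa> * u x))" by (simp add: power_def eval_nat_numeral)
      also have "\<dots> \<le> real s * (bump s x ^ 3 * (\<kappa> * u x))"
        using u[of x] \<kappa> by (intro mult_right_mono bump_le) auto
      finally show ?thesis by (simp add: mult_ac)
    next
      case False
      then show ?thesis by (simp add: bump_eq_0)
    qed
  qed
  also have "\<dots> = \<kappa> * real s * S3" by (simp add: S3_def sum_distrib_left)
  finally have "\<delta> \<le> W / (16 * real s) * (\<kappa> * real s * S3 + c * S2)"
    unfolding \<delta> using W0 s0 by (intro mult_left_mono) auto
  also have "\<dots> = \<kappa> / 16 * (W * S3) + c / (48 * real s) * (3 * W * S2)"
    using s0 by (simp add: field_simps)
  finally have 1: "\<delta> \<le> \<kappa> / 16 * (W * S3) + c / (48 * real s) * (3 * W * S2)" .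
  have "3 * S2 \<le> (\<Sum>x\<in>D. u x * (bump (Suc s) x ^ 3 - bump s x ^ 3))"
    unfolding S2_def sum_distrib_left
  proof (rule sum_mono)
    fix x :: "int ^ 'd"
    have "3 * (bump s x)\<^sup>2 \<le> bump (Suc s) x ^ 3 - bump s x ^ 3"
      by (rule bump_Suc_cases[of s x]) (simp_all add: power2_eq_square power3_eq_cube algebra_simps)
    then show "3 * (u x * (bump s x)\<^sup>2) \<le> u x * (bump (Suc s) x ^ 3 - bump s x ^ 3)"
      using u[of x] mult_left_mono by fastforce
  qed
  also have "\<dots> = (\<Sum>x\<in>D. u x * (16 * real s * (bump (Suc s) x ^ 3 - bump s x ^ 3) - 16 * \<alpha> * bump s x ^ 3)) / (16 * real s) + \<alpha> / real s * S3"
    using s0 by (simp add: S3_def sum_divide_distrib sum_distrib_left sum_subtractf field_simps sum.distrib)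
  finally have "W * (3 * S2) \<le> W * ((\<Sum>x\<in>D. u x * (16 * real s * (bump (Suc s) x ^ 3 - bump s x ^ 3) - 16 * \<alpha> * bump s x ^ 3)) / (16 * real s) + \<alpha> / real s * S3)"
    using W0 by (intro mult_left_mono) auto
  also have "\<dots> = \<delta> + \<alpha> / real s * (W * S3)" unfolding \<delta> by (simp add: algebra_simps)
  also have "\<dots> \<le> \<delta> + \<alpha> / real s * mass u s"
    using WS3 \<alpha>0 by (intro add_left_mono mult_left_mono) auto
  finally have 2: "3 * W * S2 \<le> \<delta> + \<alpha> / real s * mass u s" by (simp add: mult_ac)
  \<comment> \<open>The threshold 20 d gives (400 d + 64) / (48 s) \<le> 464 / 960, which is below
    1/2.\<close>
  define \<theta> where "\<theta> = c / (48 * real s)"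
  have \<theta>: "0 \<le> \<theta>" "\<theta> \<le> 1 / 2" using d1 s s0 by (auto simp: \<theta>_def c_def field_simps)
  have "\<kappa> / 16 * (W * S3) \<le> \<kappa> / 16 * mass u s" using WS3 \<kappa> by (intro mult_left_mono) auto
  moreover have "\<theta> * (3 * W * S2) \<le> \<theta> * (\<delta> + \<alpha> / real s * mass u s)"
    using 2 \<theta> by (intro mult_left_mono) auto
  ultimately have 3: "\<delta> \<le> \<kappa> / 16 * mass u s + \<theta> * \<delta> + \<theta> * (\<alpha> / real s) * mass u s"
    using 1 unfolding \<theta>_def[symmetric] by (simp add: algebra_simps)
  have pos: "0 \<le> \<kappa> / 16 * mass u s" "0 \<le> \<theta> * (\<alpha> / real s) * mass u s"
    using \<kappa> m0 \<theta> \<alpha>0 by auto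
  have "\<delta> \<le> 2 * (\<kappa> / 16 * mass u s + \<theta> * (\<alpha> / real s) * mass u s)"
  proof (cases "\<delta> \<le> 0")
    case True
    also have "0 \<le> 2 * (\<kappa> / 16 * mass u s + \<theta> * (\<alpha> / real s) * mass u s)"
      using add_nonneg_nonneg[OF pos] by simp
    finally show ?thesis .
  next
    case False
    then have "\<theta> * \<delta> \<le> 1 / 2 * \<delta>" using \<theta> by (intro mult_right_mono) auto
    moreover have "a \<le> 2 * (b + c)" if "t \<le> 1 / 2 * a" "a \<le> b + t + c" for a b c t :: real
      using that by (simp add: algebra_simps)
    ultimately show ?thesis using 3 by blast
  qed
  also have "\<dots> = (\<kappa> / 8 + c * \<alpha> / 24 / (real s)\<^sup>2) * mass u s"
    using s0 by (simp add: \<theta>_def field_simps power2_eq_square)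
  finally show ?thesis unfolding \<delta>_def c_def \<alpha>_def by (simp add: algebra_simps)
qed

lemma inverse_square_telescope:
  assumes "s \<ge> 2"
  shows "1 / (real s)\<^sup>2 \<le> 1 / (real s - 1) - 1 / real s"
  using assms by (simp add: field_simps power2_eq_square)

text \<open>The potential accumulates to exp(\<kappa> S / 8), which stays bounded for \<kappa> =
  O(1/S), while the errors of order s^-2 telescope.\<close>

lemma mass_superharmonic_iterate:
  fixes u :: "int ^ 'd \<Rightarrow> real"
  defines "d \<equiv> real CARD('d)"
  assumes u: "\<And>x. u x \<ge> 0" and \<kappa>: "\<kappa> \<ge> 0" and s0: "real s0 \<ge> 20 * d"
    and lap: "\<And>x. sqn x < int S \<Longrightarrow> lap u x \<le> \<kappa> * u x" and S: "s0 \<le> S"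
  shows "mass u S \<le> exp (\<kappa> * real S / 8 + (400 * d + 64) * (d / 2 + 3) / 24) * mass u s0"
proof -
  define C where "C = (400 * d + 64) * (d / 2 + 3) / 24"
  have d1: "d \<ge> 1" unfolding d_def by (simp add: Suc_leI)
  have C0: "C \<ge> 0" using d1 by (simp add: C_def)
  have s02: "s0 \<ge> 2" using d1 s0 by linarith
  have "mass u S \<le> exp (\<kappa> * (real S - real s0) / 8 + C * (1 / (real s0 - 1) - 1 / (real S - 1))) * mass u s0"
    using S lap
  proof (induction S rule: dec_induct)
    case (step s)
    have sr: "real s \<ge> 2" using step s02 by linarith
    have "1 + \<kappa> / 8 + C / (real s)\<^sup>2 \<le> exp (\<kappa> / 8 + C / (real s)\<^sup>2)"
      using exp_ge_add_one_self[of "\<kappa> / 8 + C / (real s)\<^sup>2"] by (simp only: add.assoc)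
    also have "C / (real s)\<^sup>2 \<le> C * (1 / (real s - 1) - 1 / real s)"
      using mult_left_mono[OF inverse_square_telescope C0, of s] sr by simp
    finally have e: "1 + \<kappa> / 8 + C / (real s)\<^sup>2 \<le> exp (\<kappa> / 8 + C * (1 / (real s - 1) - 1 / real s))"
      by simp
    have "mass u (Suc s) \<le> (1 + \<kappa> / 8 + C / (real s)\<^sup>2) * mass u s"
      unfolding C_def d_def using step s0 \<kappa> u by (intro mass_superharmonic_step) (auto simp: d_def)
    also have "\<dots> \<le> exp (\<kappa> / 8 + C * (1 / (real s - 1) - 1 / real s)) * mass u s"
      by (intro mult_right_mono e mass_nonneg u)
    also have "\<dots> \<le> exp (\<kappa> / 8 + C * (1 / (real s - 1) - 1 / real s)) *
       (exp (\<kappa> * (real s - real s0) / 8 + C * (1 / (real s0 - 1) - 1 / (real s - 1))) * mass u s0)"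
      using step by (intro mult_left_mono) auto
    also have "\<dots> = exp (\<kappa> / 8 + C * (1 / (real s - 1) - 1 / real s) + 
        (\<kappa> * (real s - real s0) / 8 + C * (1 / (real s0 - 1) - 1 / (real s - 1)))) * mass u s0"
      by (simp add: exp_add)
    also have "\<kappa> / 8 + C * (1 / (real s - 1) - 1 / real s) + 
        (\<kappa> * (real s - real s0) / 8 + C * (1 / (real s0 - 1) - 1 / (real s - 1))) =
        \<kappa> * (real (Suc s) - real s0) / 8 + C * (1 / (real s0 - 1) - 1 / (real (Suc s) - 1))"
      by (simp add: algebra_simps add_divide_distrib diff_divide_distrib)
    finally show ?case .
  qed (simp add: mass_nonneg u)
  also have "\<dots> \<le> exp (\<kappa> * real S / 8 + C) * mass u s0"
  proof -
    have "C * (1 / (real s0 - 1) - 1 / (real S - 1)) \<le> C * 1"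
    proof (rule mult_left_mono[OF _ C0])
      have "1 / (real s0 - 1) \<le> 1" "1 / (real S - 1) \<ge> 0" using s02 S by (auto simp: field_simps)
      then show "1 / (real s0 - 1) - 1 / (real S - 1) \<le> 1" by linarith
    qed
    moreover have "\<kappa> * (real S - real s0) / 8 \<le> \<kappa> * real S / 8"
      using \<kappa> by (intro divide_right_mono mult_left_mono) auto
    ultimately show ?thesis
      by (intro mult_right_mono mass_nonneg u) (simp add: add_mono)
  qed
  finally show ?thesis unfolding C_def .
qed

lemma neighbour_le_lap:
  fixes u :: "int ^ 'd \<Rightarrow> real"
  assumes "\<And>x. u x \<ge> 0"
  shows "u (x + axis i 1) \<le> lap u x + 2 * real CARD('d) * u x"
    "u (x - axis i 1) \<le> lap u x + 2 * real CARD('d) * u x"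
proof -
  have "(\<Sum>i\<in>UNIV. u (x + axis i 1) + u (x - axis i 1)) = lap u x + 2 * real CARD('d) * u x"
    by (simp add: lap_def sum_subtractf)
  moreover have "u (x + axis i 1) + u (x - axis i 1) \<le> (\<Sum>i\<in>UNIV. u (x + axis i 1) + u (x - axis i 1))"
    using assms by (intro member_le_sum) auto
  ultimately show "u (x + axis i 1) \<le> lap u x + 2 * real CARD('d) * u x"
    "u (x - axis i 1) \<le> lap u x + 2 * real CARD('d) * u x"
    using assms[of "x + axis i 1"] assms[of "x - axis i 1"] by linarith+
qed

text \<open>A walk to the origin along which \<open>sqn\<close> decreases costs a factor 2 d + 1 per
  step. The bound is exponential, but it is applied only on a starting ball of fixed size.\<close>

lemma superharmonic_growth:
  fixes u :: "int ^ 'd \<Rightarrow> real"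
  assumes u: "\<And>x. u x \<ge> 0" and lap: "\<And>x. sqn x < S \<Longrightarrow> lap u x \<le> u x"
  shows "sqn x < S \<Longrightarrow> u x \<le> (2 * real CARD('d) + 1) ^ nat (sqn x) * u 0"
proof (induction "nat (sqn x)" arbitrary: x rule: less_induct)
  case less
  let ?c = "2 * real CARD('d) + 1"
  show ?case
  proof (cases "x = 0")
    case False
    then obtain i where i: "x $ i \<noteq> 0" by (auto simp: vec_eq_iff)
    obtain y where y: "sqn y < sqn x" "u x \<le> lap u y + 2 * real CARD('d) * u y"
    proof (cases "x $ i > 0")
      case True
      show ?thesis
      proof (rule that[of "x - axis i 1"])
        show "sqn (x - axis i 1) < sqn x" using True by (simp add: sqn_diff_axis)
      qed (use neighbour_le_lap(1)[where u = u and x = "x - axis i 1" and i = i, OF u] in simp)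
    next
      case False
      show ?thesis
      proof (rule that[of "x + axis i 1"])
        show "sqn (x + axis i 1) < sqn x" using False i by (simp add: sqn_add_axis)
      qed (use neighbour_le_lap(2)[where u = u and x = "x + axis i 1" and i = i, OF u] in simp)
    qed
    have lt: "nat (sqn y) < nat (sqn x)" using y(1) sqn_nonneg[of y] by linarith
    have "u x \<le> ?c * u y" using y less.prems lap[of y] by (simp add: algebra_simps)
    also have "\<dots> \<le> ?c * (?c ^ nat (sqn y) * u 0)"
      using y lt less.prems by (intro mult_left_mono less.hyps) auto
    also have "\<dots> = ?c ^ Suc (nat (sqn y)) * u 0" by simp
    also have "\<dots> \<le> ?c ^ nat (sqn x) * u 0"
      using lt u by (intro mult_right_mono power_increasing) auto
    finally show ?thesis .
  qed simp
qed

lemma mass_superharmonic: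
  shows "\<exists>C>0. \<forall>(u :: int ^ 'd \<Rightarrow> real) \<kappa> S. (\<forall>x. u x \<ge> 0) \<longrightarrow> 0 \<le> \<kappa> \<longrightarrow> \<kappa> \<le> 1 \<longrightarrow>
      \<kappa> * real S \<le> 4 * real CARD('d) \<longrightarrow> S \<ge> 20 * CARD('d) \<longrightarrow>
      (\<forall>x. sqn x < int S \<longrightarrow> lap u x \<le> \<kappa> * u x) \<longrightarrow> mass u S \<le> C * u 0"
proof -
  define d where "d = real CARD('d)"
  \<comment> \<open>The starting ball: 20 d is the smallest scale at which
    \<open>mass_superharmonic_step\<close> applies.\<close>
  define s0 where "s0 = 20 * CARD('d)"
  define A where "A = wt (d / 2 + 3) s0 * (real (card {x :: int ^ 'd. sqn x < int s0}) * (real s0 ^ 3 * (2 * d + 1) ^ s0))"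
  define C where "C = exp (4 * d / 8 + (400 * d + 64) * (d / 2 + 3) / 24) * A"
  have d1: "d \<ge> 1" unfolding d_def by (simp add: Suc_leI)
  have "A > 0"
  proof -
    have "(0 :: int ^ 'd) \<in> {x. sqn x < int s0}" by (simp add: s0_def)
    then have "card {x :: int ^ 'd. sqn x < int s0} > 0" using finite_sqn_less card_gt_0_iff by blast
    then show ?thesis unfolding A_def using d1 by (auto intro!: mult_pos_pos wt_pos zero_less_power simp: s0_def)
  qed
  show ?thesis
  proof (intro exI[of _ C] conjI allI impI)
    show "C > 0" using \<open>A > 0\<close> by (simp add: C_def)
    fix u :: "int ^ 'd \<Rightarrow> real" and \<kappa> S
    assume "\<forall>x. u x \<ge> 0" and \<kappa>: "0 \<le> \<kappa>" "\<kappa> \<le> 1" "\<kappa> * real S \<le> 4 * real CARD('d)"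
      and S: "S \<ge> 20 * CARD('d)" and "\<forall>x. sqn x < int S \<longrightarrow> lap u x \<le> \<kappa> * u x"
    then have u: "\<And>x. u x \<ge> 0" and lap: "\<And>x. sqn x < int S \<Longrightarrow> lap u x \<le> \<kappa> * u x" by auto
    have lap1: "lap u x \<le> u x" if "sqn x < int S" for x
      using lap[OF that] mult_right_mono[OF \<kappa>(2) u[of x]] by simp
    have "(\<Sum>x | sqn x < int s0. bump s0 x ^ 3 * u x) \<le> (\<Sum>x :: int ^ 'd | sqn x < int s0. real s0 ^ 3 * ((2 * d + 1) ^ s0 * u 0))"
    proof (intro sum_mono mult_mono power_mono bump_le)
      fix x :: "int ^ 'd" assume x: "x \<in> {x. sqn x < int s0}"
      then have "sqn x < int S" using S by (simp add: s0_def)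
      then have "u x \<le> (2 * d + 1) ^ nat (sqn x) * u 0"
        unfolding d_def using superharmonic_growth[OF u lap1] by blast
      also have "\<dots> \<le> (2 * d + 1) ^ s0 * u 0"
        using x d1 u by (intro mult_right_mono power_increasing) auto
      finally show "u x \<le> (2 * d + 1) ^ s0 * u 0" .
    qed (use u d1 in auto)
    also have "\<dots> = real (card {x :: int ^ 'd. sqn x < int s0}) * (real s0 ^ 3 * (2 * d + 1) ^ s0) * u 0"
      by simp
    finally have "mass u s0 \<le> wt (d / 2 + 3) s0 * (real (card {x :: int ^ 'd. sqn x < int s0}) * (real s0 ^ 3 * (2 * d + 1) ^ s0) * u 0)"
      unfolding mass_def d_def by (intro mult_left_mono less_imp_le[OF wt_pos]) auto
    then have m: "mass u s0 \<le> A * u 0" by (simp add: A_def)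
    have "mass u S \<le> exp (\<kappa> * real S / 8 + (400 * d + 64) * (d / 2 + 3) / 24) * mass u s0"
      unfolding d_def using S lap by (intro mass_superharmonic_iterate u \<kappa>) (auto simp: s0_def)
    also have "\<dots> \<le> exp (4 * d / 8 + (400 * d + 64) * (d / 2 + 3) / 24) * mass u s0"
      using \<kappa> by (intro mult_right_mono mass_nonneg u) (simp add: d_def)
    also have "\<dots> \<le> exp (4 * d / 8 + (400 * d + 64) * (d / 2 + 3) / 24) * (A * u 0)"
      by (intro mult_left_mono m) auto
    finally show "mass u S \<le> C * u 0" by (simp add: C_def)
  qed
qed

text \<open>Plain sums are turned into averages in this way: where q stays r below s, the bump is at
  least r.\<close>

lemma mass_ge:
  fixes u :: "int ^ 'd \<Rightarrow> real"
  assumes u: "\<And>x. u x \<ge> 0" and A: "A \<subseteq> {x. sqn x + int r \<le> int s}"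
  shows "wt (real CARD('d) / 2 + 3) s * (real r ^ 3 * (\<Sum>x\<in>A. u x)) \<le> mass u s"
  unfolding mass_def
proof (rule mult_left_mono)
  have fin: "finite {x :: int ^ 'd. sqn x \<le> int s}" by (rule finite_sqn_le)
  have AA: "A \<subseteq> {x. sqn x \<le> int s}" using A by auto
  have "real r ^ 3 * (\<Sum>x\<in>A. u x) = (\<Sum>x\<in>A. real r ^ 3 * u x)" by (simp add: sum_distrib_left)
  also have "\<dots> \<le> (\<Sum>x\<in>A. bump s x ^ 3 * u x)"
  proof (intro sum_mono mult_right_mono power_mono u)
    fix x assume "x \<in> A"
    then have "sqn x + int r \<le> int s" using A by auto
    then have "real_of_int (sqn x) + real r \<le> real s" by linarith
    then show "real r \<le> bump s x" by (simp add: bump_def)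
  qed simp
  also have "\<dots> \<le> (\<Sum>x | sqn x \<le> int s. bump s x ^ 3 * u x)"
    using fin AA u by (intro sum_mono2) auto
  also have "\<dots> = (\<Sum>x | sqn x < int s. bump s x ^ 3 * u x)"
    using fin by (intro sum.mono_neutral_right) (auto simp: bump_eq_0)
  finally show "real r ^ 3 * (\<Sum>x\<in>A. u x) \<le> (\<Sum>x | sqn x < int s. bump s x ^ 3 * u x)" .
qed (intro less_imp_le[OF wt_pos], simp)

text \<open>
  Here the fourth-order term has the wrong sign near the boundary of the ball, and the error is
  charged to the average over a larger ball instead.
\<close>

lemma mass_subharmonic_step:
  fixes u :: "int ^ 'd \<Rightarrow> real"
  defines "d \<equiv> real CARD('d)"
  assumes u: "\<And>x. u x \<ge> 0" and s: "s \<ge> 2"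
    and lap: "\<And>x. sqn x < int s \<Longrightarrow> lap u x \<ge> 0"
  shows "mass u s \<le> mass u (Suc s) + exp (7 * (d / 2 + 3)) * (12 * d + 512) / 1024 / (real s)\<^sup>2 * mass u (8 * s)"
proof -
  define \<alpha> where "\<alpha> = d / 2 + 3"
  define D :: "(int ^ 'd) set" where "D = {x. sqn x \<le> 4 * int s}"
  define W where "W = wt \<alpha> (Suc s)"
  define U where "U = (\<Sum>x\<in>D. u x)"
  have d1: "d \<ge> 1" unfolding d_def by (simp add: Suc_leI)
  have s1: "s \<ge> 1" "real s > 0" using s by linarith+
  have \<alpha>0: "\<alpha> \<ge> 0" using d1 by (simp add: \<alpha>_def)
  have W0: "W > 0" unfolding W_def by (rule wt_pos[OF \<alpha>0])
  have U0: "U \<ge> 0" unfolding U_def by (intro sum_nonneg u)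
  have D: "finite D" "{x. sqn x \<le> int s} \<subseteq> D" by (auto simp: D_def finite_sqn_le)
  \<comment> \<open>The summand 12 d comes from t \<le> s, and 512 = 32 * 4^2 from q \<le> 4 s on
    \<open>D\<close>.\<close>
  have "- ((12 * d + 512) * (real s)\<^sup>2) * U = (\<Sum>x\<in>D. u x * (- ((12 * d + 512) * (real s)\<^sup>2)))"
    by (simp only: U_def flip: sum_distrib_right) simp
  also have "\<dots> \<le> (\<Sum>x\<in>D. u x * (16 * real s * (bump (Suc s) x ^ 3 - bump s x ^ 3) - 16 * \<alpha> * bump s x ^ 3
      - lap (\<lambda>y. bump s y ^ 4) x))"
  proof (intro sum_mono mult_left_mono u)
    fix x assume x: "x \<in> D"
    have "lap (\<lambda>y. bump s y ^ 4) x - 12 * d * (bump s x)\<^sup>2 - 32 * (of_int (sqn x))\<^sup>2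
      \<le> 16 * real s * (bump (Suc s) x ^ 3 - bump s x ^ 3) - 16 * \<alpha> * bump s x ^ 3"
      using bump_difference_lower[OF s, of x] x unfolding \<alpha>_def d_def D_def by simp
    moreover have "(bump s x)\<^sup>2 \<le> (real s)\<^sup>2" by (intro power_mono bump_le) simp
    then have "12 * d * (bump s x)\<^sup>2 \<le> 12 * d * (real s)\<^sup>2" using d1 by (intro mult_left_mono) auto
    moreover have "(real_of_int (sqn x))\<^sup>2 \<le> (4 * real s)\<^sup>2"
    proof (intro power_mono)
      have "sqn x \<le> 4 * int s" using x by (simp add: D_def)
      then show "real_of_int (sqn x) \<le> 4 * real s" by linarith
    qed simp
    ultimately show "- ((12 * d + 512) * (real s)\<^sup>2) \<le> 16 * real s * (bump (Suc s) x ^ 3 - bump s x ^ 3)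
      - 16 * \<alpha> * bump s x ^ 3 - lap (\<lambda>y. bump s y ^ 4) x"
      by (simp add: algebra_simps power_mult_distrib)
  qed
  also have "\<dots> = (\<Sum>x\<in>D. u x * (16 * real s * (bump (Suc s) x ^ 3 - bump s x ^ 3) - 16 * \<alpha> * bump s x ^ 3))
      - (\<Sum>x\<in>D. u x * lap (\<lambda>y. bump s y ^ 4) x)"
    by (simp add: right_diff_distrib sum_subtractf)
  also have "(\<Sum>x\<in>D. u x * lap (\<lambda>y. bump s y ^ 4) x) = (\<Sum>x\<in>D. bump s x ^ 4 * lap u x)"
    unfolding D_def by (rule bump_sum_by_parts[OF s1(1)])
  finally have "- ((12 * d + 512) * (real s)\<^sup>2) * U + (\<Sum>x\<in>D. bump s x ^ 4 * lap u x) \<le>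
    (\<Sum>x\<in>D. u x * (16 * real s * (bump (Suc s) x ^ 3 - bump s x ^ 3) - 16 * \<alpha> * bump s x ^ 3))" by simp
  moreover have "(\<Sum>x\<in>D. bump s x ^ 4 * lap u x) \<ge> 0"
  proof (rule sum_nonneg)
    fix x
    show "bump s x ^ 4 * lap u x \<ge> 0"
      using lap[of x] bump_eq_0[of x s] by (cases "sqn x < int s") auto
  qed
  ultimately have "- ((12 * d + 512) * (real s)\<^sup>2) * U \<le>
    (\<Sum>x\<in>D. u x * (16 * real s * (bump (Suc s) x ^ 3 - bump s x ^ 3) - 16 * \<alpha> * bump s x ^ 3))" by simp
  then have "W / (16 * real s) * (- ((12 * d + 512) * (real s)\<^sup>2) * U) \<le> W / (16 * real s) *
    (\<Sum>x\<in>D. u x * (16 * real s * (bump (Suc s) x ^ 3 - bump s x ^ 3) - 16 * \<alpha> * bump s x ^ 3))"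
    using W0 s1 by (intro mult_left_mono) auto
  also have "\<dots> = mass u (Suc s) - mass u s"
    unfolding W_def \<alpha>_def d_def by (rule mass_difference[OF D s1(1), symmetric])
  also have "W / (16 * real s) * (- ((12 * d + 512) * (real s)\<^sup>2) * U) = - ((12 * d + 512) * real s / 16 * (W * U))"
    using s1 by (simp add: field_simps power2_eq_square)
  finally have 1: "mass u s \<le> mass u (Suc s) + (12 * d + 512) * real s / 16 * (W * U)" by simp
  \<comment> \<open>On \<open>D\<close> the bump of the ball 8 s is at least 4 s, so the plain sum
    \<open>U\<close> is controlled by the average at scale 8 s. The gain of (4 s)^3 against the
    prefactor of order s leaves a relative error of order s^-2.\<close>
  have "W \<le> wt \<alpha> s" unfolding W_def by (rule wt_Suc_le[OF s1(1) \<alpha>0])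
  also have "\<dots> \<le> exp (\<alpha> * (real (8 * s) - real s) / real s) * wt \<alpha> (8 * s)"
    by (rule wt_doubling) (use s1 \<alpha>0 in auto)
  also have "\<alpha> * (real (8 * s) - real s) / real s = 7 * \<alpha>" using s1 by simp
  finally have "W * U \<le> exp (7 * \<alpha>) * wt \<alpha> (8 * s) * U" using U0 by (intro mult_right_mono)
  also have "\<dots> = exp (7 * \<alpha>) / (64 * (real s)^3) * (wt \<alpha> (8 * s) * (real (4 * s) ^ 3 * U))"
    using s1 by (simp add: field_simps)
  also have "\<dots> \<le> exp (7 * \<alpha>) / (64 * (real s)^3) * mass u (8 * s)"
  proof (rule mult_left_mono)
    show "wt \<alpha> (8 * s) * (real (4 * s) ^ 3 * U) \<le> mass u (8 * s)"
      unfolding U_def \<alpha>_def d_def by (rule mass_ge[OF u]) (auto simp: D_def)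
  qed auto
  finally have "(12 * d + 512) * real s / 16 * (W * U) \<le> (12 * d + 512) * real s / 16 * (exp (7 * \<alpha>) / (64 * (real s)^3) * mass u (8 * s))"
    using d1 by (intro mult_left_mono) auto
  also have "\<dots> = exp (7 * \<alpha>) * (12 * d + 512) / 1024 / (real s)\<^sup>2 * mass u (8 * s)"
    using s1 by (simp add: field_simps power2_eq_square power3_eq_cube)
  finally show ?thesis using 1 unfolding \<alpha>_def by linarith
qed

text \<open>The bound at s uses those at s + 1 and 8 s, both larger, so the induction runs downwards
  from S. Once 8 s \<ge> S, the average is compared directly with the plain sum over the ball S. The
  term C / (s - 1) in the exponent holds the sum of the errors of order s^-2 collected on the way
  down.\<close>

lemma mass_subharmonic_iterate:
  fixes u :: "int ^ 'd \<Rightarrow> real"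
  defines "d \<equiv> real CARD('d)"
  assumes u: "\<And>x. u x \<ge> 0"
    and lap: "\<And>x. sqn x < int S \<Longrightarrow> lap u x \<ge> 0"
  defines "C \<equiv> exp (7 * (d / 2 + 3)) * (12 * d + 512) / 1024"
    and "X \<equiv> wt (d / 2 + 3) S * (real S ^ 3 * (\<Sum>x | sqn x < int S. u x))"
  shows "2 \<le> s \<Longrightarrow> s \<le> S \<Longrightarrow> mass u s \<le> exp (7 * (d / 2 + 3) + C / (real s - 1)) * X"
proof (induction "S - s" arbitrary: s rule: less_induct)
  case less
  define \<alpha> where "\<alpha> = d / 2 + 3"
  have d1: "d \<ge> 1" unfolding d_def by (simp add: Suc_leI)
  have \<alpha>0: "\<alpha> \<ge> 0" using d1 by (simp add: \<alpha>_def)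
  have C0: "C \<ge> 0" using d1 by (simp add: C_def)
  have X0: "X \<ge> 0" unfolding X_def \<alpha>_def[symmetric]
    by (intro mult_nonneg_nonneg sum_nonneg u less_imp_le[OF wt_pos[OF \<alpha>0]]) auto
  show ?case
  proof (cases "S \<le> 8 * s")
    case True
    have "wt \<alpha> s \<le> exp (\<alpha> * (real S - real s) / real s) * wt \<alpha> S"
      by (rule wt_doubling) (use less.prems \<alpha>0 in auto)
    also have "\<dots> \<le> exp (7 * \<alpha> + C / (real s - 1)) * wt \<alpha> S"
    proof (rule mult_right_mono)
      have "\<alpha> * (real S - real s) \<le> \<alpha> * (7 * real s)"
        using True \<alpha>0 by (intro mult_left_mono) linarith+
      then have "\<alpha> * (real S - real s) / real s \<le> 7 * \<alpha>"
        using less.prems by (simp add: field_simps)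
      moreover have "C / (real s - 1) \<ge> 0" using C0 less.prems by simp
      ultimately show "exp (\<alpha> * (real S - real s) / real s) \<le> exp (7 * \<alpha> + C / (real s - 1))" by simp
    qed (intro less_imp_le[OF wt_pos[OF \<alpha>0]])
    finally have w: "wt \<alpha> s \<le> exp (7 * \<alpha> + C / (real s - 1)) * wt \<alpha> S" .
    have "(\<Sum>x | sqn x < int s. bump s x ^ 3 * u x) \<le> (\<Sum>x | sqn x < int s. real S ^ 3 * u x)"
      using u less.prems by (intro sum_mono mult_right_mono power_mono order_trans[OF bump_le]) auto
    also have "\<dots> = real S ^ 3 * (\<Sum>x | sqn x < int s. u x)" by (simp add: sum_distrib_left)
    also have "\<dots> \<le> real S ^ 3 * (\<Sum>x | sqn x < int S. u x)"
      using u less.prems by (intro mult_left_mono sum_mono2 finite_sqn_less) auto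
    finally have "mass u s \<le> wt \<alpha> s * (real S ^ 3 * (\<Sum>x | sqn x < int S. u x))"
      unfolding mass_def \<alpha>_def d_def by (intro mult_left_mono less_imp_le[OF wt_pos]) auto
    also have "\<dots> \<le> (exp (7 * \<alpha> + C / (real s - 1)) * wt \<alpha> S) * (real S ^ 3 * (\<Sum>x | sqn x < int S. u x))"
      by (intro mult_right_mono w mult_nonneg_nonneg sum_nonneg u) auto
    finally show ?thesis by (simp add: X_def \<alpha>_def)
  next
    case False
    define E where "E = exp (7 * \<alpha> + C / real s) * X"
    have E0: "E \<ge> 0" using X0 by (simp add: E_def)
    have sr: "real s \<ge> 2" using less.prems by simp
    have IH1: "mass u (Suc s) \<le> E"
      using less.hyps[of "Suc s"] less.prems False by (simp add: E_def \<alpha>_def)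
    have "mass u (8 * s) \<le> exp (7 * \<alpha> + C / (real (8 * s) - 1)) * X"
      unfolding \<alpha>_def using less.prems False by (intro less.hyps) auto
    also have "\<dots> \<le> E" unfolding E_def
      using X0 C0 sr by (intro mult_right_mono) (auto intro!: divide_left_mono)
    finally have IH2: "mass u (8 * s) \<le> E" .
    have "mass u s \<le> mass u (Suc s) + C / (real s)\<^sup>2 * mass u (8 * s)"
      unfolding C_def d_def using less.prems lap by (intro mass_subharmonic_step u) auto
    also have "\<dots> \<le> E + C / (real s)\<^sup>2 * E"
      using C0 by (intro add_mono IH1 mult_left_mono IH2) auto
    also have "\<dots> = (1 + C / (real s)\<^sup>2) * E" by (simp add: algebra_simps)
    also have "\<dots> \<le> exp (C * (1 / (real s - 1) - 1 / real s)) * E"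
    proof (rule mult_right_mono[OF _ E0])
      have "1 + C / (real s)\<^sup>2 \<le> exp (C / (real s)\<^sup>2)" by (rule exp_ge_add_one_self)
      also have "C / (real s)\<^sup>2 \<le> C * (1 / (real s - 1) - 1 / real s)"
        using mult_left_mono[OF inverse_square_telescope C0, of s] sr by simp
      finally show "1 + C / (real s)\<^sup>2 \<le> exp (C * (1 / (real s - 1) - 1 / real s))" by simp
    qed
    also have "\<dots> = exp (C * (1 / (real s - 1) - 1 / real s) + (7 * \<alpha> + C / real s)) * X"
      by (simp add: E_def exp_add)
    also have "C * (1 / (real s - 1) - 1 / real s) + (7 * \<alpha> + C / real s) = 7 * \<alpha> + C / (real s - 1)"
      by (simp add: algebra_simps)
    finally show ?thesis by (simp add: \<alpha>_def)
  qed
qed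

text \<open>The downward iteration stops at s = 2, where the centre alone already contributes a
  fixed multiple of \<open>u 0\<close> to the average.\<close>

lemma mean_value_subharmonic:
  shows "\<exists>C>0. \<forall>(u :: int ^ 'd \<Rightarrow> real) S. (\<forall>x. u x \<ge> 0) \<longrightarrow> S \<ge> 2 \<longrightarrow>
      (\<forall>x. sqn x < int S \<longrightarrow> lap u x \<ge> 0) \<longrightarrow>
      u 0 \<le> C * (wt (real CARD('d) / 2 + 3) S * (real S ^ 3 * (\<Sum>x | sqn x < int S. u x)))"
proof -
  define d where "d = real CARD('d)"
  define B where "B = exp (7 * (d / 2 + 3) + exp (7 * (d / 2 + 3)) * (12 * d + 512) / 1024)"
  define w where "w = wt (d / 2 + 3) 2"
  have w0: "w > 0" unfolding w_def d_def by (intro wt_pos) simp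
  show ?thesis
  proof (intro exI[of _ "B / w"] conjI allI impI)
    show "B / w > 0" using w0 by (simp add: B_def)
    fix u :: "int ^ 'd \<Rightarrow> real" and S :: nat
    assume "\<forall>x. u x \<ge> 0" and S: "S \<ge> 2" and "\<forall>x. sqn x < int S \<longrightarrow> lap u x \<ge> 0"
    then have u: "\<And>x. u x \<ge> 0" and lap: "\<And>x. sqn x < int S \<Longrightarrow> lap u x \<ge> 0" by auto
    have "w * u 0 \<le> w * (real 2 ^ 3 * (\<Sum>x\<in>{0}. u x))" using w0 u[of 0] by simp
    also have "\<dots> \<le> mass u 2" unfolding w_def d_def by (rule mass_ge[OF u]) simp
    also have "mass u 2 \<le> B * (wt (d / 2 + 3) S * (real S ^ 3 * (\<Sum>x | sqn x < int S. u x)))"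
      using mass_subharmonic_iterate[OF u lap, of S 2] S by (simp add: B_def d_def)
    finally show "u 0 \<le> B / w * (wt (real CARD('d) / 2 + 3) S * (real S ^ 3 * (\<Sum>x | sqn x < int S. u x)))"
      using w0 by (simp add: field_simps d_def)
  qed
qed

lemma lap_translate: "lap (\<lambda>z. u (x + z)) z = lap u (x + z)"
  by (simp add: lap_def add.assoc add_diff_eq)

text \<open>The subharmonic bound at x involves the ball S about x. It lies in the ball 4 S about
  x', by |y + z|^2 \<le> 2 |y|^2 + 2 |z|^2, and there the bump of the ball 16 S about x' is at least
  12 S. So the sum is dominated by the average about x' at scale 16 S, which the superharmonic bound
  compares with \<open>u x'\<close>. The condition on \<kappa> is that of
  \<open>mass_superharmonic\<close> at scale 16 S.\<close>

theorem harnack: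
  shows "\<exists>C>0. \<forall>(u :: int ^ 'd \<Rightarrow> real) \<kappa> S x x'. (\<forall>y. u y \<ge> 0) \<longrightarrow> 0 \<le> \<kappa> \<longrightarrow> \<kappa> \<le> 1 \<longrightarrow>
      16 * \<kappa> * real S \<le> 4 * real CARD('d) \<longrightarrow> S \<ge> 20 * CARD('d) \<longrightarrow> sqn (x - x') \<le> int S \<longrightarrow>
      (\<forall>y. sqn (y - x') < 16 * int S \<longrightarrow> 0 \<le> lap u y \<and> lap u y \<le> \<kappa> * u y) \<longrightarrow>
      u x \<le> C * u x'"
proof -
  obtain C1 :: real where C1: "C1 > 0"
    "\<And>(u :: int ^ 'd \<Rightarrow> real) \<kappa> S. (\<And>x. u x \<ge> 0) \<Longrightarrow> 0 \<le> \<kappa> \<Longrightarrow> \<kappa> \<le> 1 \<Longrightarrow>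
      \<kappa> * real S \<le> 4 * real CARD('d) \<Longrightarrow> S \<ge> 20 * CARD('d) \<Longrightarrow>
      (\<And>x. sqn x < int S \<Longrightarrow> lap u x \<le> \<kappa> * u x) \<Longrightarrow> mass u S \<le> C1 * u 0"
    using mass_superharmonic[where ?'d = 'd] by blast
  obtain C2 :: real where C2: "C2 > 0"
    "\<And>(u :: int ^ 'd \<Rightarrow> real) S. (\<And>x. u x \<ge> 0) \<Longrightarrow> S \<ge> 2 \<Longrightarrow>
      (\<And>x. sqn x < int S \<Longrightarrow> lap u x \<ge> 0) \<Longrightarrow>
      u 0 \<le> C2 * (wt (real CARD('d) / 2 + 3) S * (real S ^ 3 * (\<Sum>x | sqn x < int S. u x)))"
    using mean_value_subharmonic[where ?'d = 'd] by blast
  define \<alpha> where "\<alpha> = real CARD('d) / 2 + 3"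
  have \<alpha>0: "\<alpha> \<ge> 0" by (simp add: \<alpha>_def)
  show ?thesis
  proof (intro exI[of _ "C2 * (exp (15 * \<alpha>) * C1)"] conjI allI impI)
    show "C2 * (exp (15 * \<alpha>) * C1) > 0" using C1 C2 by simp
    fix u :: "int ^ 'd \<Rightarrow> real" and \<kappa> :: real and S :: nat and x x' :: "int ^ 'd"
    assume "\<forall>y. u y \<ge> 0" and \<kappa>: "0 \<le> \<kappa>" "\<kappa> \<le> 1" "16 * \<kappa> * real S \<le> 4 * real CARD('d)"
      and S: "S \<ge> 20 * CARD('d)" and xx: "sqn (x - x') \<le> int S"
      and "\<forall>y. sqn (y - x') < 16 * int S \<longrightarrow> 0 \<le> lap u y \<and> lap u y \<le> \<kappa> * u y"
    then have u: "\<And>y. u y \<ge> 0"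
      and lap: "\<And>y. sqn (y - x') < 16 * int S \<Longrightarrow> 0 \<le> lap u y \<and> lap u y \<le> \<kappa> * u y" by auto
    have "CARD('d) \<ge> 1" by (simp add: Suc_leI)
    then have S1: "S \<ge> 2" "S \<ge> 1" using S by linarith+
    define v where "v z = u (x' + z)" for z
    have near: "sqn (z + (x - x')) \<le> 4 * int S" if "sqn z < int S" for z
      using sqn_add_le[of z "x - x'"] xx that by linarith
    have "mass v (16 * S) \<le> C1 * v 0"
    proof (rule C1(2)[of v \<kappa>])
      fix z :: "int ^ 'd" assume "sqn z < int (16 * S)"
      then show "lap v z \<le> \<kappa> * v z" unfolding v_def lap_translate using lap[of "x' + z"] by simp
    qed (use u \<kappa> S in \<open>auto simp: v_def\<close>)
    then have sup: "mass v (16 * S) \<le> C1 * u x'" by (simp add: v_def)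
    have "u (x + 0) \<le> C2 * (wt (real CARD('d) / 2 + 3) S * (real S ^ 3 * (\<Sum>z | sqn z < int S. u (x + z))))"
    proof (rule C2(2)[of "\<lambda>z. u (x + z)"])
      fix z :: "int ^ 'd" assume "sqn z < int S"
      then have "sqn ((x + z) - x') < 16 * int S" using near[of z] S1 by (simp add: algebra_simps)
      then show "0 \<le> lap (\<lambda>z. u (x + z)) z" unfolding lap_translate using lap by blast
    qed (use u S1 in auto)
    then have sub: "u x \<le> C2 * (wt \<alpha> S * (real S ^ 3 * (\<Sum>z | sqn z < int S. u (x + z))))"
      by (simp add: \<alpha>_def)
    define A where "A = (\<lambda>z. z + (x - x')) ` {z. sqn z < int S}"
    have sumA: "(\<Sum>z | sqn z < int S. u (x + z)) = (\<Sum>z\<in>A. v z)"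
      unfolding A_def by (subst sum.reindex) (auto simp: v_def algebra_simps inj_on_def)
    have "wt \<alpha> S \<le> exp (\<alpha> * (real (16 * S) - real S) / real S) * wt \<alpha> (16 * S)"
      by (rule wt_doubling) (use S1 \<alpha>0 in auto)
    also have "\<alpha> * (real (16 * S) - real S) / real S = 15 * \<alpha>" using S1 by simp
    finally have "wt \<alpha> S * (real S ^ 3 * (\<Sum>z | sqn z < int S. u (x + z))) \<le>
        exp (15 * \<alpha>) * wt \<alpha> (16 * S) * (real (12 * S) ^ 3 * (\<Sum>z\<in>A. v z))"
      unfolding sumA using u \<alpha>0
      by (intro mult_mono power_mono mult_nonneg_nonneg sum_nonneg less_imp_le[OF wt_pos]) (auto simp: v_def)
    also have "\<dots> = exp (15 * \<alpha>) * (wt \<alpha> (16 * S) * (real (12 * S) ^ 3 * (\<Sum>z\<in>A. v z)))" by simp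
    also have "\<dots> \<le> exp (15 * \<alpha>) * mass v (16 * S)"
      unfolding \<alpha>_def using near by (intro mult_left_mono mass_ge) (auto simp: v_def u A_def)
    also have "\<dots> \<le> exp (15 * \<alpha>) * (C1 * u x')" by (intro mult_left_mono sup) simp
    finally have "C2 * (wt \<alpha> S * (real S ^ 3 * (\<Sum>z | sqn z < int S. u (x + z)))) \<le> C2 * (exp (15 * \<alpha>) * (C1 * u x'))"
      using C2(1) by (intro mult_left_mono) auto
    then show "u x \<le> C2 * (exp (15 * \<alpha>) * C1) * u x'" using sub by simp
  qed
qed

section \<open>Contraction of the oscillation of ratios\<close>

lemma sum_neighbours:
  fixes x :: "int ^ 'd" and f :: "int ^ 'd \<Rightarrow> real"
  shows "(\<Sum>y | x \<sim>\<^sub>Z y. f y) = (\<Sum>i\<in>UNIV. f (x + axis i 1) + f (x - axis i 1))"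
proof -
  let ?f = "\<lambda>i. x + axis i 1" and ?g = "\<lambda>i. x - axis i 1"
  have *: "{y. x \<sim>\<^sub>Z y} = range ?f \<union> range ?g" by (auto simp: adj_iff)
  have "axis i 1 \<noteq> - axis j (1::int)" for i j :: 'd
    by (auto simp: vec_eq_iff axis_def intro!: exI[of _ i])
  then have "range ?f \<inter> range ?g = {}"
    by (auto simp: algebra_simps add_eq_0_iff)
  moreover have "inj ?f" "inj ?g" by (auto simp: inj_def axis_eq_axis)
  ultimately show ?thesis
    unfolding * by (simp add: sum.union_disjoint sum.reindex sum.distrib)
qed

text \<open>Killing acts as the potential 2 d k / (1 - k). Multiplying by 1 - k keeps the case k = 1
  meaningful.\<close>

lemma massive_harmonic_at_lap:
  fixes u :: "int ^ 'd \<Rightarrow> real"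
  assumes "massive_harmonic_at k u x"
  shows "(1 - k x) * lap u x = 2 * real CARD('d) * k x * u x"
proof -
  have "(\<Sum>y | x \<sim>\<^sub>Z y. u y) = lap u x + 2 * real CARD('d) * u x"
    by (simp add: lap_def sum_neighbours sum_subtractf)
  then have "2 * real CARD('d) * u x = (1 - k x) * (lap u x + 2 * real CARD('d) * u x)"
    using assms unfolding massive_harmonic_at_def by (simp add: field_simps)
  then show ?thesis by (simp add: algebra_simps)
qed

text \<open>For k \<le> 1/2 the potential 2 d k / (1 - k) is at most 4 d k.\<close>

lemma massive_harmonic_lap_bounds:
  fixes u :: "int ^ 'd \<Rightarrow> real"
  assumes "massive_harmonic_at k u x" "0 \<le> k x" "k x \<le> 1 / 2" "u x \<ge> 0"
  shows "0 \<le> lap u x" "lap u x \<le> 4 * real CARD('d) * k x * u x"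
proof -
  let ?r = "2 * real CARD('d) * k x * u x"
  have e: "(1 - k x) * lap u x = ?r" by (rule massive_harmonic_at_lap[OF assms(1)])
  have r: "?r \<ge> 0" using assms by simp
  then have "0 \<le> (1 - k x) * lap u x" using e by simp
  then show l: "0 \<le> lap u x" using assms(3) by (simp add: zero_le_mult_iff)
  have "1 / 2 * lap u x \<le> (1 - k x) * lap u x"
    using assms l by (intro mult_right_mono) auto
  then show "lap u x \<le> 4 * real CARD('d) * k x * u x" using e by simp
qed

section \<open>Cubes, shells and the minimum principle\<close>

definition cube :: "nat \<Rightarrow> (int ^ 'd) set"
  where "cube n = {x. \<forall>i. \<bar>x $ i\<bar> \<le> int n}"

definition shell :: "nat \<Rightarrow> (int ^ 'd) set"
  where "shell n = {x. (\<forall>i. \<bar>x $ i\<bar> \<le> int n) \<and> (\<exists>i. \<bar>x $ i\<bar> = int n)}"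

text \<open>The reference point of a shell, with which all its other points are compared.\<close>

definition corner :: "nat \<Rightarrow> int ^ 'd"
  where "corner n = (\<chi> i. int n)"

definition upd :: "int ^ 'd \<Rightarrow> 'd \<Rightarrow> int \<Rightarrow> int ^ 'd"
  where "upd x i c = (\<chi> j. if j = i then c else x $ j)"

lemma upd_nth [simp]: "upd x i c $ j = (if j = i then c else x $ j)"
  by (simp add: upd_def)

lemma finite_cube: "finite (cube n :: (int ^ 'd) set)"
proof -
  have "cube n = {x :: int ^ 'd. \<forall>i. x $ i \<in> {- int n..int n}}" by (simp add: cube_def abs_le_iff minus_le_iff conj_commute)
  then show ?thesis using finite_vec_components[of "\<lambda>_. {- int n..int n}"] by simp
qed

lemma cube_mono: "m \<le> n \<Longrightarrow> cube m \<subseteq> cube n"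
  unfolding cube_def by (auto intro: order_trans)

lemma shell_subset_cube: "shell n \<subseteq> cube n"
  by (auto simp: shell_def cube_def)

lemma corner_in_shell: "corner n \<in> shell n"
  by (simp add: corner_def shell_def)

lemma adj_component:
  assumes "x \<sim>\<^sub>Z y"
  shows "\<bar>y $ i\<bar> \<le> \<bar>x $ i\<bar> + 1"
proof -
  obtain j where "y = x + axis j 1 \<or> y = x - axis j 1" using assms by (auto simp: adj_iff)
  then show ?thesis by (auto simp: axis_def)
qed

lemma cube_adj: "x \<in> cube n \<Longrightarrow> x \<sim>\<^sub>Z y \<Longrightarrow> y \<in> cube (Suc n)"
  unfolding cube_def using adj_component[of x y] by (force intro: order_trans)

lemma cube_boundary:
  assumes "x \<in> cube (n - 1)" "x \<sim>\<^sub>Z y" "y \<notin> cube (n - 1)" "n \<ge> 1"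
  shows "y \<in> shell n"
proof -
  have "y \<in> cube n" using cube_adj[OF assms(1,2)] assms(4) by simp
  moreover obtain i where "\<not> \<bar>y $ i\<bar> \<le> int (n - 1)" using assms(3) by (auto simp: cube_def)
  moreover have "\<bar>y $ i\<bar> \<le> int n" using \<open>y \<in> cube n\<close> by (simp add: cube_def)
  ultimately have "\<bar>y $ i\<bar> = int n" using assms(4) by linarith
  then show ?thesis using \<open>y \<in> cube n\<close> by (auto simp: shell_def cube_def)
qed

lemma cube_cases: "n \<ge> 1 \<Longrightarrow> x \<in> cube n \<Longrightarrow> x \<in> cube (n - 1) \<or> x \<in> shell n"
  unfolding cube_def shell_def by (auto simp: of_nat_diff) (metis linorder_not_less zle_diff1_eq order_antisym)

lemma sqn_ge_square: "\<bar>c\<bar> \<le> \<bar>x $ i\<bar> \<Longrightarrow> c\<^sup>2 \<le> sqn x"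
  using component_le_sqn[of x i] by (simp add: abs_le_square_iff)

lemma adj_axis: "x \<sim>\<^sub>Z x + axis i 1" "x \<sim>\<^sub>Z x - axis i 1"
  by (auto simp: adj_iff)

text \<open>Suppose the minimum is negative, and among the points of \<open>A\<close> attaining it
  take one with largest i-th coordinate. Its neighbour in direction i has a strictly larger value,
  so the average over the neighbours exceeds the minimum. Multiplying that average by 1 - k, a
  number in [0,1], can lower it only if it is nonnegative, and then the result is still nonnegative;
  so equality with the minimum is impossible.\<close>

lemma minimum_principle:
  fixes w :: "int ^ 'd \<Rightarrow> real"
  assumes A: "finite A" and k: "\<And>x. k x \<in> {0..1}"
    and harm: "\<And>x. x \<in> A \<Longrightarrow> massive_harmonic_at k w x"
    and bd: "\<And>x y. x \<in> A \<Longrightarrow> x \<sim>\<^sub>Z y \<Longrightarrow> y \<notin> A \<Longrightarrow> w y \<ge> 0"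
    and x: "x \<in> A"
  shows "w x \<ge> 0"
proof (rule ccontr)
  assume "\<not> w x \<ge> 0"
  define \<mu> where "\<mu> = Min (w ` A)"
  have \<mu>: "\<mu> \<le> w y" if "y \<in> A" for y using A that by (simp add: \<mu>_def)
  have \<mu>0: "\<mu> < 0" using \<mu>[OF x] \<open>\<not> w x \<ge> 0\<close> by simp
  define B where "B = {y\<in>A. w y = \<mu>}"
  have "\<mu> \<in> w ` A" unfolding \<mu>_def using A x by (intro Min_in) auto
  then have B: "finite B" "B \<noteq> {}" using A by (auto simp: B_def)
  obtain i :: 'd where True by simp
  obtain z where z: "z \<in> B" "\<And>y. y \<in> B \<Longrightarrow> y $ i \<le> z $ i"
  proof -
    have "Max ((\<lambda>y. y $ i) ` B) \<in> (\<lambda>y. y $ i) ` B" using B by (intro Max_in) auto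
    then obtain z where "z \<in> B" "z $ i = Max ((\<lambda>y. y $ i) ` B)" by auto
    then show ?thesis using that[of z] B by simp
  qed
  have zA: "z \<in> A" "w z = \<mu>" using z by (auto simp: B_def)
  have nb: "\<mu> \<le> w y" if "z \<sim>\<^sub>Z y" for y
    using \<mu>[of y] bd[OF zA(1) that] \<mu>0 by (cases "y \<in> A") auto
  have "z + axis i 1 \<notin> B" using z(2)[of "z + axis i 1"] by auto
  then have "\<mu> < w (z + axis i 1)"
    using \<mu>[of "z + axis i 1"] bd[OF zA(1) adj_axis(1)[of z i]] \<mu>0
    by (cases "z + axis i 1 \<in> A") (auto simp: B_def)
  then have "(\<Sum>y | z \<sim>\<^sub>Z y. \<mu>) < (\<Sum>y | z \<sim>\<^sub>Z y. w y)"
    using nb adj_axis(1)[of z i] by (intro sum_strict_mono_ex1) (auto simp: card_neighbours)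
  then have s: "2 * real CARD('d) * \<mu> < (\<Sum>y | z \<sim>\<^sub>Z y. w y)" by (simp add: card_neighbours)
  define c where "c = (\<Sum>y | z \<sim>\<^sub>Z y. w y) / (2 * real CARD('d))"
  have c: "\<mu> < c" using s by (simp add: c_def field_simps)
  have "\<mu> = (1 - k z) * c" using harm[OF zA(1)] zA(2) by (simp add: massive_harmonic_at_def c_def)
  moreover have "(1 - k z) * c > \<mu>"
  proof (cases "c \<ge> 0")
    case True
    then have "(1 - k z) * c \<ge> 0" using k[of z] by simp
    then show ?thesis using \<mu>0 by simp
  next
    case False
    then have "k z * c \<le> 0" using k[of z] by (intro mult_nonneg_nonpos) auto
    then have "(1 - k z) * c \<ge> c" by (simp add: algebra_simps)
    then show ?thesis using c by simp
  qed
  ultimately show False by simp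
qed

lemma massive_harmonic_linear:
  assumes "massive_harmonic_at k u x" "massive_harmonic_at k v x"
  shows "massive_harmonic_at k (\<lambda>y. a * u y + b * v y) x"
proof -
  define c where "c = (1 - k x) / (2 * real CARD('a))"
  have "a * u x + b * v x = a * (c * (\<Sum>y | x \<sim>\<^sub>Z y. u y)) + b * (c * (\<Sum>y | x \<sim>\<^sub>Z y. v y))"
    using assms by (simp only: massive_harmonic_at_def c_def)
  also have "\<dots> = c * (\<Sum>y | x \<sim>\<^sub>Z y. a * u y + b * v y)"
    by (simp add: sum.distrib algebra_simps flip: sum_distrib_left)
  finally show ?thesis by (simp only: massive_harmonic_at_def c_def)
qed

lemma massive_harmonic_cong:
  assumes "u x = v x" "\<And>y. x \<sim>\<^sub>Z y \<Longrightarrow> u y = v y"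
  shows "massive_harmonic_at k u x \<longleftrightarrow> massive_harmonic_at k v x"
proof -
  have "(\<Sum>y | x \<sim>\<^sub>Z y. u y) = (\<Sum>y | x \<sim>\<^sub>Z y. v y)" using assms(2) by (intro sum.cong) auto
  then show ?thesis by (simp only: massive_harmonic_at_def assms(1))
qed

text \<open>With m = n div 8 and S = m^2, the ball 16 S about a shell point has radius 4 m \<le> n /
  2. It therefore stays inside the cube of size 2 n - 1, and some coordinate of each of its points
  has modulus at least n / 2. There q \<ge> n^2 / 4, so k \<le> 4 / n^2, and \<kappa> S is bounded
  independently of n. The threshold 160 d gives S \<ge> m \<ge> 20 d.\<close>

lemma shell_harnack_local:
  fixes k :: "int ^ 'd \<Rightarrow> real"
  assumes k: "\<And>x. k x \<in> {0..1}" and decay: "\<forall>x. sqn x \<ge> int N \<longrightarrow> k x * of_int (sqn x) \<le> 1"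
  shows "\<exists>C\<ge>1. \<forall>n \<ge> 160 * CARD('d) + 2 * N. \<forall>u.
    (\<forall>x\<in>cube (2 * n). u x \<ge> 0) \<longrightarrow> (\<forall>x\<in>cube (2 * n - 1). massive_harmonic_at k u x) \<longrightarrow>
    (\<forall>x\<in>shell n. \<forall>y\<in>shell n. sqn (x - y) \<le> (int (n div 8))\<^sup>2 \<longrightarrow> u x \<le> C * u y)"
proof -
  obtain C :: real where C: "C > 0"
    "\<And>(u :: int ^ 'd \<Rightarrow> real) \<kappa> S x x'. (\<And>y. u y \<ge> 0) \<Longrightarrow> 0 \<le> \<kappa> \<Longrightarrow> \<kappa> \<le> 1 \<Longrightarrow>
      16 * \<kappa> * real S \<le> 4 * real CARD('d) \<Longrightarrow> S \<ge> 20 * CARD('d) \<Longrightarrow> sqn (x - x') \<le> int S \<Longrightarrow>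
      (\<And>y. sqn (y - x') < 16 * int S \<Longrightarrow> 0 \<le> lap u y \<and> lap u y \<le> \<kappa> * u y) \<Longrightarrow>
      u x \<le> C * u x'"
    using harnack[where ?'d = 'd] by blast
  have d1: "CARD('d) \<ge> 1" by (simp add: Suc_leI)
  have "u x \<le> max C 1 * u x'"
    if n: "n \<ge> 160 * CARD('d) + 2 * N"
      and pos: "\<forall>x\<in>cube (2 * n). u x \<ge> 0" and harm: "\<forall>x\<in>cube (2 * n - 1). massive_harmonic_at k u x"
      and x: "x \<in> shell n" and x': "x' \<in> shell n" and close: "sqn (x - x') \<le> (int (n div 8))\<^sup>2"
    for n and u :: "int ^ 'd \<Rightarrow> real" and x x'
  proof -
    define m where "m = n div 8"
    define S where "S = m\<^sup>2"
    \<comment> \<open>The bound 4 d k of \<open>massive_harmonic_lap_bounds\<close> for k \<le> 4 /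
      n^2.\<close>
    define \<kappa> where "\<kappa> = 16 * real CARD('d) / (real n)\<^sup>2"
    \<comment> \<open>\<open>harnack\<close> asks for nonnegativity on the whole lattice; cutting
      \<open>u\<close> off outside the cube 2 n is not felt by the Laplacian on the cube 2 n -
      1.\<close>
    define v where "v y = (if y \<in> cube (2 * n) then u y else 0)" for y
    have n160: "n \<ge> 160" using n d1 by linarith
    have m8: "8 * m \<le> n" "20 * CARD('d) \<le> m" using n by (auto simp: m_def)
    have n0: "real n > 0" using n160 by simp
    have "real CARD('d) * 160 \<le> real n" using n by linarith
    moreover have "real n * 1 \<le> real n * real n" using n160 by (intro mult_left_mono) auto
    ultimately have "16 * real CARD('d) \<le> (real n)\<^sup>2" by (simp add: power2_eq_square)
    then have \<kappa>: "0 \<le> \<kappa>" "\<kappa> \<le> 1" using n0 by (auto simp: \<kappa>_def field_simps)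
    have "real (8 * m) \<le> real n" using m8 by linarith
    then have "(real (8 * m))\<^sup>2 \<le> (real n)\<^sup>2" by (intro power_mono) auto
    then have "64 * (real m)\<^sup>2 \<le> (real n)\<^sup>2" by (simp add: power_mult_distrib)
    then have "256 * real CARD('d) * (real m)\<^sup>2 \<le> 4 * real CARD('d) * (real n)\<^sup>2"
      using mult_left_mono[of "64 * (real m)\<^sup>2" "(real n)\<^sup>2" "4 * real CARD('d)"] by simp
    then have \<kappa>S: "16 * \<kappa> * real S \<le> 4 * real CARD('d)"
      using n0 by (simp add: \<kappa>_def S_def field_simps)
    have "m * 1 \<le> m * m" by (intro mult_left_mono) (use m8 d1 in linarith)+
    then have "m \<le> S" by (simp add: S_def power2_eq_square)
    then have S20: "S \<ge> 20 * CARD('d)" using m8 by linarith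
    have "v x \<le> C * v x'"
    proof (rule C(2)[OF _ \<kappa> \<kappa>S S20])
      show "v y \<ge> 0" for y using pos by (simp add: v_def)
      show "sqn (x - x') \<le> int S" using close by (simp add: S_def m_def)
      fix y assume y: "sqn (y - x') < 16 * int S"
      have near: "\<bar>y $ i - x' $ i\<bar> < 4 * int m" for i
      proof -
        have "(y $ i - x' $ i)\<^sup>2 < (4 * int m)\<^sup>2"
          using y component_le_sqn[of "y - x'" i] by (simp add: S_def power_mult_distrib)
        then have "\<bar>y $ i - x' $ i\<bar> < \<bar>4 * int m\<bar>" using abs_le_square_iff[of "4 * int m" "y $ i - x' $ i"] by linarith
        then show ?thesis by simp
      qed
      have "\<bar>y $ i\<bar> \<le> int (2 * n - 1)" for i
      proof -
        have "\<bar>x' $ i\<bar> \<le> int n" using x' by (simp add: shell_def)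
        then show ?thesis using near[of i] m8 n160 by linarith
      qed
      then have yb: "y \<in> cube (2 * n - 1)" by (simp add: cube_def)
      then have yb2: "y \<in> cube (2 * n)" using cube_mono[of "2 * n - 1" "2 * n"] by auto
      have "v z = u z" if "y \<sim>\<^sub>Z z" for z
        using cube_adj[OF yb that] n160 by (simp add: v_def)
      then have mh: "massive_harmonic_at k v y"
        using harm yb yb2 massive_harmonic_cong[of v y u k] by (simp add: v_def)
      obtain i where "\<bar>x' $ i\<bar> = int n" using x' by (auto simp: shell_def)
      then have "int n \<le> \<bar>2 * y $ i\<bar>" using near[of i] m8 by linarith
      then have "(int n)\<^sup>2 \<le> (2 * y $ i)\<^sup>2" by (simp add: abs_le_square_iff[of "int n", simplified])
      then have q: "(int n)\<^sup>2 \<le> 4 * sqn y" using component_le_sqn[of y i] by (simp add: power_mult_distrib)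
      have "2 * N * 2 \<le> n * n" using n n160 by (intro mult_le_mono) linarith+
      then have "4 * int N \<le> (int n)\<^sup>2" by (simp add: power2_eq_square flip: of_nat_mult)
      then have "int N \<le> sqn y" using q by linarith
      then have "k y * of_int (sqn y) \<le> 1" using decay by blast
      moreover have "real_of_int ((int n)\<^sup>2) \<le> real_of_int (4 * sqn y)"
        using q by (simp only: of_int_le_iff)
      then have q': "(real n)\<^sup>2 \<le> 4 * of_int (sqn y)" by simp
      then have "k y * (real n)\<^sup>2 \<le> k y * (4 * of_int (sqn y))" using k[of y] by (intro mult_left_mono) auto
      ultimately have k4: "k y * (real n)\<^sup>2 \<le> 4" by simp
      then have k4': "k y \<le> 4 / (real n)\<^sup>2" using n0 by (simp add: field_simps)
      have "(160::real)\<^sup>2 \<le> (real n)\<^sup>2" using n160 by (intro power_mono) auto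
      then have "4 / (real n)\<^sup>2 \<le> 1 / 2" using n0 by (simp add: field_simps)
      then have kh: "k y \<le> 1 / 2" using k4' by linarith
      have vy: "v y \<ge> 0" using pos by (simp add: v_def)
      have b: "0 \<le> lap v y" "lap v y \<le> 4 * real CARD('d) * k y * v y"
        using massive_harmonic_lap_bounds[OF mh _ kh vy] k[of y] by auto
      have "4 * real CARD('d) * k y * v y \<le> 4 * real CARD('d) * (4 / (real n)\<^sup>2) * v y"
        using k4' vy by (intro mult_right_mono mult_left_mono) auto
      also have "\<dots> = \<kappa> * v y" by (simp add: \<kappa>_def)
      finally show "0 \<le> lap v y \<and> lap v y \<le> \<kappa> * v y" using b by linarith
    qed
    moreover have "v x = u x" "v x' = u x'" 
      using x x' shell_subset_cube[of n] cube_mono[of n "2 * n"] by (auto simp: v_def)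
    moreover have "u x' \<ge> 0"
      using pos x' shell_subset_cube[of n] cube_mono[of n "2 * n"] by auto
    then have "C * u x' \<le> max C 1 * u x'" by (intro mult_right_mono) auto
    ultimately show ?thesis by simp
  qed
  then show ?thesis by (intro exI[of _ "max C 1"]) auto
qed

text \<open>Coordinate i moves in strides of length at most m while another coordinate keeps modulus
  n, so every intermediate point remains on the shell. Each stride costs one factor
  \<open>C\<close>.\<close>

lemma shell_chain_coordinate:
  fixes u :: "int ^ 'd \<Rightarrow> real"
  assumes step: "\<And>x y. x \<in> shell n \<Longrightarrow> y \<in> shell n \<Longrightarrow> sqn (x - y) \<le> (int m)\<^sup>2 \<Longrightarrow> u x \<le> C * u y"
    and C: "C \<ge> 1" and x: "x \<in> cube n" and j: "j \<noteq> i" "\<bar>x $ j\<bar> = int n"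
  shows "\<bar>b\<bar> \<le> int n \<Longrightarrow> \<bar>c\<bar> \<le> int n \<Longrightarrow> \<bar>b - c\<bar> \<le> int (L * m) \<Longrightarrow> u (upd x i b) \<le> C ^ L * u (upd x i c)"
proof (induction L arbitrary: b)
  case (Suc L)
  have sh: "upd x i c \<in> shell n" if "\<bar>c\<bar> \<le> int n" for c
    using that x j by (auto simp: shell_def cube_def intro!: exI[of _ j])
  define b' where "b' = (if \<bar>b - c\<bar> \<le> int m then c else if b < c then b + int m else b - int m)"
  have b': "\<bar>b'\<bar> \<le> int n" "\<bar>b - b'\<bar> \<le> int m" "\<bar>b' - c\<bar> \<le> int (L * m)"
    using Suc.prems by (auto simp: b'_def abs_if split: if_splits)
  have "sqn (upd x i b - upd x i b') = (\<Sum>j\<in>UNIV. if j = i then (b - b')\<^sup>2 else 0)"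
    unfolding sqn_def by (intro sum.cong) auto
  also have "\<dots> = (b - b')\<^sup>2" by simp
  also have "\<dots> \<le> (int m)\<^sup>2" using b'(2) abs_le_square_iff[of "b - b'" "int m"] by simp
  finally have "u (upd x i b) \<le> C * u (upd x i b')"
    using Suc.prems b' by (intro step sh) auto
  also have "\<dots> \<le> C * (C ^ L * u (upd x i c))"
    using C b' Suc.prems by (intro mult_left_mono Suc.IH) auto
  finally show ?case by simp
qed simp

text \<open>A coordinate i of modulus n is held fixed while the others are moved to n one after the
  other. Coordinate i itself moves last, when some other coordinate i', which exists because d \<ge>
  2, is already n. A coordinate travels at most 2 n, hence at most \<open>L\<close> strides.\<close>

lemma shell_chain_corner:
  fixes u :: "int ^ 'd \<Rightarrow> real"
  assumes d: "CARD('d) \<ge> 2"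
    and step: "\<And>x y. x \<in> shell n \<Longrightarrow> y \<in> shell n \<Longrightarrow> sqn (x - y) \<le> (int m)\<^sup>2 \<Longrightarrow> u x \<le> C * u y"
    and C: "C \<ge> 1" and nm: "2 * n \<le> L * m"
    and x: "x \<in> shell n"
  shows "u x \<le> (C ^ L) ^ CARD('d) * u (corner n)" "u (corner n) \<le> (C ^ L) ^ CARD('d) * u x"
proof -
  obtain i where i: "\<bar>x $ i\<bar> = int n" using x by (auto simp: shell_def)
  obtain i' where i': "i' \<noteq> i"
  proof -
    have "UNIV \<noteq> {i}" using d by (metis card_1_singleton_iff One_nat_def Suc_1 not_less_eq_eq order_refl)
    then show ?thesis using that by blast
  qed
  have K1: "C ^ L \<ge> 1" using C by simp
  \<comment> \<open>\<open>A\<close> is the set of coordinates already moved to n.\<close>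
  define X where "X A = (\<chi> j. if j \<in> A then int n else x $ j)" for A
  have XB: "X A \<in> cube n" for A using x by (auto simp: X_def cube_def shell_def)
  have move: "u (upd y j b) \<le> C ^ L * u (upd y j c)"
    if "y \<in> cube n" "l \<noteq> j" "\<bar>y $ l\<bar> = int n" "\<bar>b\<bar> \<le> int n" "\<bar>c\<bar> \<le> int n" for y j l b c
  proof (rule shell_chain_coordinate[OF step C that(1-5)])
    have "\<bar>b - c\<bar> \<le> int (2 * n)" using that by linarith
    then show "\<bar>b - c\<bar> \<le> int (L * m)" using nm by (metis of_nat_le_iff order_trans)
  qed
  have "u x \<le> (C ^ L) ^ card A * u (X A) \<and> u (X A) \<le> (C ^ L) ^ card A * u x" if "A \<subseteq> UNIV - {i}" for A
    using finite[of A] that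
  proof (induction A rule: finite_induct)
    case empty
    have "X {} = x" by (simp add: X_def vec_eq_iff)
    then show ?case by simp
  next
    case (insert j A)
    have e: "X (insert j A) = upd (X A) j (int n)" "X A = upd (X A) j (X A $ j)"
      by (auto simp: X_def vec_eq_iff)
    have p: "X A \<in> cube n" "i \<noteq> j" "\<bar>X A $ i\<bar> = int n" "\<bar>X A $ j\<bar> \<le> int n" "\<bar>int n\<bar> \<le> int n"
      using insert XB[of A] XB[of "{}"] i by (auto simp: X_def cube_def)
    have 1: "u (X A) \<le> C ^ L * u (X (insert j A))" "u (X (insert j A)) \<le> C ^ L * u (X A)"
      using move[OF p(1-5)] move[OF p(1-3) p(5) p(4)] e by simp_all
    have IH: "u x \<le> (C ^ L) ^ card A * u (X A)" "u (X A) \<le> (C ^ L) ^ card A * u x"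
      using insert by auto
    have "u x \<le> (C ^ L) ^ card A * (C ^ L * u (X (insert j A)))"
      by (rule order_trans[OF IH(1) mult_left_mono[OF 1(1)]]) (use K1 in simp)
    moreover have "u (X (insert j A)) \<le> C ^ L * ((C ^ L) ^ card A * u x)"
      by (rule order_trans[OF 1(2) mult_left_mono[OF IH(2)]]) (use K1 in simp)
    ultimately show ?case using insert by (simp add: mult_ac)
  qed
  from this[of "UNIV - {i}"]
  have a: "u x \<le> (C ^ L) ^ card (UNIV - {i}) * u (X (UNIV - {i}))" "u (X (UNIV - {i})) \<le> (C ^ L) ^ card (UNIV - {i}) * u x"
    by auto
  have e: "corner n = upd (X (UNIV - {i})) i (int n)" "X (UNIV - {i}) = upd (X (UNIV - {i})) i (x $ i)"
    by (auto simp: X_def vec_eq_iff corner_def)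
  have p: "X (UNIV - {i}) \<in> cube n" "i' \<noteq> i" "\<bar>X (UNIV - {i}) $ i'\<bar> = int n" "\<bar>x $ i\<bar> \<le> int n" "\<bar>int n\<bar> \<le> int n"
    using XB[of "UNIV - {i}"] i i' unfolding X_def by simp_all
  have b: "u (X (UNIV - {i})) \<le> C ^ L * u (corner n)" "u (corner n) \<le> C ^ L * u (X (UNIV - {i}))"
    using move[OF p(1-5)] move[OF p(1-3) p(5) p(4)] e by simp_all
  have "(C ^ L) ^ CARD('d) = (C ^ L) ^ card (UNIV - {i}) * C ^ L"
    using card.remove[of UNIV i] by (simp flip: power_Suc2 del: power_Suc)
  moreover have "u x \<le> (C ^ L) ^ card (UNIV - {i}) * (C ^ L * u (corner n))"
    by (rule order_trans[OF a(1) mult_left_mono[OF b(1)]]) (use K1 in simp)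
  moreover have "u (corner n) \<le> C ^ L * ((C ^ L) ^ card (UNIV - {i}) * u x)"
    by (rule order_trans[OF b(2) mult_left_mono[OF a(2)]]) (use K1 in simp)
  ultimately show "u x \<le> (C ^ L) ^ CARD('d) * u (corner n)" "u (corner n) \<le> (C ^ L) ^ CARD('d) * u x"
    by (simp_all add: mult_ac)
qed

lemma shell_harnack:
  fixes k :: "int ^ 'd \<Rightarrow> real"
  assumes d: "CARD('d) \<ge> 2" and k: "\<And>x. k x \<in> {0..1}"
    and decay: "\<forall>x. sqn x \<ge> int N \<longrightarrow> k x * of_int (sqn x) \<le> 1"
  shows "\<exists>C\<ge>1. \<forall>n \<ge> 160 * CARD('d) + 2 * N. \<forall>u.
    (\<forall>x\<in>cube (2 * n). u x \<ge> 0) \<longrightarrow> (\<forall>x\<in>cube (2 * n - 1). massive_harmonic_at k u x) \<longrightarrow>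
    (\<forall>x\<in>shell n. u x \<le> C * u (corner n) \<and> u (corner n) \<le> C * u x)"
proof -
  obtain C where C: "C \<ge> 1" "\<And>n u x y. n \<ge> 160 * CARD('d) + 2 * N \<Longrightarrow>
    (\<forall>x\<in>cube (2 * n). u x \<ge> 0) \<Longrightarrow> (\<forall>x\<in>cube (2 * n - 1). massive_harmonic_at k u x) \<Longrightarrow>
    x\<in>shell n \<Longrightarrow> y\<in>shell n \<Longrightarrow> sqn (x - y) \<le> (int (n div 8))\<^sup>2 \<Longrightarrow> u x \<le> C * u y"
    using shell_harnack_local[OF k decay] by metis
  have "u x \<le> (C ^ 24) ^ CARD('d) * u (corner n) \<and> u (corner n) \<le> (C ^ 24) ^ CARD('d) * u x"
    if n: "n \<ge> 160 * CARD('d) + 2 * N" and u: "\<forall>x\<in>cube (2 * n). u x \<ge> 0"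
      "\<forall>x\<in>cube (2 * n - 1). massive_harmonic_at k u x" and x: "x \<in> shell n"
    for n and u :: "int ^ 'd \<Rightarrow> real" and x
  proof -
    \<comment> \<open>Up to rounding, 16 strides of length n / 8 cover 2 n; 24 strides of length n
      div 8 suffice once n \<ge> 21.\<close>
    have "2 * n \<le> 24 * (n div 8)" using n d by linarith
    moreover have "u x \<le> C * u y" if "x \<in> shell n" "y \<in> shell n" "sqn (x - y) \<le> (int (n div 8))\<^sup>2" for x y
      using C(2)[OF n u that] .
    ultimately show ?thesis
      using shell_chain_corner[where m = "n div 8" and L = 24 and C = C and u = u, OF d _ C(1) _ x] by auto
  qed
  then show ?thesis using C(1) by (intro exI[of _ "(C ^ 24) ^ CARD('d)"]) auto
qed


section \<open>Ratio bounds on nested cubes\<close>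

definition ratio_within :: "(int ^ 'd \<Rightarrow> real) \<Rightarrow> (int ^ 'd \<Rightarrow> real) \<Rightarrow> nat \<Rightarrow> real \<Rightarrow> real \<Rightarrow> bool"
  where "ratio_within u v n a b \<longleftrightarrow> (\<forall>x\<in>cube n. a * v x \<le> u x \<and> u x \<le> b * v x)"

lemma nonneg_on_cube:
  fixes w :: "int ^ 'd \<Rightarrow> real"
  assumes k: "\<And>x. k x \<in> {0..1}" and n: "n \<ge> 1"
    and harm: "\<And>x. x \<in> cube (n - 1) \<Longrightarrow> massive_harmonic_at k w x"
    and bd: "\<And>x. x \<in> shell n \<Longrightarrow> w x \<ge> 0"
    and x: "x \<in> cube n"
  shows "w x \<ge> 0"
proof (cases "x \<in> shell n")
  case False
  then have "x \<in> cube (n - 1)" using cube_cases[OF n x] by blast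
  then show ?thesis
    using minimum_principle[OF finite_cube k harm, of "n - 1"] cube_boundary[OF _ _ _ n] bd by blast
qed (rule bd)

text \<open>The minimum principle for u - a v and b v - u. It takes the bounds through the region
  near the origin where Harnack's inequality fails, and avoids quotients because v may vanish inside
  the cube.\<close>

lemma ratio_within_shell:
  fixes u v :: "int ^ 'd \<Rightarrow> real"
  assumes k: "\<And>x. k x \<in> {0..1}" and n: "n \<ge> 1"
    and u: "\<And>x. x \<in> cube (n - 1) \<Longrightarrow> massive_harmonic_at k u x"
    and v: "\<And>x. x \<in> cube (n - 1) \<Longrightarrow> massive_harmonic_at k v x"
    and bd: "\<And>x. x \<in> shell n \<Longrightarrow> a * v x \<le> u x \<and> u x \<le> b * v x"
  shows "ratio_within u v n a b"
  unfolding ratio_within_def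
proof
  fix x :: "int ^ 'd" assume x: "x \<in> cube n"
  have harm: "massive_harmonic_at k (\<lambda>x. p * u x + q * v x) y" if "y \<in> cube (n - 1)" for p q y
    by (rule massive_harmonic_linear[OF u[OF that] v[OF that]])
  have "0 \<le> 1 * u x + (- a) * v x"
    by (rule nonneg_on_cube[OF k n harm _ x]) (use bd in auto)
  moreover have "0 \<le> (- 1) * u x + b * v x"
    by (rule nonneg_on_cube[OF k n harm _ x]) (use bd in auto)
  ultimately show "a * v x \<le> u x \<and> u x \<le> b * v x" by simp
qed

text \<open>
  One of the two nonnegative functions \<open>u - a v\<close> and \<open>b v - u\<close> is at least
  \<open>(b - a) v / 2\<close> at the corner, and Harnack's inequality spreads this over the shell.
\<close>

lemma oscillation_step:
  fixes u v :: "int ^ 'd \<Rightarrow> real"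
  assumes k: "\<And>x. k x \<in> {0..1}" and n: "n \<ge> 1" and C: "C \<ge> 1"
    and harnack: "\<And>w x. \<forall>x\<in>cube (2 * n). w x \<ge> 0 \<Longrightarrow> \<forall>x\<in>cube (2 * n - 1). massive_harmonic_at k w x \<Longrightarrow>
      x \<in> shell n \<Longrightarrow> w x \<le> C * w (corner n) \<and> w (corner n) \<le> C * w x"
    and u: "\<And>x. x \<in> cube (2 * n - 1) \<Longrightarrow> massive_harmonic_at k u x"
    and v: "\<And>x. x \<in> cube (2 * n - 1) \<Longrightarrow> massive_harmonic_at k v x" "\<And>x. x \<in> cube (2 * n) \<Longrightarrow> v x \<ge> 0"
    and ab: "ratio_within u v (2 * n) a b" "a \<le> b"
  shows "\<exists>a' b'. a \<le> a' \<and> a' \<le> b' \<and> b' - a' \<le> (1 - 1 / (2 * C\<^sup>2)) * (b - a) \<and> ratio_within u v n a' b'"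
proof -
  define z :: "int ^ 'd" where "z = corner n"
  \<comment> \<open>One factor \<open>C\<close> is spent on v x \<le> C v z, the other on w z \<le>
    C w x; the 2 is the half of the oscillation present at the corner.\<close>
  define \<delta> where "\<delta> = (b - a) / (2 * C\<^sup>2)"
  have C2: "C\<^sup>2 \<ge> 1" using C by (simp add: one_le_power)
  have \<delta>: "0 \<le> \<delta>" "\<delta> \<le> b - a"
  proof -
    show "0 \<le> \<delta>" using ab C by (simp add: \<delta>_def)
    have "(b - a) / (2 * C\<^sup>2) \<le> (b - a) / 1" using ab C2 by (intro divide_left_mono) auto
    then show "\<delta> \<le> b - a" by (simp add: \<delta>_def)
  qed
  have sub: "shell n \<subseteq> cube (2 * n)" "cube (n - 1) \<subseteq> cube (2 * n - 1)"
    using shell_subset_cube[of n] cube_mono[of n "2 * n"] cube_mono[of "n - 1" "2 * n - 1"] by (auto simp del: One_nat_def simp: diff_le_mono)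
  have improve: "\<delta> * v x \<le> w x"
    if w: "\<And>x. w x = p * u x + q * v x" and w0: "\<And>x. x \<in> cube (2 * n) \<Longrightarrow> w x \<ge> 0"
      and big: "(b - a) / 2 * v z \<le> w z" and x: "x \<in> shell n" for w p q x
  proof -
    have "v x \<le> C * v z" unfolding z_def using harnack[OF _ _ x, of v] v by blast
    then have "\<delta> * v x \<le> \<delta> * (C * v z)" using \<delta> by (intro mult_left_mono)
    also have "\<dots> = (b - a) / 2 * v z / C" using C by (simp add: \<delta>_def power2_eq_square field_simps)
    also have "\<dots> \<le> w z / C" using big C by (intro divide_right_mono) auto
    also have "w z \<le> C * w x"
    proof -
      have "\<forall>x\<in>cube (2 * n - 1). massive_harmonic_at k w x"
        using massive_harmonic_linear[OF u v(1)] unfolding w by blast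
      then show ?thesis unfolding z_def using harnack[OF _ _ x, of w] w0 by blast
    qed
    then have "w z / C \<le> w x" using C by (simp add: field_simps)
    finally show ?thesis .
  qed
  consider "(b - a) / 2 * v z \<le> 1 * u z + (- a) * v z" | "(b - a) / 2 * v z \<le> (- 1) * u z + b * v z"
    by (cases "(a + b) / 2 * v z \<le> u z") (auto simp: field_simps)
  then show ?thesis
  proof cases
    case 1
    have "(a + \<delta>) * v x \<le> u x \<and> u x \<le> b * v x" if "x \<in> shell n" for x
    proof -
      have "\<delta> * v x \<le> 1 * u x + (- a) * v x"
        by (rule improve[OF refl _ 1 that]) (use ab in \<open>auto simp: ratio_within_def\<close>)
      then show ?thesis using ab sub that by (auto simp: ratio_within_def algebra_simps)
    qed
    then have "ratio_within u v n (a + \<delta>) b"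
      using u v sub by (intro ratio_within_shell[where k = k, OF k n]) auto
    then show ?thesis using \<delta> by (intro exI[of _ "a + \<delta>"] exI[of _ b]) (auto simp: \<delta>_def algebra_simps)
  next
    case 2
    have "a * v x \<le> u x \<and> u x \<le> (b - \<delta>) * v x" if "x \<in> shell n" for x
    proof -
      have "\<delta> * v x \<le> (- 1) * u x + b * v x"
        by (rule improve[OF refl _ 2 that]) (use ab in \<open>auto simp: ratio_within_def\<close>)
      then show ?thesis using ab sub that by (auto simp: ratio_within_def algebra_simps)
    qed
    then have "ratio_within u v n a (b - \<delta>)"
      using u v sub by (intro ratio_within_shell[where k = k, OF k n]) auto
    then show ?thesis using \<delta> by (intro exI[of _ a] exI[of _ "b - \<delta>"]) (auto simp: \<delta>_def algebra_simps)
  qed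
qed

text \<open>Since one Harnack constant serves all scales m \<ge> n, each halving of the cube
  contracts by the same factor.\<close>

lemma oscillation_iterate:
  fixes u v :: "int ^ 'd \<Rightarrow> real"
  assumes k: "\<And>x. k x \<in> {0..1}" and n: "n \<ge> 1" and C: "C \<ge> 1"
    and harnack: "\<And>m w x. m \<ge> n \<Longrightarrow> \<forall>x\<in>cube (2 * m). w x \<ge> 0 \<Longrightarrow> \<forall>x\<in>cube (2 * m - 1). massive_harmonic_at k w x \<Longrightarrow>
      x \<in> shell m \<Longrightarrow> w x \<le> C * w (corner m) \<and> w (corner m) \<le> C * w x"
  shows "(\<And>x. x \<in> cube (2 ^ j * n) \<Longrightarrow> massive_harmonic_at k u x) \<Longrightarrow>
    (\<And>x. x \<in> cube (2 ^ j * n) \<Longrightarrow> massive_harmonic_at k v x) \<Longrightarrow>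
    (\<And>x. x \<in> cube (2 ^ j * n) \<Longrightarrow> v x \<ge> 0) \<Longrightarrow>
    ratio_within u v (2 ^ j * n) a b \<Longrightarrow> a \<le> b \<Longrightarrow>
    \<exists>a' b'. a \<le> a' \<and> a' \<le> b' \<and> b' - a' \<le> (1 - 1 / (2 * C\<^sup>2)) ^ j * (b - a) \<and> ratio_within u v n a' b'"
proof (induction j arbitrary: a b)
  case 0
  then show ?case by (intro exI[of _ a] exI[of _ b]) simp
next
  case (Suc j)
  define m where "m = 2 ^ j * n"
  have m: "m \<ge> n" "2 ^ Suc j * n = 2 * m" by (simp_all add: m_def)
  have sub: "cube (2 * m - 1) \<subseteq> cube (2 * m)" "cube m \<subseteq> cube (2 * m)"
    using cube_mono[of "2 * m - 1" "2 * m"] cube_mono[of m "2 * m"] by auto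
  have m1: "m \<ge> 1" using m n by linarith
  note prems = Suc.prems[unfolded m(2)]
  obtain a' b' where ab': "a \<le> a'" "a' \<le> b'" "b' - a' \<le> (1 - 1 / (2 * C\<^sup>2)) * (b - a)" "ratio_within u v m a' b'"
  proof -
    have "\<exists>a' b'. a \<le> a' \<and> a' \<le> b' \<and> b' - a' \<le> (1 - 1 / (2 * C\<^sup>2)) * (b - a) \<and> ratio_within u v m a' b'"
    proof (rule oscillation_step[OF k m1 C])
      show "w x \<le> C * w (corner m) \<and> w (corner m) \<le> C * w x"
        if "\<forall>x\<in>cube (2 * m). w x \<ge> 0" "\<forall>x\<in>cube (2 * m - 1). massive_harmonic_at k w x" "x \<in> shell m" for w x
        using harnack[OF m(1) that] .
    qed (use prems sub in auto)
    then show ?thesis using that by blast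
  qed
  have \<theta>: "0 \<le> 1 - 1 / (2 * C\<^sup>2)"
  proof -
    have "C\<^sup>2 \<ge> 1" using C by (simp add: one_le_power)
    then have "1 / (2 * C\<^sup>2) \<le> 1 / 1" by (intro divide_left_mono) auto
    then show ?thesis by simp
  qed
  obtain a'' b'' where ab'': "a' \<le> a''" "a'' \<le> b''" "b'' - a'' \<le> (1 - 1 / (2 * C\<^sup>2)) ^ j * (b' - a')" "ratio_within u v n a'' b''"
    using Suc.IH[of a' b'] prems sub ab' unfolding m_def[symmetric] by blast
  have "b'' - a'' \<le> (1 - 1 / (2 * C\<^sup>2)) ^ j * ((1 - 1 / (2 * C\<^sup>2)) * (b - a))"
    using \<theta> by (intro order_trans[OF ab''(3)] mult_left_mono ab'(3) zero_le_power)
  then show ?case using ab'(1) ab''(1,2,4) by (intro exI[of _ a''] exI[of _ b'']) (simp add: mult_ac)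
qed

text \<open>The outermost doubling is spent on Harnack's inequality on the shell of size m = 2^j n,
  which confines u / v to an interval there; the j halvings that follow contract it. The error is
  stated relative to v x / v y, so that a bound on this quotient which is uniform in v yields
  uniform closeness.\<close>

theorem ratio_convergence:
  fixes k :: "int ^ 'd \<Rightarrow> real"
  assumes d: "CARD('d) \<ge> 2" and k: "\<And>x. k x \<in> {0..1}"
    and decay: "\<forall>x. sqn x \<ge> int N \<longrightarrow> k x * of_int (sqn x) \<le> 1"
  shows "\<exists>B \<theta> n0. B \<ge> 0 \<and> 0 \<le> \<theta> \<and> \<theta> < 1 \<and> (\<forall>n\<ge>n0. \<forall>j. \<forall>u v.
    (\<forall>x\<in>cube (2 * (2 ^ j * n)). massive_harmonic_at k u x \<and> massive_harmonic_at k v x \<and> u x \<ge> 0 \<and> v x \<ge> 0) \<longrightarrow>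
    (\<forall>x\<in>shell (2 ^ j * n). u x > 0 \<and> v x > 0) \<longrightarrow>
    (\<forall>x\<in>cube n. \<forall>y\<in>cube n. u y > 0 \<longrightarrow> v y > 0 \<longrightarrow>
      \<bar>u x / u y - v x / v y\<bar> \<le> B * \<theta> ^ j * (v x / v y)))"
proof -
  define n0 where "n0 = 160 * CARD('d) + 2 * N"
  obtain C where C: "C \<ge> 1" and harnack: "\<And>n u x. n \<ge> n0 \<Longrightarrow>
    (\<forall>x\<in>cube (2 * n). u x \<ge> 0) \<Longrightarrow> (\<forall>x\<in>cube (2 * n - 1). massive_harmonic_at k u x) \<Longrightarrow>
    x \<in> shell n \<Longrightarrow> u x \<le> C * u (corner n) \<and> u (corner n) \<le> C * u x"
    using shell_harnack[OF d k decay] unfolding n0_def by metis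
  define \<theta> where "\<theta> = 1 - 1 / (2 * C\<^sup>2)"
  have C2: "C\<^sup>2 \<ge> 1" using C by (simp add: one_le_power)
  have "1 / (2 * C\<^sup>2) \<le> 1 / 1" using C2 by (intro divide_left_mono) auto
  moreover have "1 / (2 * C\<^sup>2) > 0" using C by simp
  ultimately have \<theta>: "0 \<le> \<theta>" "\<theta> < 1" by (simp_all add: \<theta>_def)
  have "\<bar>u x / u y - v x / v y\<bar> \<le> C ^ 4 * \<theta> ^ j * (v x / v y)"
    if n: "n \<ge> n0"
      and uv: "\<forall>x\<in>cube (2 * (2 ^ j * n)). massive_harmonic_at k u x \<and> massive_harmonic_at k v x \<and> u x \<ge> 0 \<and> v x \<ge> 0"
      and pos: "\<forall>x\<in>shell (2 ^ j * n). u x > 0 \<and> v x > 0"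
      and x: "x \<in> cube n" and y: "y \<in> cube n" "u y > 0" "v y > 0" for n j u v x y
  proof -
    define m where "m = 2 ^ j * n"
    have n1: "n \<ge> 1" using n d unfolding n0_def by linarith
    have m: "m \<ge> n" "m \<ge> n0" "m \<ge> 1" using n n1 by (auto simp: m_def intro: order_trans)
    have sub: "cube (2 * m - 1) \<subseteq> cube (2 * m)" "cube m \<subseteq> cube (2 * m)" "cube n \<subseteq> cube m" "cube (m - 1) \<subseteq> cube (2 * m)"
      using m by (auto intro!: cube_mono)
    define z :: "int ^ 'd" where "z = corner m"
    have z: "u z > 0" "v z > 0" using pos corner_in_shell by (auto simp: z_def m_def)
    \<comment> \<open>Comparing both u and v with their corner values costs a factor
      \<open>C\<close> each, so u / v differs from u z / v z by at most a factor C^2 either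
      way.\<close>
    define a where "a = u z / (C\<^sup>2 * v z)"
    define b where "b = C\<^sup>2 * u z / v z"
    have a0: "a > 0" using z C by (simp add: a_def)
    have "C\<^sup>2 * a = u z / v z" using C by (simp add: a_def)
    then have "b = C\<^sup>2 * (C\<^sup>2 * a)" by (simp add: b_def)
    also have "\<dots> = C ^ 4 * a" by algebra
    finally have ba: "b = C ^ 4 * a" .
    have C4: "C ^ 4 \<ge> 1" using C by (simp add: one_le_power)
    then have ab: "a \<le> b" using a0 unfolding ba by (simp add: mult_le_cancel_right1)
    have rab: "ratio_within u v m a b"
    proof (rule ratio_within_shell[OF k m(3)])
      fix w :: "int ^ 'd" assume w: "w \<in> shell m"
      have hu: "u w \<le> C * u z" "u z \<le> C * u w" and hv: "v w \<le> C * v z" "v z \<le> C * v w"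
        using harnack[OF m(2) _ _ w, of u] harnack[OF m(2) _ _ w, of v] uv sub
        unfolding z_def m_def[symmetric] by blast+
      have "a * v w \<le> a * (C * v z)" using hv a0 by (intro mult_left_mono) auto
      also have "\<dots> = u z / C" using z C by (simp add: a_def field_simps power2_eq_square)
      also have "\<dots> \<le> u w" using hu C by (simp add: field_simps)
      finally have 1: "a * v w \<le> u w" .
      have "u w \<le> C * u z" by (rule hu)
      also have "\<dots> = C * u z / v z * v z" using z by simp
      also have "\<dots> \<le> C * u z / v z * (C * v w)" using hv z C by (intro mult_left_mono) auto
      also have "\<dots> = b * v w" by (simp add: b_def power2_eq_square)
      finally show "a * v w \<le> u w \<and> u w \<le> b * v w" using 1 by simp
    qed (use uv sub in \<open>auto simp: m_def\<close>)
    have H: "w x \<le> C * w (corner l) \<and> w (corner l) \<le> C * w x"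
      if "l \<ge> n" "\<forall>x\<in>cube (2 * l). w x \<ge> 0" "\<forall>x\<in>cube (2 * l - 1). massive_harmonic_at k w x" "x \<in> shell l" for l w x
      using harnack[of l w x] that n by simp
    have harm: "x \<in> cube m \<Longrightarrow> massive_harmonic_at k u x" "x \<in> cube m \<Longrightarrow> massive_harmonic_at k v x"
      "x \<in> cube m \<Longrightarrow> v x \<ge> 0" for x
      using uv sub by (auto simp: m_def)
    have "\<exists>a' b'. a \<le> a' \<and> a' \<le> b' \<and> b' - a' \<le> \<theta> ^ j * (b - a) \<and> ratio_within u v n a' b'"
      unfolding \<theta>_def
    proof (rule oscillation_iterate[OF k n1 C])
      show "w x \<le> C * w (corner l) \<and> w (corner l) \<le> C * w x"
        if "l \<ge> n" "\<forall>x\<in>cube (2 * l). w x \<ge> 0" "\<forall>x\<in>cube (2 * l - 1). massive_harmonic_at k w x" "x \<in> shell l" for l w x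
        by (rule H[OF that])
    qed (use harm rab ab in \<open>simp_all add: m_def\<close>)
    then obtain a' b' where ab': "a \<le> a'" "a' \<le> b'" "b' - a' \<le> \<theta> ^ j * (b - a)" "ratio_within u v n a' b'"
      by blast
    have r: "a' * v x \<le> u x" "u x \<le> b' * v x" "a' * v y \<le> u y" "u y \<le> b' * v y"
      using ab'(4) x y by (auto simp: ratio_within_def)
    have vx: "v x \<ge> 0" using uv sub x by (auto simp: m_def)
    have "\<bar>u x * v y - v x * u y\<bar> \<le> (b' - a') * (v x * v y)"
    proof -
      have "u x * v y \<le> b' * v x * v y" "a' * v x * v y \<le> u x * v y"
        using r y by (auto intro: mult_right_mono)
      moreover have "v x * u y \<le> v x * (b' * v y)" "v x * (a' * v y) \<le> v x * u y"
        using r vx by (auto intro: mult_left_mono)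
      ultimately show ?thesis by (simp add: algebra_simps abs_le_iff)
    qed
    also have "\<dots> \<le> (\<theta> ^ j * (C ^ 4 * a')) * (v x * v y)"
    proof (rule mult_right_mono)
      \<comment> \<open>The initial oscillation is a multiple of its own lower end, and a \<le> a'.
        Together with a' v y \<le> u y this makes the error relative instead of absolute.\<close>
      have "b - a \<le> C ^ 4 * a" using a0 ba by simp
      also have "\<dots> \<le> C ^ 4 * a'" using ab' C by (intro mult_left_mono) auto
      finally show "b' - a' \<le> \<theta> ^ j * (C ^ 4 * a')"
        using \<theta> ab'(3) by (meson mult_left_mono order_trans zero_le_power)
    qed (use vx y in simp)
    also have "\<dots> = \<theta> ^ j * C ^ 4 * v x * (a' * v y)" by simp
    also have "\<dots> \<le> \<theta> ^ j * C ^ 4 * v x * u y"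
      using r vx \<theta> C by (intro mult_left_mono) auto
    finally have main: "\<bar>u x * v y - v x * u y\<bar> \<le> \<theta> ^ j * C ^ 4 * v x * u y" .
    have "u x / u y - v x / v y = (u x * v y - v x * u y) / (u y * v y)"
      using y by (simp add: field_simps)
    then have "\<bar>u x / u y - v x / v y\<bar> = \<bar>u x * v y - v x * u y\<bar> / (u y * v y)"
      using y by (simp add: abs_divide)
    also have "\<dots> \<le> \<theta> ^ j * C ^ 4 * v x * u y / (u y * v y)"
      using y main by (intro divide_right_mono) auto
    also have "\<dots> = C ^ 4 * \<theta> ^ j * (v x / v y)" using y by (simp add: field_simps)
    finally show ?thesis .
  qed
  then show ?thesis using C \<theta> by (intro exI[of _ "C ^ 4"] exI[of _ \<theta>] exI[of _ n0]) auto
qed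

section \<open>The first step of a Markov chain and convergence in distribution\<close>

lemma sets_cylinder:
  "{\<omega> :: nat \<Rightarrow> 's. \<forall>i\<le>n. \<omega> i = p i} \<in> sets (PiM UNIV (\<lambda>_. count_space UNIV))"
proof -
  have "{\<omega> \<in> space (PiM UNIV (\<lambda>_. count_space (UNIV :: 's set))). \<forall>i\<in>{..n}. \<omega> i = p i} \<in> sets (PiM UNIV (\<lambda>_. count_space UNIV))"
  proof (rule sets.sets_Collect_countable_Ball)
    fix i
    have "Measurable.pred (PiM UNIV (\<lambda>_. count_space (UNIV :: 's set))) (\<lambda>\<omega>. \<omega> i = p i)"
      by (rule measurable_compose[OF measurable_component_singleton[of i]]) auto
    then show "{\<omega> \<in> space (PiM UNIV (\<lambda>_. count_space (UNIV :: 's set))). \<omega> i = p i} \<in> sets (PiM UNIV (\<lambda>_. count_space UNIV))"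
      by (simp add: pred_def)
  qed
  then show ?thesis by (simp add: space_PiM Ball_def)
qed

text \<open>On a countable state space an event about coordinate i is a countable union of
  cylinders, one for each finite prefix.\<close>

lemma sets_PiM_cylinders:
  "sets (PiM UNIV (\<lambda>_. count_space (UNIV :: 's :: countable set))) =
    sigma_sets UNIV (insert {} {{\<omega>. \<forall>i\<le>n. \<omega> i = p i} | (n :: nat) p. True})" (is "?S = sigma_sets UNIV ?E")
proof
  show "sigma_sets UNIV ?E \<subseteq> ?S"
  proof -
    have "?E \<subseteq> ?S" using sets_cylinder by auto
    then have "sigma_sets (space (PiM UNIV (\<lambda>_. count_space (UNIV :: 's set)))) ?E \<subseteq> ?S"
      by (rule sets.sigma_sets_subset)
    then show ?thesis by (simp add: space_PiM)
  qed
  show "?S \<subseteq> sigma_sets UNIV ?E"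
  proof -
    have gen: "?S = sigma_sets UNIV {{f. f i \<in> A} | (i :: nat) (A :: 's set). True}"
      unfolding sets_PiM_single by simp
    show ?thesis
      unfolding gen
    proof (rule sigma_sets_mono, safe)
      fix i and A :: "'s set"
      define B where "B = (\<lambda>l. {\<omega> :: nat \<Rightarrow> 's. \<forall>j\<le>i. \<omega> j = l ! j}) ` {l. length l = Suc i \<and> l ! i \<in> A}"
      have "{f. f i \<in> A} = \<Union>B"
      proof safe
        fix f :: "nat \<Rightarrow> 's" assume f: "f i \<in> A"
        have "f \<in> {\<omega>. \<forall>j\<le>i. \<omega> j = map f [0..<Suc i] ! j}" by (auto simp del: upt_Suc)
        moreover have "map f [0..<Suc i] \<in> {l. length l = Suc i \<and> l ! i \<in> A}" using f by (auto simp del: upt_Suc)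
        ultimately show "f \<in> \<Union>B" unfolding B_def by blast
      qed (auto simp: B_def)
      moreover have "\<Union>B \<in> sigma_sets UNIV ?E"
        by (rule sigma_sets_UNION) (auto simp: B_def intro!: sigma_sets.Basic)
      ultimately show "{f. f i \<in> A} \<in> sigma_sets UNIV ?E" by simp
    qed
  qed
qed

text \<open>Two cylinders are nested or disjoint, so together with the empty set they form an
  intersection-stable generator.\<close>

lemma measure_eqI_cylinders:
  fixes M N :: "(nat \<Rightarrow> 's :: countable) measure"
  assumes M: "sets M = sets (PiM UNIV (\<lambda>_. count_space UNIV))" "prob_space M"
    and N: "sets N = sets (PiM UNIV (\<lambda>_. count_space UNIV))"
    and eq: "\<And>n p. emeasure M {\<omega>. \<forall>i\<le>n. \<omega> i = p i} = emeasure N {\<omega>. \<forall>i\<le>n. \<omega> i = p i}"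
  shows "M = N"
proof -
  let ?cyl = "\<lambda>(n :: nat) p. {\<omega> :: nat \<Rightarrow> 's. \<forall>i\<le>n. \<omega> i = p i}"
  let ?E = "insert {} {?cyl n p | n p. True}"
  interpret prob_space M by (rule M(2))
  have cap: "?cyl n p \<inter> ?cyl m q \<in> ?E" if "n \<le> m" for n m p q
  proof (cases "\<forall>i\<le>n. p i = q i")
    case True
    then have "?cyl n p \<inter> ?cyl m q = ?cyl m q" using that by auto
    moreover have "?cyl m q \<in> ?E" by blast
    ultimately show ?thesis by (simp only:)
  next
    case False
    then have "?cyl n p \<inter> ?cyl m q = {}" using that by auto
    then show ?thesis by simp
  qed
  show ?thesis
  proof (rule measure_eqI_generator_eq_countable[where E = ?E and \<Omega> = UNIV and A = "range (\<lambda>s. ?cyl 0 (\<lambda>_. s))"])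
    show "Int_stable ?E"
    proof (rule Int_stableI)
      fix a b assume "a \<in> ?E" "b \<in> ?E"
      then consider "a = {} \<or> b = {}" | n p m q where "a = ?cyl n p" "b = ?cyl m q" by blast
      then show "a \<inter> b \<in> ?E"
      proof cases
        case (2 n p m q)
        then show ?thesis using cap[of n m p q] cap[of m n q p] by (cases "n \<le> m") (simp_all add: Int_commute)
      qed auto
    qed
    show "sets M = sigma_sets UNIV ?E" "sets N = sigma_sets UNIV ?E"
      using M N sets_PiM_cylinders by auto
    show "\<Union> (range (\<lambda>s. ?cyl 0 (\<lambda>_. s))) = UNIV" by auto
    show "emeasure M X = emeasure N X" if "X \<in> ?E" for X using that eq by auto
    show "range (\<lambda>s. ?cyl 0 (\<lambda>_. s)) \<subseteq> ?E" by auto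
    show "countable (range (\<lambda>s. ?cyl 0 (\<lambda>_. s)))" by simp
  qed auto
qed

lemma measurable_case_nat_PiM:
  "case_nat s \<in> PiM UNIV (\<lambda>_. count_space UNIV) \<rightarrow>\<^sub>M PiM UNIV (\<lambda>_. count_space UNIV)"
proof (rule measurable_PiM_single')
  show "(\<lambda>\<omega>. case_nat s \<omega> i) \<in> PiM UNIV (\<lambda>_. count_space UNIV) \<rightarrow>\<^sub>M count_space UNIV" for i
    by (cases i) (simp_all add: measurable_component_singleton)
qed (auto simp: space_PiM)

text \<open>The Markov property at time 1, where \<open>case_nat s\<close> prepends the starting
  state. Drawing y from \<open>K s\<close> and prepending s to the chain from y gives the same
  cylinder probabilities as \<open>emeasure_chain_law_path\<close>.\<close>

lemma chain_law_first_step: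
  fixes K :: "'s :: countable \<Rightarrow> 's pmf"
  assumes A: "A \<in> sets (PiM UNIV (\<lambda>_. count_space UNIV))"
  shows "emeasure (chain_law K s) A = (\<integral>\<^sup>+y. emeasure (chain_law K y) {\<omega>. case_nat s \<omega> \<in> A} \<partial>measure_pmf (K s))"
proof -
  let ?P = "PiM UNIV (\<lambda>_. count_space (UNIV :: 's set))"
  have law: "chain_law K \<in> measure_pmf (K s) \<rightarrow>\<^sub>M subprob_algebra ?P"
    using prob_space_chain_law[of K] by (auto simp: space_subprob_algebra sets_chain_law prob_space_imp_subprob_space)
  define M where "M = measure_pmf (K s) \<bind> chain_law K"
  have ne: "space (measure_pmf (K s)) \<noteq> {}" by simp
  have setsM: "sets M = sets ?P" unfolding M_def by (rule sets_bind) (auto simp: sets_chain_law)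
  have cn: "case_nat s \<in> M \<rightarrow>\<^sub>M ?P"
    using measurable_case_nat_PiM[of s] by (simp add: measurable_cong_sets[OF setsM refl])
  have em: "emeasure (distr M ?P (case_nat s)) A = (\<integral>\<^sup>+y. emeasure (chain_law K y) {\<omega>. case_nat s \<omega> \<in> A} \<partial>measure_pmf (K s))"
    if "A \<in> sets ?P" for A
  proof -
    have sp: "space M = UNIV" using sets_eq_imp_space_eq[OF setsM] by (simp add: space_PiM)
    have "{\<omega>. case_nat s \<omega> \<in> A} = case_nat s -` A \<inter> space ?P" by (auto simp: space_PiM)
    then have B: "{\<omega>. case_nat s \<omega> \<in> A} \<in> sets ?P"
      using measurable_sets[OF measurable_case_nat_PiM that] by simp
    have "emeasure (distr M ?P (case_nat s)) A = emeasure M {\<omega>. case_nat s \<omega> \<in> A}"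
      using emeasure_distr[OF cn that] by (simp add: sp vimage_def)
    also have "\<dots> = (\<integral>\<^sup>+y. emeasure (chain_law K y) {\<omega>. case_nat s \<omega> \<in> A} \<partial>measure_pmf (K s))"
      unfolding M_def by (rule emeasure_bind[OF ne law B])
    finally show ?thesis .
  qed
  have "chain_law K s = distr M ?P (case_nat s)"
  proof (rule measure_eqI_cylinders)
    fix n and p :: "nat \<Rightarrow> 's"
    let ?c = "\<lambda>n p. {\<omega> :: nat \<Rightarrow> 's. \<forall>i\<le>n. \<omega> i = p i}"
    have "emeasure (distr M ?P (case_nat s)) (?c n p) =
        (\<integral>\<^sup>+y. emeasure (chain_law K y) {\<omega>. case_nat s \<omega> \<in> ?c n p} \<partial>measure_pmf (K s))"
      by (rule em[OF sets_cylinder])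
    also have "\<dots> = emeasure (chain_law K s) (?c n p)"
    proof (cases n)
      case 0
      then have "{\<omega>. case_nat s \<omega> \<in> ?c n p} = (if s = p 0 then UNIV else {})" by auto
      moreover have "emeasure (chain_law K y) UNIV = 1" for y
        using prob_space.emeasure_space_1[OF prob_space_chain_law[of K y]] by (simp add: space_chain_law)
      ultimately show ?thesis
        by (simp add: 0 emeasure_chain_law_path[where n = 0, simplified] indicator_def measure_pmf.emeasure_space_1[simplified])
    next
      case (Suc m)
      define q where "q i = p (Suc i)" for i
      have split: "(\<forall>i\<le>Suc m. Q i) \<longleftrightarrow> Q 0 \<and> (\<forall>i\<le>m. Q (Suc i))" for Q
        by (metis Suc_le_mono le0 not0_implies_Suc)
      have e: "{\<omega>. case_nat s \<omega> \<in> ?c n p} = (if s = p 0 then ?c m q else {})"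
        unfolding Suc by (auto simp: split q_def)
      show ?thesis
      proof (cases "s = p 0")
        case True
        define c where "c = (\<Prod>i<m. ennreal (pmf (K (q i)) (q (Suc i))))"
        have "(\<integral>\<^sup>+y. emeasure (chain_law K y) {\<omega>. case_nat s \<omega> \<in> ?c n p} \<partial>measure_pmf (K s)) =
            (\<integral>\<^sup>+y. c * indicator {q 0} y \<partial>measure_pmf (K s))"
          unfolding e using True by (intro nn_integral_cong) (auto simp: emeasure_chain_law_path c_def indicator_def)
        also have "\<dots> = c * ennreal (pmf (K s) (q 0))"
          by (subst nn_integral_cmult_indicator) (auto simp: emeasure_pmf_single)
        also have "\<dots> = emeasure (chain_law K s) (?c n p)"
          unfolding emeasure_chain_law_path using True
          by (simp add: Suc c_def q_def prod.lessThan_Suc_shift mult.commute del: prod.lessThan_Suc)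
        finally show ?thesis .
      next
        case False
        then show ?thesis unfolding e by (simp add: emeasure_chain_law_path)
      qed
    qed
    finally show "emeasure (chain_law K s) (?c n p) = emeasure (distr M ?P (case_nat s)) (?c n p)" by simp
  qed (auto simp: sets_chain_law prob_space_chain_law)
  then show ?thesis using em[OF A] by simp
qed

lemma measure_chain_law_first_step:
  fixes K :: "'s :: countable \<Rightarrow> 's pmf"
  assumes A: "A \<in> sets (PiM UNIV (\<lambda>_. count_space UNIV))"
  shows "measure (chain_law K s) A = (\<integral>y. measure (chain_law K y) {\<omega>. case_nat s \<omega> \<in> A} \<partial>measure_pmf (K s))"
proof -
  have em: "emeasure (chain_law K y) B = ennreal (measure (chain_law K y) B)" for y B
    by (rule finite_measure.emeasure_eq_measure) (rule prob_space.finite_measure[OF prob_space_chain_law])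
  have "ennreal (measure (chain_law K s) A) = (\<integral>\<^sup>+y. ennreal (measure (chain_law K y) {\<omega>. case_nat s \<omega> \<in> A}) \<partial>measure_pmf (K s))"
    unfolding em[symmetric] by (rule chain_law_first_step[OF A])
  also have "\<dots> = ennreal (\<integral>y. measure (chain_law K y) {\<omega>. case_nat s \<omega> \<in> A} \<partial>measure_pmf (K s))"
    by (intro nn_integral_eq_integral measure_pmf.integrable_const_bound[where B = 1])
       (auto intro!: prob_space.prob_le_1 prob_space_chain_law)
  finally show ?thesis by (simp add: integral_nonneg_AE)
qed

lemma measure_chain_law_start:
  fixes K :: "'s :: countable \<Rightarrow> 's pmf"
  assumes "\<And>\<omega>. \<omega> \<in> A \<Longrightarrow> \<omega> 0 \<noteq> s"
  shows "measure (chain_law K s) A = 0"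
proof (cases "A \<in> sets (PiM UNIV (\<lambda>_. count_space UNIV))")
  case True
  have "{\<omega>. case_nat s \<omega> \<in> A} = {}" using assms[of "case_nat s _"] by auto
  then show ?thesis using measure_chain_law_first_step[OF True, of K s] by simp
next
  \<comment> \<open>Off the sigma-algebra \<open>measure\<close> takes its default value 0.\<close>
  case False
  then show ?thesis by (simp add: measure_notin_sets sets_chain_law)
qed

section \<open>Exit probabilities\<close>

lemma exits_alive_iff:
  "\<omega> \<in> exits_alive L \<longleftrightarrow> (\<exists>m y. \<omega> m = Some y \<and> y \<notin> L \<and> (\<forall>j\<le>m. \<omega> j \<noteq> None))"
proof -
  have 1: "enat m < hitting_time B \<omega> \<longleftrightarrow> (\<forall>j\<le>m. \<omega> j \<notin> B)" for m B
  proof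
    assume "enat m < hitting_time B \<omega>"
    then show "\<forall>j\<le>m. \<omega> j \<notin> B"
      unfolding hitting_time_def by (metis (mono_tags, lifting) Inf_lower enat_ord_simps(1) imageI leD mem_Collect_eq order_trans)
  next
    assume *: "\<forall>j\<le>m. \<omega> j \<notin> B"
    have "enat (Suc m) \<le> hitting_time B \<omega>"
      unfolding hitting_time_def using * by (intro Inf_greatest) (auto simp: not_less_eq_eq[symmetric])
    then show "enat m < hitting_time B \<omega>" by (simp add: Suc_ile_eq)
  qed
  have "\<omega> \<in> exits_alive L \<longleftrightarrow> (\<exists>m. \<omega> m \<in> Some ` (- L) \<and> enat m < hitting_time {None} \<omega>)"
    unfolding exits_alive_def hitting_time_def[of "Some ` (- L)"] by (auto simp: Inf_less_iff)
  then show ?thesis unfolding 1 by auto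
qed

lemma exits_alive_case_nat_None: "case_nat None \<omega> \<notin> exits_alive L"
  unfolding exits_alive_iff by (auto split: nat.split intro!: exI[of _ 0])

lemma exits_alive_case_nat_outside: "x \<notin> L \<Longrightarrow> case_nat (Some x) \<omega> \<in> exits_alive L"
  unfolding exits_alive_iff by (intro exI[of _ 0] exI[of _ x]) auto

lemma exits_alive_case_nat_inside:
  assumes "x \<in> L"
  shows "case_nat (Some x) \<omega> \<in> exits_alive L \<longleftrightarrow> \<omega> \<in> exits_alive L"
proof
  assume "case_nat (Some x) \<omega> \<in> exits_alive L"
  then obtain m y where m: "case_nat (Some x) \<omega> m = Some y" "y \<notin> L" "\<forall>j\<le>m. case_nat (Some x) \<omega> j \<noteq> None"
    unfolding exits_alive_iff by blast
  then obtain l where l: "m = Suc l" using assms by (cases m) auto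
  have "\<omega> j \<noteq> None" if "j \<le> l" for j using m(3)[rule_format, of "Suc j"] that l by simp
  then show "\<omega> \<in> exits_alive L" using m l unfolding exits_alive_iff by auto
next
  assume "\<omega> \<in> exits_alive L"
  then obtain m y where "\<omega> m = Some y" "y \<notin> L" "\<forall>j\<le>m. \<omega> j \<noteq> None"
    unfolding exits_alive_iff by blast
  then show "case_nat (Some x) \<omega> \<in> exits_alive L"
    unfolding exits_alive_iff by (intro exI[of _ "Suc m"] exI[of _ y]) (auto split: nat.split)
qed

text \<open>The function h_L of the overview.\<close>

definition exit_prob :: "(int ^ 'd \<Rightarrow> real) \<Rightarrow> (int ^ 'd) set \<Rightarrow> int ^ 'd \<Rightarrow> real"
  where "exit_prob k L x = measure (krw k x) (exits_alive L)"

lemma sets_exits_alive_PiM: "exits_alive L \<in> sets (PiM UNIV (\<lambda>_. count_space UNIV))"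
  using sets_exits_alive[of L] by (simp add: krw_def sets_chain_law)

lemma prob_space_krw: "prob_space (krw k x)"
  by (simp add: krw_def prob_space_chain_law)

lemma exit_prob_nonneg: "exit_prob k L x \<ge> 0"
  by (simp add: exit_prob_def)

lemma exit_prob_outside: "x \<notin> L \<Longrightarrow> exit_prob k L x = 1"
  unfolding exit_prob_def krw_def measure_chain_law_first_step[OF sets_exits_alive_PiM]
  using exits_alive_case_nat_outside[of x L] prob_space.prob_space[OF prob_space_chain_law[of "krw_kernel k"]]
  by (simp add: space_chain_law)

lemma exit_prob_massive_harmonic:
  fixes k :: "int ^ 'd \<Rightarrow> real"
  assumes k: "\<And>x. k x \<in> {0..1}" and x: "x \<in> L"
  shows "massive_harmonic_at k (exit_prob k L) x"
proof -
  let ?K = "krw_kernel k" and ?N = "{y. x \<sim>\<^sub>Z y}"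
  define f where "f s = measure (chain_law ?K s) (exits_alive L)" for s
  have f: "f None = 0" "\<And>y. f (Some y) = exit_prob k L y"
    unfolding f_def measure_chain_law_first_step[OF sets_exits_alive_PiM, of _ None]
    by (simp_all add: exits_alive_case_nat_None exit_prob_def krw_def)
  have "exit_prob k L x = (\<integral>s. f s \<partial>measure_pmf (?K (Some x)))"
    unfolding exit_prob_def krw_def measure_chain_law_first_step[OF sets_exits_alive_PiM, of _ "Some x"] f_def
    using exits_alive_case_nat_inside[OF x] by simp
  also have "\<dots> = (\<Sum>s\<in>Some ` ?N. f s * pmf (?K (Some x)) s)"
  proof (rule integral_measure_pmf_real)
    show "finite (Some ` ?N)" by (simp add: card_neighbours)
    fix s assume "s \<in> set_pmf (?K (Some x))" "f s \<noteq> 0"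
    then show "s \<in> Some ` ?N"
      using f by (cases s) (auto simp: set_pmf_iff pmf_krw_kernel[OF k] split: if_splits)
  qed
  also have "\<dots> = (\<Sum>y\<in>?N. exit_prob k L y * ((1 - k x) / (2 * real CARD('d))))"
    by (simp add: sum.reindex f pmf_krw_kernel[OF k])
  finally show ?thesis
    unfolding massive_harmonic_at_def by (subst mult.commute) (simp only: sum_distrib_right)
qed

text \<open>As long as the path stays in \<open>L\<close>, the exit has not happened yet, so the
  exit event depends only on the walk from time n on. The endpoint \<open>p n\<close> may lie
  outside \<open>L\<close>.\<close>

lemma measure_path_exits_alive:
  fixes k :: "int ^ 'd \<Rightarrow> real"
  assumes k: "\<And>x. k x \<in> {0..1}"
  shows "(\<And>i. i < n \<Longrightarrow> p i \<in> L) \<Longrightarrow> measure (krw k (p 0)) ({\<omega>. \<forall>i\<le>n. \<omega> i = Some (p i)} \<inter> exits_alive L) =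
    (\<Prod>i<n. krw_prob k (Some (p i)) (Some (p (Suc i)))) * exit_prob k L (p n)"
proof (induction n arbitrary: p)
  case 0
  have "{\<omega> :: nat \<Rightarrow> (int ^ 'd) option. \<omega> 0 = Some (p 0)} \<inter> exits_alive L \<in> sets (PiM UNIV (\<lambda>_. count_space UNIV))"
    using sets_cylinder[of 0 "\<lambda>_. Some (p 0)"] sets_exits_alive_PiM by (intro sets.Int) simp_all
  from measure_chain_law_first_step[OF this, of "krw_kernel k" "Some (p 0)"]
    measure_chain_law_first_step[OF sets_exits_alive_PiM[of L], of "krw_kernel k" "Some (p 0)"]
  show ?case by (simp add: exit_prob_def krw_def)
next
  case (Suc n)
  let ?K = "krw_kernel k"
  define q where "q i = p (Suc i)" for i
  let ?A = "\<lambda>n p. {\<omega> :: nat \<Rightarrow> (int ^ 'd) option. \<forall>i\<le>n. \<omega> i = Some (p i)} \<inter> exits_alive L"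
  have split: "(\<forall>i\<le>Suc n. Q i) \<longleftrightarrow> Q 0 \<and> (\<forall>i\<le>n. Q (Suc i))" for Q
    by (metis Suc_le_mono le0 not0_implies_Suc)
  have e: "{\<omega>. case_nat (Some (p 0)) \<omega> \<in> ?A (Suc n) p} = ?A n q"
    using exits_alive_case_nat_inside[of "p 0" L] Suc.prems[of 0] by (auto simp: split q_def)
  have "?A (Suc n) p \<in> sets (PiM UNIV (\<lambda>_. count_space UNIV))"
    using sets_cylinder[of "Suc n" "\<lambda>i. Some (p i)"] sets_exits_alive_PiM by (intro sets.Int)
  then have "measure (krw k (p 0)) (?A (Suc n) p) = (\<integral>s. measure (chain_law ?K s) (?A n q) \<partial>measure_pmf (?K (Some (p 0))))"
    unfolding krw_def by (subst measure_chain_law_first_step) (simp_all only: e)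
  also have "\<dots> = (\<Sum>s\<in>{Some (q 0)}. measure (chain_law ?K s) (?A n q) * pmf (?K (Some (p 0))) s)"
  proof (rule integral_measure_pmf_real)
    fix s assume "measure (chain_law ?K s) (?A n q) \<noteq> 0"
    then show "s \<in> {Some (q 0)}" using measure_chain_law_start[of "?A n q" s ?K] by fastforce
  qed simp
  also have "\<dots> = measure (krw k (q 0)) (?A n q) * krw_prob k (Some (p 0)) (Some (p (Suc 0)))"
    by (simp add: krw_def pmf_krw_kernel[OF k] q_def)
  also have "measure (krw k (q 0)) (?A n q) = (\<Prod>i<n. krw_prob k (Some (q i)) (Some (q (Suc i)))) * exit_prob k L (q n)"
    by (rule Suc.IH) (simp add: q_def Suc.prems)
  finally show ?case by (simp add: q_def prod.lessThan_Suc_shift mult_ac del: prod.lessThan_Suc)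
qed

text \<open>No mass can escape because the limit is a probability measure: a finite set carrying
  almost all of \<nu> eventually carries almost all of \<mu> R as well, and on it only finitely many
  point masses matter.\<close>

lemma conv_in_dist_countable:
  fixes \<mu> :: "nat \<Rightarrow> 'b :: countable measure"
  assumes \<mu>: "\<And>R. prob_space (\<mu> R)" "\<And>R. sets (\<mu> R) = UNIV"
    and \<nu>: "prob_space \<nu>" "sets \<nu> = UNIV"
    and lim: "\<And>l. (\<lambda>R. measure (\<mu> R) {l}) \<longlonglongrightarrow> measure \<nu> {l}"
  shows "conv_in_dist \<mu> \<nu>"
  unfolding conv_in_dist_def
proof (intro allI impI)
  fix f :: "'b \<Rightarrow> real" assume "bounded (range f)"
  then obtain B where B: "\<And>x. \<bar>f x\<bar> \<le> B" by (auto simp: bounded_iff)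
  then have B0: "B \<ge> 0" using abs_ge_zero order_trans by blast
  have approx: "\<bar>(\<integral>x. f x \<partial>M) - (\<Sum>l\<in>F. f l * measure M {l})\<bar> \<le> B * (1 - (\<Sum>l\<in>F. measure M {l}))"
    if "prob_space M" "sets M = UNIV" "finite F" for M :: "'b measure" and F
  proof -
    interpret prob_space M by fact
    have meas: "g \<in> borel_measurable M" for g :: "'b \<Rightarrow> real" using that by (simp add: measurable_def)
    have spaceM: "space M = UNIV" using that(2) sets.sets_into_space[of UNIV M] by auto
    have int: "integrable M g" if "\<And>x. \<bar>g x\<bar> \<le> B" for g :: "'b \<Rightarrow> real"
      using that by (intro integrable_const_bound[where B = B] meas) auto
    have F: "(\<integral>x. f x * indicator F x \<partial>M) = (\<Sum>l\<in>F. f l * measure M {l})"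
    proof -
      have "(\<integral>x. f x * indicator F x \<partial>M) = (\<integral>x. (\<Sum>l\<in>F. f l * indicator {l} x) \<partial>M)"
        using \<open>finite F\<close> by (intro Bochner_Integration.integral_cong) (auto simp: indicator_def if_distrib sum.delta cong: if_cong)
      also have "\<dots> = (\<Sum>l\<in>F. \<integral>x. f l * indicator {l} x \<partial>M)"
        using that by (intro Bochner_Integration.integral_sum integrable_mult_right integrable_real_indicator) (auto simp: emeasure_eq_measure)
      also have "\<dots> = (\<Sum>l\<in>F. f l * measure M {l})" using that spaceM by simp
      finally show ?thesis .
    qed
    have sumF: "measure M F = (\<Sum>l\<in>F. measure M {l})"
      using that by (intro finite_measure_eq_sum_singleton) auto
    have "(\<integral>x. f x \<partial>M) - (\<integral>x. f x * indicator F x \<partial>M) = (\<integral>x. f x - f x * indicator F x \<partial>M)"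
      using B B0 by (intro Bochner_Integration.integral_diff[symmetric] int) (auto simp: indicator_def)
    also have "\<bar>\<dots>\<bar> \<le> (\<integral>x. \<bar>f x - f x * indicator F x\<bar> \<partial>M)" by (rule integral_abs_bound)
    also have "\<dots> \<le> (\<integral>x. B * indicator (UNIV - F) x \<partial>M)"
      using B B0 that by (intro integral_mono int) (auto simp: indicator_def)
    also have "\<dots> = B * (1 - measure M F)"
      using prob_compl[of F] that spaceM by simp
    finally show ?thesis unfolding F sumF by simp
  qed
  show "(\<lambda>R. \<integral>x. f x \<partial>\<mu> R) \<longlonglongrightarrow> (\<integral>x. f x \<partial>\<nu>)"
  proof (rule LIMSEQ_I)
    fix r :: real assume r: "r > 0"
    \<comment> \<open>The two tails cost at most B \<epsilon> \<le> r / 4 each and the finite sum r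
      / 2; the summand 1 covers B = 0.\<close>
    define \<epsilon> where "\<epsilon> = r / (4 * (B + 1))"
    have \<epsilon>: "\<epsilon> > 0" "B * \<epsilon> \<le> r / 4" using r B0 by (auto simp: \<epsilon>_def field_simps)
    interpret \<nu>: prob_space \<nu> by (rule \<nu>)
    have sp\<nu>: "space \<nu> = UNIV" using \<nu>(2) sets.sets_into_space[of UNIV \<nu>] by auto
    define F :: "nat \<Rightarrow> 'b set" where "F n = from_nat ` {..<n}" for n
    have "(\<lambda>n. measure \<nu> (F n)) \<longlonglongrightarrow> measure \<nu> (\<Union>n. F n)"
      using \<nu>(2) by (intro \<nu>.finite_Lim_measure_incseq) (auto simp: F_def incseq_def)
    also have "(\<Union>n. F n) = UNIV"
    proof -
      have "x \<in> F (Suc (to_nat x))" for x :: 'b unfolding F_def by (intro image_eqI[of _ _ "to_nat x"]) auto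
      then show ?thesis by blast
    qed
    finally have "(\<lambda>n. measure \<nu> (F n)) \<longlonglongrightarrow> 1" using \<nu>.prob_space sp\<nu> by simp
    from order_tendstoD(1)[OF this, of "1 - \<epsilon>"] obtain n where n: "measure \<nu> (F n) > 1 - \<epsilon>"
      using \<epsilon> by (auto simp: eventually_sequentially)
    define G where "G = (F n)"
    have G: "finite G" by (simp add: G_def F_def)
    have sG: "measure \<nu> G = (\<Sum>l\<in>G. measure \<nu> {l})"
      using \<nu> G by (intro \<nu>.finite_measure_eq_sum_singleton) auto
    have lim1: "(\<lambda>R. \<Sum>l\<in>G. measure (\<mu> R) {l}) \<longlonglongrightarrow> (\<Sum>l\<in>G. measure \<nu> {l})"
      by (intro tendsto_sum lim)
    have lim2: "(\<lambda>R. \<Sum>l\<in>G. f l * measure (\<mu> R) {l}) \<longlonglongrightarrow> (\<Sum>l\<in>G. f l * measure \<nu> {l})"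
      by (intro tendsto_sum tendsto_mult lim tendsto_const)
    have "eventually (\<lambda>R. (\<Sum>l\<in>G. measure (\<mu> R) {l}) > 1 - \<epsilon>) sequentially"
      using n sG by (intro order_tendstoD(1)[OF lim1]) (simp add: G_def)
    moreover have "eventually (\<lambda>R. dist (\<Sum>l\<in>G. f l * measure (\<mu> R) {l}) (\<Sum>l\<in>G. f l * measure \<nu> {l}) < r / 2) sequentially"
      using r by (intro tendstoD[OF lim2]) simp
    ultimately have "eventually (\<lambda>R. norm ((\<integral>x. f x \<partial>\<mu> R) - (\<integral>x. f x \<partial>\<nu>)) < r) sequentially"
    proof eventually_elim
      case (elim R)
      have "B * (1 - (\<Sum>l\<in>G. measure (\<mu> R) {l})) \<le> B * \<epsilon>" "B * (1 - (\<Sum>l\<in>G. measure \<nu> {l})) \<le> B * \<epsilon>"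
        using elim n sG B0 by (auto intro!: mult_left_mono simp: G_def)
      then show ?case
        using approx[OF \<mu>[of R] G] approx[OF \<nu> G] elim(2) \<epsilon>(2) r unfolding dist_real_def real_norm_def by linarith
    qed
    then show "\<exists>no. \<forall>n\<ge>no. norm ((\<integral>x. f x \<partial>\<mu> n) - (\<integral>x. f x \<partial>\<nu>)) < r"
      by (simp add: eventually_sequentially)
  qed
qed

section \<open>The killed random walk conditioned to survive\<close>

lemma survival_set_less_1: "x \<in> survival_set k \<Longrightarrow> k x < 1"
  unfolding survival_set_def by auto

lemma survival_set_adj:
  fixes k :: "int ^ 'd \<Rightarrow> real"
  assumes y: "y \<in> survival_set k" and xy: "x \<sim>\<^sub>Z y" and kx: "k x < 1"
  shows "x \<in> survival_set k"
proof -
  obtain p where p: "p 0 = y" "\<forall>i. p i \<sim>\<^sub>Z p (Suc i)" "\<forall>i. k (p i) < 1"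
    "filterlim (\<lambda>i. enorm (p i)) at_top sequentially"
    using y unfolding survival_set_def by blast
  define q where "q = case_nat x p"
  have "q i \<sim>\<^sub>Z q (Suc i) \<and> k (q i) < 1" for i
    using p xy kx by (cases i) (auto simp: q_def)
  moreover have "filterlim (\<lambda>i. enorm (q i)) at_top sequentially"
  proof -
    have "filterlim (\<lambda>i. enorm (q (i + 1))) at_top sequentially" using p(4) by (simp add: q_def)
    then show ?thesis using filterlim_sequentially_Suc[of "\<lambda>i. enorm (q i)"] by simp
  qed
  ultimately show ?thesis unfolding survival_set_def by (auto intro!: exI[of _ q] simp: q_def)
qed

lemma abs_component_le_enorm: "\<bar>real_of_int (x $ i)\<bar> \<le> enorm x"
proof (rule power2_le_imp_le)
  show "\<bar>real_of_int (x $ i)\<bar>\<^sup>2 \<le> (enorm x)\<^sup>2"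
    unfolding enorm_squared using component_le_sqn[of x i] by (simp flip: of_int_power)
qed (simp add: enorm_def)

text \<open>The straight ray along axis i away from the origin increases the i-th coordinate in
  modulus, so it never meets a point with k = 1.\<close>

lemma outside_cube_survives:
  fixes k :: "int ^ 'd \<Rightarrow> real"
  assumes far: "\<forall>x i. \<bar>x $ i\<bar> \<ge> int M \<longrightarrow> k x < 1" and x: "\<bar>x $ i\<bar> \<ge> int M"
  shows "x \<in> survival_set k"
proof -
  define \<sigma> :: int where "\<sigma> = (if x $ i \<ge> 0 then 1 else -1)"
  define p where "p j = x + axis i (\<sigma> * int j)" for j
  have pi: "\<bar>p j $ i\<bar> = \<bar>x $ i\<bar> + int j" for j
    by (auto simp: p_def \<sigma>_def axis_def)
  have "p j \<sim>\<^sub>Z p (Suc j)" for j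
  proof -
    have "p (Suc j) = p j + axis i 1 \<or> p (Suc j) = p j - axis i 1"
      by (auto simp: p_def \<sigma>_def vec_eq_iff axis_def)
    then show ?thesis by (auto simp: adj_iff)
  qed
  moreover have "k (p j) < 1" for j
    using far[rule_format, of "p j" i] pi[of j] x by simp
  moreover have "filterlim (\<lambda>j. enorm (p j)) at_top sequentially"
  proof (rule filterlim_at_top_mono[OF filterlim_real_sequentially])
    show "eventually (\<lambda>j. real j \<le> enorm (p j)) sequentially"
    proof (rule always_eventually, rule allI)
      fix j
      have "int j \<le> \<bar>p j $ i\<bar>" using pi[of j] by simp
      then have "real j \<le> \<bar>real_of_int (p j $ i)\<bar>" by linarith
      then show "real j \<le> enorm (p j)" using abs_component_le_enorm[of "p j" i] by linarith
    qed
  qed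
  moreover have "p 0 = x" by (simp add: p_def vec_eq_iff axis_def)
  ultimately show ?thesis unfolding survival_set_def by blast
qed

lemma exit_prob_neighbour:
  fixes k :: "int ^ 'd \<Rightarrow> real"
  assumes k: "\<And>x. k x \<in> {0..1}" and x: "x \<in> L" and xy: "x \<sim>\<^sub>Z y"
  shows "(1 - k x) / (2 * real CARD('d)) * exit_prob k L y \<le> exit_prob k L x"
proof -
  have "exit_prob k L y \<le> (\<Sum>y | x \<sim>\<^sub>Z y. exit_prob k L y)"
    using xy by (intro member_le_sum) (auto simp: exit_prob_nonneg card_neighbours)
  then have "(1 - k x) / (2 * real CARD('d)) * exit_prob k L y \<le> (1 - k x) / (2 * real CARD('d)) * (\<Sum>y | x \<sim>\<^sub>Z y. exit_prob k L y)"
    using k[of x] by (intro mult_left_mono) auto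
  then show ?thesis using exit_prob_massive_harmonic[OF k x] by (simp only: massive_harmonic_at_def)
qed

text \<open>A surviving path leaves the finite set \<open>L\<close> at some time m, where the exit
  probability is 1; positivity is carried back along the path, j counting the steps
  backwards.\<close>

lemma exit_prob_pos:
  fixes k :: "int ^ 'd \<Rightarrow> real"
  assumes k: "\<And>x. k x \<in> {0..1}" and L: "finite L" and x: "x \<in> survival_set k"
  shows "exit_prob k L x > 0"
proof -
  obtain p where p: "p 0 = x" "\<forall>i. p i \<sim>\<^sub>Z p (Suc i)" "\<forall>i. k (p i) < 1"
    "filterlim (\<lambda>i. enorm (p i)) at_top sequentially"
    using x unfolding survival_set_def by blast
  have "eventually (\<lambda>i. enorm (p i) > Max (insert 0 (enorm ` L))) sequentially"
    using p(4) by (simp add: filterlim_at_top_dense)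
  then obtain m where "enorm (p m) > Max (insert 0 (enorm ` L))"
    by (auto simp: eventually_sequentially)
  then have m: "p m \<notin> L" using L by auto
  have "exit_prob k L (p (m - j)) > 0" if "j \<le> m" for j
    using that
  proof (induction j)
    case 0
    then show ?case using m by (simp add: exit_prob_outside)
  next
    case (Suc j)
    define i where "i = m - Suc j"
    have i: "Suc i = m - j" using Suc.prems by (simp add: i_def)
    have pos: "exit_prob k L (p (Suc i)) > 0" using Suc i by simp
    show ?case unfolding i_def[symmetric]
    proof (cases "p i \<in> L")
      case True
      have "0 < (1 - k (p i)) / (2 * real CARD('d)) * exit_prob k L (p (Suc i))"
        using p(3) pos by simp
      also have "\<dots> \<le> exit_prob k L (p i)" by (rule exit_prob_neighbour[OF k True]) (use p in blast)
      finally show "exit_prob k L (p i) > 0" .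
    qed (simp add: exit_prob_outside)
  qed
  from this[of m] show ?thesis using p(1) by simp
qed

text \<open>The constant comes from a path from x to y and is the same for all \<open>L\<close>
  containing \<open>F\<close>, the points of the path at which a step is taken. This uniformity
  bounds the ratios from above and makes their limit positive.\<close>

lemma exit_prob_comparison:
  fixes k :: "int ^ 'd \<Rightarrow> real"
  assumes k: "\<And>x. k x \<in> {0..1}"
    and xy: "(x, y) \<in> {(u, v). u \<in> survival_set k \<and> v \<in> survival_set k \<and> u \<sim>\<^sub>Z v}\<^sup>*"
  shows "\<exists>c>0. \<exists>F. finite F \<and> (\<forall>L. F \<subseteq> L \<longrightarrow> c * exit_prob k L y \<le> exit_prob k L x)"
  using xy
proof (induction rule: converse_rtrancl_induct)
  case base
  then show ?case by (intro exI[of _ 1] conjI exI[of _ "{}"]) auto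
next
  case (step x z)
  obtain c F where c: "c > 0" "finite F" "\<And>L. F \<subseteq> L \<Longrightarrow> c * exit_prob k L y \<le> exit_prob k L z"
    using step.IH by blast
  define b where "b = (1 - k x) / (2 * real CARD('d))"
  have b: "b > 0" using step survival_set_less_1[of x k] by (auto simp: b_def)
  have "b * c * exit_prob k L y \<le> exit_prob k L x" if "insert x F \<subseteq> L" for L
  proof -
    have "b * (c * exit_prob k L y) \<le> b * exit_prob k L z"
      using b c(3)[of L] that by (intro mult_left_mono) auto
    also have "\<dots> \<le> exit_prob k L x"
      unfolding b_def using step that by (intro exit_prob_neighbour[OF k]) auto
    finally show ?thesis by (simp add: mult.assoc)
  qed
  then show ?case using b c by (intro exI[of _ "b * c"] conjI exI[of _ "insert x F"]) auto
qed

text \<open>The cluster of points with k < 1 reachable from x contains no surviving point, so it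
  lies in a cube and is finite. It is surrounded by points with k = 1, at which the exit probability
  is 0 as soon as they belong to \<open>L\<close>; by the minimum principle it is 0 on the whole
  cluster.\<close>

lemma exit_prob_vanishes:
  fixes k :: "int ^ 'd \<Rightarrow> real"
  assumes k: "\<And>x. k x \<in> {0..1}" and far: "\<forall>x i. \<bar>x $ i\<bar> \<ge> int M \<longrightarrow> k x < 1"
    and x: "x \<notin> survival_set k"
  shows "\<exists>F. finite F \<and> (\<forall>L. F \<subseteq> L \<longrightarrow> exit_prob k L x = 0)"
proof -
  have killed: "exit_prob k L y = 0" if "k y = 1" "y \<in> L" for y L
    using exit_prob_massive_harmonic[OF k that(2)] that(1) by (simp add: massive_harmonic_at_def)
  show ?thesis
  proof (cases "k x < 1")
    case False
    then have "k x = 1" using k[of x] by simp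
    then show ?thesis using killed by (intro exI[of _ "{x}"]) auto
  next
    case True
    define A where "A = {y. (x, y) \<in> {(u, v). k u < 1 \<and> k v < 1 \<and> u \<sim>\<^sub>Z v}\<^sup>*}"
    have survives: "x \<in> survival_set k" if "(x, y) \<in> {(u, v). k u < 1 \<and> k v < 1 \<and> u \<sim>\<^sub>Z v}\<^sup>*" "y \<in> survival_set k" for x y
      using that by (induction rule: converse_rtrancl_induct) (auto intro: survival_set_adj)
    have "A \<subseteq> cube M"
    proof
      fix y assume "y \<in> A"
      then have "y \<notin> survival_set k" using survives[of x y] x by (auto simp: A_def)
      then have "\<not> int M \<le> \<bar>y $ i\<bar>" for i using outside_cube_survives[OF far, of y i] by blast
      then show "y \<in> cube M" by (auto simp: cube_def not_le intro: less_imp_le)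
    qed
    then have A: "finite A" by (rule finite_subset[OF _ finite_cube])
    have kA: "k y < 1" if "y \<in> A" for y
      using that True unfolding A_def by (auto elim: rtranclE)
    have boundary: "k y = 1" if "z \<in> A" "z \<sim>\<^sub>Z y" "y \<notin> A" for y z
    proof (rule ccontr)
      assume "k y \<noteq> 1"
      then have "k y < 1" using k[of y] by simp
      then have "y \<in> A" using that kA[OF that(1)] unfolding A_def by (auto intro: rtrancl_into_rtrancl)
      then show False using that by simp
    qed
    define F where "F = A \<union> (\<Union>z\<in>A. {y. z \<sim>\<^sub>Z y})"
    have "exit_prob k L x = 0" if L: "F \<subseteq> L" for L
    proof -
      \<comment> \<open>The principle is applied to the negative of the exit probability, written as
        a linear combination to match \<open>massive_harmonic_linear\<close>.\<close>
      have "0 \<le> (-1) * exit_prob k L x + 0 * exit_prob k L x"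
      proof (rule minimum_principle[OF A k, where w = "\<lambda>y. (-1) * exit_prob k L y + 0 * exit_prob k L y"])
        fix y assume "y \<in> A"
        then have "massive_harmonic_at k (exit_prob k L) y"
          using L by (intro exit_prob_massive_harmonic[OF k]) (auto simp: F_def)
        then show "massive_harmonic_at k (\<lambda>y. (-1) * exit_prob k L y + 0 * exit_prob k L y) y"
          by (rule massive_harmonic_linear) fact
      next
        fix y z assume yz: "y \<in> A" "y \<sim>\<^sub>Z z" "z \<notin> A"
        then have "z \<in> L" using L by (auto simp: F_def)
        then show "0 \<le> (-1) * exit_prob k L z + 0 * exit_prob k L z"
          using killed[OF boundary[OF yz]] by simp
      next
        show "x \<in> A" by (simp add: A_def)
      qed
      then show ?thesis using exit_prob_nonneg[of k L x] by simp
    qed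
    then show ?thesis using A by (intro exI[of _ F]) (auto simp: F_def card_neighbours)
  qed
qed

section \<open>Limits along exhaustions\<close>

lemma eventually_exhaustion_superset:
  assumes "exhaustion \<Lambda>" "finite F"
  shows "eventually (\<lambda>R. F \<subseteq> \<Lambda> R) sequentially"
proof -
  have "eventually (\<lambda>R. x \<in> \<Lambda> R) sequentially" for x
  proof -
    obtain R where "x \<in> \<Lambda> R" using assms(1) by (auto simp: exhaustion_def)
    moreover have "incseq \<Lambda>" using assms(1) by (simp add: exhaustion_def)
    ultimately show ?thesis unfolding eventually_sequentially incseq_def by blast
  qed
  then have "\<forall>x\<in>F. eventually (\<lambda>R. x \<in> \<Lambda> R) sequentially" by blast
  then have "eventually (\<lambda>R. \<forall>x\<in>F. x \<in> \<Lambda> R) sequentially"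
    using assms(2) by (simp add: eventually_ball_finite)
  then show ?thesis by (simp add: subset_eq)
qed

lemma exhaustion_cube: "exhaustion (cube :: nat \<Rightarrow> (int ^ 'd) set)"
  unfolding exhaustion_def
proof (intro conjI allI)
  show "incseq (cube :: nat \<Rightarrow> (int ^ 'd) set)" using cube_mono by (auto simp: incseq_def)
  show "\<exists>R. x \<in> cube R" for x :: "int ^ 'd"
  proof -
    have "\<bar>x $ i\<bar> \<le> int (nat (\<Sum>i\<in>UNIV. \<bar>x $ i\<bar>))" for i
    proof -
      have "\<bar>x $ i\<bar> \<le> (\<Sum>i\<in>UNIV. \<bar>x $ i\<bar>)" by (rule member_le_sum) auto
      then show ?thesis by simp
    qed
    then show ?thesis unfolding cube_def by blast
  qed
qed (rule finite_cube)

text \<open>A Cauchy property along all finite sets ordered by inclusion. Comparing two arbitrary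
  sets \<open>L\<close> and \<open>L'\<close>, and not two members of one exhaustion, is what makes
  the limit independent of the exhaustion.\<close>

lemma exit_prob_ratio_close:
  fixes k :: "int ^ 'd \<Rightarrow> real"
  assumes d: "CARD('d) \<ge> 2" and k: "\<And>x. k x \<in> {0..1}"
    and decay: "\<forall>x. sqn x \<ge> int N \<longrightarrow> k x * of_int (sqn x) \<le> 1"
    and far: "\<forall>x i. \<bar>x $ i\<bar> \<ge> int M \<longrightarrow> k x < 1"
    and conn: "lattice_connected (survival_set k)"
    and x: "x \<in> survival_set k" and x0: "x0 \<in> survival_set k" and e: "e > 0"
  shows "\<exists>F. finite F \<and> (\<forall>L L'. finite L \<longrightarrow> finite L' \<longrightarrow> F \<subseteq> L \<longrightarrow> F \<subseteq> L' \<longrightarrow>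
    \<bar>exit_prob k L x / exit_prob k L x0 - exit_prob k L' x / exit_prob k L' x0\<bar> \<le> e)"
proof -
  obtain B \<theta> n0 where B: "B \<ge> 0" "0 \<le> \<theta>" "\<theta> < 1" and conv: "\<forall>n\<ge>n0. \<forall>j. \<forall>u v.
    (\<forall>x\<in>cube (2 * (2 ^ j * n)). massive_harmonic_at k u x \<and> massive_harmonic_at k v x \<and> u x \<ge> 0 \<and> v x \<ge> 0) \<longrightarrow>
    (\<forall>x\<in>shell (2 ^ j * n). u x > 0 \<and> v x > 0) \<longrightarrow>
    (\<forall>x\<in>cube n. \<forall>y\<in>cube n. u y > 0 \<longrightarrow> v y > 0 \<longrightarrow>
      \<bar>u x / u y - v x / v y\<bar> \<le> B * \<theta> ^ j * (v x / v y))"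
    using ratio_convergence[OF d k decay] by (elim exE conjE) (rule that)
  have "(x0, x) \<in> {(u, v). u \<in> survival_set k \<and> v \<in> survival_set k \<and> u \<sim>\<^sub>Z v}\<^sup>*"
    using conn x x0 by (simp add: lattice_connected_def)
  from exit_prob_comparison[OF k this]
  obtain c F where c: "c > 0" "finite F" "\<And>L. F \<subseteq> L \<Longrightarrow> c * exit_prob k L x \<le> exit_prob k L x0"
    by blast
  obtain R1 where R1: "x \<in> cube R1" using exhaustion_cube by (auto simp: exhaustion_def)
  obtain R2 where R2: "x0 \<in> cube R2" using exhaustion_cube by (auto simp: exhaustion_def)
  \<comment> \<open>Large enough for \<open>ratio_convergence\<close>, for the shells from size n on
    to consist of surviving points, and for the cube to contain x and x0.\<close>
  define n where "n = n0 + M + R1 + R2"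
  have n: "n \<ge> n0" "n \<ge> M" "x \<in> cube n" "x0 \<in> cube n"
    using R1 R2 cube_mono[of R1 n] cube_mono[of R2 n] by (auto simp: n_def)
  have "(\<lambda>j. B * \<theta> ^ j * (1 / c)) \<longlonglongrightarrow> B * 0 * (1 / c)"
    using B by (intro tendsto_mult tendsto_const LIMSEQ_realpow_zero)
  then have "eventually (\<lambda>j. B * \<theta> ^ j * (1 / c) < e) sequentially"
    using e by (intro order_tendstoD(2)[where a = e]) auto
  then obtain j where j: "B * \<theta> ^ j * (1 / c) < e" by (auto simp: eventually_sequentially)
  \<comment> \<open>\<open>F\<close> makes 1 / c a bound on the ratio for \<open>L'\<close>; the
    cube makes both exit probabilities massive harmonic up to the scale needed for j
    contractions.\<close>
  define G where "G = F \<union> cube (2 * (2 ^ j * n))"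
  have "\<bar>exit_prob k L x / exit_prob k L x0 - exit_prob k L' x / exit_prob k L' x0\<bar> \<le> e"
    if L: "finite L" "finite L'" "G \<subseteq> L" "G \<subseteq> L'" for L L'
  proof -
    have pos: "exit_prob k L y > 0" "exit_prob k L' y > 0" if "y \<in> survival_set k" for y
      using exit_prob_pos[OF k _ that] L by blast+
    have shell: "y \<in> survival_set k" if y: "y \<in> shell (2 ^ j * n)" for y
    proof -
      obtain i where "\<bar>y $ i\<bar> = int (2 ^ j * n)" using y by (auto simp: shell_def)
      moreover have "M \<le> 2 ^ j * n" using n(2) by (rule order_trans) simp
      ultimately have "int M \<le> \<bar>y $ i\<bar>" by (simp only: of_nat_le_iff)
      then show ?thesis by (rule outside_cube_survives[OF far])
    qed
    have "\<bar>exit_prob k L x / exit_prob k L x0 - exit_prob k L' x / exit_prob k L' x0\<bar>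
        \<le> B * \<theta> ^ j * (exit_prob k L' x / exit_prob k L' x0)"
    proof (rule conv[THEN spec, THEN mp, OF n(1), THEN spec, THEN spec, THEN spec, THEN mp, THEN mp,
          THEN bspec, OF _ _ n(3), THEN bspec, OF _ _ n(4), THEN mp, THEN mp])
      show "\<forall>y\<in>cube (2 * (2 ^ j * n)). massive_harmonic_at k (exit_prob k L) y \<and>
          massive_harmonic_at k (exit_prob k L') y \<and> exit_prob k L y \<ge> 0 \<and> exit_prob k L' y \<ge> 0"
        using L by (auto simp: G_def exit_prob_nonneg intro: exit_prob_massive_harmonic[where k = k, OF k])
    qed (use pos shell x0 in auto)
    also have "\<dots> \<le> B * \<theta> ^ j * (1 / c)"
    proof (rule mult_left_mono)
      have "c * exit_prob k L' x \<le> exit_prob k L' x0" using c(3) L by (auto simp: G_def)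
      then show "exit_prob k L' x / exit_prob k L' x0 \<le> 1 / c"
        using c(1) pos(2)[OF x0] by (simp add: field_simps)
    qed (use B in simp)
    finally show ?thesis using j by linarith
  qed
  then show ?thesis using c(2) finite_cube by (intro exI[of _ G]) (auto simp: G_def)
qed

text \<open>The cubes determine the limit; closeness for all large finite sets transfers it to every
  other exhaustion.\<close>

lemma exit_prob_ratio_limit:
  fixes k :: "int ^ 'd \<Rightarrow> real"
  assumes d: "CARD('d) \<ge> 2" and k: "\<And>x. k x \<in> {0..1}"
    and decay: "\<forall>x. sqn x \<ge> int N \<longrightarrow> k x * of_int (sqn x) \<le> 1"
    and far: "\<forall>x i. \<bar>x $ i\<bar> \<ge> int M \<longrightarrow> k x < 1"
    and conn: "lattice_connected (survival_set k)" and x0: "x0 \<in> survival_set k"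
  shows "\<exists>l. \<forall>\<Lambda>. exhaustion \<Lambda> \<longrightarrow> (\<lambda>R. exit_prob k (\<Lambda> R) x / exit_prob k (\<Lambda> R) x0) \<longlonglongrightarrow> l"
proof (cases "x \<in> survival_set k")
  case False
  obtain F where F: "finite F" "\<And>L. F \<subseteq> L \<Longrightarrow> exit_prob k L x = 0"
    using exit_prob_vanishes[OF k far False] by blast
  have "(\<lambda>R. exit_prob k (\<Lambda> R) x / exit_prob k (\<Lambda> R) x0) \<longlonglongrightarrow> 0" if "exhaustion \<Lambda>" for \<Lambda>
    by (rule tendsto_eventually)
       (use eventually_exhaustion_superset[OF that F(1)] F(2) in \<open>auto elim: eventually_mono\<close>)
  then show ?thesis by blast
next
  case True
  define r where "r L = exit_prob k L x / exit_prob k L x0" for L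
  have close: "\<exists>F. finite F \<and> (\<forall>L L'. finite L \<longrightarrow> finite L' \<longrightarrow> F \<subseteq> L \<longrightarrow> F \<subseteq> L' \<longrightarrow> \<bar>r L - r L'\<bar> \<le> e)" if "e > 0" for e
    unfolding r_def by (rule exit_prob_ratio_close[OF d k decay far conn True x0 that])
  have "Cauchy (\<lambda>R. r (cube R))"
  proof (rule metric_CauchyI)
    fix e :: real assume e: "e > 0"
    obtain F where F: "finite F" "\<And>L L'. finite L \<Longrightarrow> finite L' \<Longrightarrow> F \<subseteq> L \<Longrightarrow> F \<subseteq> L' \<Longrightarrow> \<bar>r L - r L'\<bar> \<le> e / 2"
      using close[of "e / 2"] e by auto
    obtain R0 where R0: "\<And>R. R \<ge> R0 \<Longrightarrow> F \<subseteq> cube R"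
      using eventually_exhaustion_superset[OF exhaustion_cube F(1)] by (auto simp: eventually_sequentially)
    show "\<exists>R0. \<forall>m\<ge>R0. \<forall>n\<ge>R0. dist (r (cube m)) (r (cube n)) < e"
    proof (intro exI[of _ R0] allI impI)
      fix m n assume "m \<ge> R0" "n \<ge> R0"
      then have "\<bar>r (cube m) - r (cube n)\<bar> \<le> e / 2" by (intro F(2) R0 finite_cube)
      then show "dist (r (cube m)) (r (cube n)) < e" using e by (simp add: dist_real_def)
    qed
  qed
  then obtain l where l: "(\<lambda>R. r (cube R)) \<longlonglongrightarrow> l"
    using real_Cauchy_convergent convergent_def by blast
  have "(\<lambda>R. r (\<Lambda> R)) \<longlonglongrightarrow> l" if \<Lambda>: "exhaustion \<Lambda>" for \<Lambda>
  proof (rule Lim_transform[OF l], rule LIMSEQ_I)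
    fix e :: real assume e: "e > 0"
    obtain F where F: "finite F" "\<And>L L'. finite L \<Longrightarrow> finite L' \<Longrightarrow> F \<subseteq> L \<Longrightarrow> F \<subseteq> L' \<Longrightarrow> \<bar>r L - r L'\<bar> \<le> e / 2"
      using close[of "e / 2"] e by auto
    have "eventually (\<lambda>R. F \<subseteq> cube R \<and> F \<subseteq> \<Lambda> R) sequentially"
      using eventually_exhaustion_superset[OF exhaustion_cube F(1)] eventually_exhaustion_superset[OF \<Lambda> F(1)]
      by (rule eventually_conj)
    then obtain R0 where R0: "\<And>R. R \<ge> R0 \<Longrightarrow> F \<subseteq> cube R \<and> F \<subseteq> \<Lambda> R"
      by (auto simp: eventually_sequentially)
    have fin: "finite (\<Lambda> R)" for R using \<Lambda> by (simp add: exhaustion_def)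
    show "\<exists>R0. \<forall>R\<ge>R0. norm (r (\<Lambda> R) - r (cube R) - 0) < e"
    proof (intro exI[of _ R0] allI impI)
      fix R assume "R \<ge> R0"
      then have "\<bar>r (\<Lambda> R) - r (cube R)\<bar> \<le> e / 2" using R0 by (intro F(2) fin finite_cube) auto
      then show "norm (r (\<Lambda> R) - r (cube R) - 0) < e" using e by simp
    qed
  qed
  then show ?thesis unfolding r_def by blast
qed

text \<open>The equation is a finite sum and so passes to the limit. It is proved at every point, on
  and off the survival set, which is the form \<open>h_transform_path\<close> asks for.\<close>

lemma limit_massive_harmonic:
  fixes k :: "int ^ 'd \<Rightarrow> real"
  assumes k: "\<And>x. k x \<in> {0..1}"
    and lim: "\<And>x. (\<lambda>R. exit_prob k (cube R) x / exit_prob k (cube R) x0) \<longlonglongrightarrow> a x"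
  shows "massive_harmonic_at k a x"
proof -
  let ?c = "(1 - k x) / (2 * real CARD('d))"
  have "(\<lambda>R. ?c * (\<Sum>y | x \<sim>\<^sub>Z y. exit_prob k (cube R) y / exit_prob k (cube R) x0)) \<longlonglongrightarrow> ?c * (\<Sum>y | x \<sim>\<^sub>Z y. a y)"
    by (intro tendsto_mult tendsto_const tendsto_sum lim)
  moreover have "eventually (\<lambda>R. ?c * (\<Sum>y | x \<sim>\<^sub>Z y. exit_prob k (cube R) y / exit_prob k (cube R) x0) =
      exit_prob k (cube R) x / exit_prob k (cube R) x0) sequentially"
    using eventually_exhaustion_superset[OF exhaustion_cube finite.insertI[OF finite.emptyI, of x]]
  proof (rule eventually_mono)
    fix R assume "{x} \<subseteq> cube R"
    then have "exit_prob k (cube R) x = ?c * (\<Sum>y | x \<sim>\<^sub>Z y. exit_prob k (cube R) y)"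
      using exit_prob_massive_harmonic[OF k, of x "cube R"] by (simp only: massive_harmonic_at_def) simp
    then show "?c * (\<Sum>y | x \<sim>\<^sub>Z y. exit_prob k (cube R) y / exit_prob k (cube R) x0) =
      exit_prob k (cube R) x / exit_prob k (cube R) x0"
      by (simp flip: sum_divide_distrib)
  qed
  ultimately have "(\<lambda>R. exit_prob k (cube R) x / exit_prob k (cube R) x0) \<longlonglongrightarrow> ?c * (\<Sum>y | x \<sim>\<^sub>Z y. a y)"
    by (rule Lim_transform_eventually)
  then show ?thesis unfolding massive_harmonic_at_def using LIMSEQ_unique[OF lim] by blast
qed

text \<open>The Doob transform of the walk by \<open>a\<close>, with \<open>a\<close> read as 0 at
  the cemetery, so that the new chain is never killed. Where \<open>a\<close> vanishes, a point mass
  serves as placeholder.\<close>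

definition h_transform :: "(int ^ 'd \<Rightarrow> real) \<Rightarrow> (int ^ 'd \<Rightarrow> real) \<Rightarrow> int ^ 'd \<Rightarrow> (int ^ 'd) pmf"
  where "h_transform k a x = (if a x > 0
    then embed_pmf (\<lambda>y. krw_prob k (Some x) (Some y) * a y / a x) else return_pmf x)"

text \<open>Massive harmonicity of \<open>a\<close> at x says exactly that the weights sum to
  1.\<close>

lemma pmf_h_transform:
  fixes k :: "int ^ 'd \<Rightarrow> real"
  assumes k: "\<And>x. k x \<in> {0..1}" and a: "\<And>y. a y \<ge> 0" and harm: "massive_harmonic_at k a x" and x: "a x > 0"
  shows "pmf (h_transform k a x) y = krw_prob k (Some x) (Some y) * a y / a x"
proof -
  let ?f = "\<lambda>y. krw_prob k (Some x) (Some y) * a y / a x" and ?N = "{y. x \<sim>\<^sub>Z y}"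
  have nonneg: "?f y \<ge> 0" for y using k[of x] a[of y] x by simp
  have "(\<integral>\<^sup>+y. ennreal (?f y) \<partial>count_space UNIV) = (\<Sum>y\<in>?N. ennreal (?f y))"
    by (rule nn_integral_count_space') (auto simp: card_neighbours)
  also have "\<dots> = ennreal (\<Sum>y\<in>?N. ?f y)" by (rule sum_ennreal) (rule nonneg)
  also have "(\<Sum>y\<in>?N. ?f y) = (1 - k x) / (2 * real CARD('d)) * (\<Sum>y\<in>?N. a y) / a x"
    by (simp add: sum_distrib_left sum_divide_distrib)
  also have "\<dots> = a x / a x" using harm by (simp only: massive_harmonic_at_def)
  finally have "(\<integral>\<^sup>+y. ennreal (?f y) \<partial>count_space UNIV) = 1" using x by simp
  then have "pmf (embed_pmf ?f) y = ?f y" by (rule pmf_embed_pmf[OF nonneg])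
  then show ?thesis unfolding h_transform_def using x by (simp only: if_True)
qed

text \<open>The factors a (p (i + 1)) / a (p i) telescope.\<close>

lemma h_transform_path:
  fixes k :: "int ^ 'd \<Rightarrow> real"
  assumes k: "\<And>x. k x \<in> {0..1}" and a: "\<And>y. a y \<ge> 0" and harm: "\<And>x. massive_harmonic_at k a x"
    and x: "a (p 0) > 0"
  shows "(\<Prod>i<n. pmf (h_transform k a (p i)) (p (Suc i))) =
    (\<Prod>i<n. krw_prob k (Some (p i)) (Some (p (Suc i)))) * a (p n) / a (p 0)"
proof (induction n)
  case 0
  then show ?case using x by simp
next
  case (Suc n)
  show ?case
  proof (cases "a (p n) > 0")
    case True
    then show ?thesis
      by (simp add: Suc pmf_h_transform[OF k a harm True] del: krw_prob.simps)
  next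
    \<comment> \<open>At a zero of \<open>a\<close> massive harmonicity makes each term of the
      neighbour sum vanish, so the right side is 0; the left side is 0 because the induction
      hypothesis already contains the factor a (p n) = 0.\<close>
    case False
    then have z: "a (p n) = 0" using a[of "p n"] by simp
    have "krw_prob k (Some (p n)) (Some (p (Suc n))) * a (p (Suc n)) = 0"
    proof (cases "p n \<sim>\<^sub>Z p (Suc n)")
      case True
      have "a (p (Suc n)) \<le> (\<Sum>y | p n \<sim>\<^sub>Z y. a y)"
        using True a by (intro member_le_sum) (auto simp: card_neighbours)
      then have "(1 - k (p n)) / (2 * real CARD('d)) * a (p (Suc n)) \<le> (1 - k (p n)) / (2 * real CARD('d)) * (\<Sum>y | p n \<sim>\<^sub>Z y. a y)"
        using k[of "p n"] by (intro mult_left_mono) auto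
      also have "\<dots> = a (p n)" using harm[of "p n"] by (simp only: massive_harmonic_at_def)
      finally have "(1 - k (p n)) / (2 * real CARD('d)) * a (p (Suc n)) \<le> 0" using z by simp
      moreover have "(1 - k (p n)) / (2 * real CARD('d)) * a (p (Suc n)) \<ge> 0"
        using k[of "p n"] a by simp
      ultimately show ?thesis using True by simp
    qed simp
    moreover have "(\<Prod>i<n. pmf (h_transform k a (p i)) (p (Suc i))) = 0" using Suc z by simp
    ultimately show ?thesis
      by (simp only: prod.lessThan_Suc mult.assoc mult_zero_left mult_zero_right div_0)
  qed
qed

lemma first_steps_eq_iff:
  "first_steps n \<omega> = l \<longleftrightarrow> length l = Suc n \<and> (\<forall>i\<le>n. \<omega> i = l ! i)"
  unfolding first_steps_def by (auto simp: list_eq_iff_nth_eq less_Suc_eq_le simp del: upt_Suc)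

text \<open>Only the mass of each list of states has to converge. For a path of living states it is
  the path weight times h (p n) / h x, with h the exit probability, once the path lies in the
  exhausting set, and the limit is the path probability of the Doob transform.\<close>

lemma exhaustion_conditioned_converges:
  fixes k :: "int ^ 'd \<Rightarrow> real"
  assumes k: "\<And>x. k x \<in> {0..1}" and a: "\<And>y. a y \<ge> 0" and harm: "\<And>x. massive_harmonic_at k a x"
    and x: "a x > 0" "x \<in> survival_set k" and \<Lambda>: "exhaustion \<Lambda>"
    and lim: "\<And>y. (\<lambda>R. exit_prob k (\<Lambda> R) y / exit_prob k (\<Lambda> R) x) \<longlonglongrightarrow> a y / a x"
  shows "conv_in_dist
      (\<lambda>R. distr (uniform_measure (krw k x) (exits_alive (\<Lambda> R))) (count_space UNIV) (first_steps n))
      (distr (chain_law (h_transform k a) x) (count_space UNIV) (\<lambda>\<omega>. first_steps n (Some \<circ> \<omega>)))"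
proof -
  let ?P = "PiM UNIV (\<lambda>_. count_space (UNIV :: (int ^ 'd) option set))"
  let ?Q = "PiM UNIV (\<lambda>_. count_space (UNIV :: (int ^ 'd) set))"
  let ?U = "\<lambda>R. uniform_measure (krw k x) (exits_alive (\<Lambda> R))"
  let ?C = "chain_law (h_transform k a) x"
  have fin: "finite (\<Lambda> R)" for R using \<Lambda> by (simp add: exhaustion_def)
  interpret krw: prob_space "krw k x" by (rule prob_space_krw)
  have pos: "exit_prob k (\<Lambda> R) x > 0" for R by (rule exit_prob_pos[OF k fin x(2)])
  then have em: "emeasure (krw k x) (exits_alive (\<Lambda> R)) \<noteq> 0" "emeasure (krw k x) (exits_alive (\<Lambda> R)) \<noteq> \<infinity>" for R
    by (auto simp: krw.emeasure_eq_measure exit_prob_def less_le)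
  have setsU: "sets (?U R) = sets ?P" for R by (simp add: krw_def sets_chain_law)
  have spaceK: "space (krw k x) = UNIV" by (simp add: krw_def space_chain_law)
  then have spaceU: "space (?U R) = UNIV" for R by simp
  have fsU: "first_steps n \<in> ?U R \<rightarrow>\<^sub>M count_space UNIV" for R
    using measurable_first_steps[of n] by (simp add: measurable_cong_sets[OF setsU refl])
  have map_Some: "first_steps n (Some \<circ> \<omega>) = map Some (first_steps n \<omega>)" for \<omega> :: "nat \<Rightarrow> int ^ 'd"
    by (simp add: first_steps_def)
  have fsC: "(\<lambda>\<omega>. first_steps n (Some \<circ> \<omega>)) \<in> ?C \<rightarrow>\<^sub>M count_space UNIV"
  proof -
    have "(\<lambda>\<omega>. map Some (first_steps n \<omega>)) \<in> ?Q \<rightarrow>\<^sub>M count_space UNIV"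
      by (rule measurable_compose[OF measurable_first_steps]) simp
    then show ?thesis by (simp add: map_Some measurable_cong_sets[OF sets_chain_law refl])
  qed
  have mU: "measure (distr (?U R) (count_space UNIV) (first_steps n)) {l} =
      measure (krw k x) ({\<omega>. first_steps n \<omega> = l} \<inter> exits_alive (\<Lambda> R)) / exit_prob k (\<Lambda> R) x" for R l
  proof -
    have S: "{\<omega>. first_steps n \<omega> = l} \<in> sets (krw k x)"
      using measurable_sets[OF fsU[of R], of "{l}"] by (simp add: krw_def space_chain_law vimage_def)
    have "measure (distr (?U R) (count_space UNIV) (first_steps n)) {l} = measure (?U R) {\<omega>. first_steps n \<omega> = l}"
      by (subst measure_distr[OF fsU]) (simp_all add: spaceK vimage_def)
    also have "\<dots> = measure (krw k x) (exits_alive (\<Lambda> R) \<inter> {\<omega>. first_steps n \<omega> = l}) / measure (krw k x) (exits_alive (\<Lambda> R))"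
      by (rule measure_uniform_measure[OF em S])
    finally show ?thesis by (simp add: exit_prob_def Int_commute)
  qed
  have mC: "measure (distr ?C (count_space UNIV) (\<lambda>\<omega>. first_steps n (Some \<circ> \<omega>))) {l} =
      measure ?C {\<omega>. map Some (first_steps n \<omega>) = l}" for l
    by (subst measure_distr[OF fsC]) (simp_all add: space_chain_law vimage_def map_Some)
  show ?thesis
  proof (rule conv_in_dist_countable)
    show "prob_space (distr (?U R) (count_space UNIV) (first_steps n))" for R
      by (rule prob_space.prob_space_distr[OF prob_space_uniform_measure[OF em] fsU])
    show "prob_space (distr ?C (count_space UNIV) (\<lambda>\<omega>. first_steps n (Some \<circ> \<omega>)))"
      by (rule prob_space.prob_space_distr[OF prob_space_chain_law fsC])
    fix l :: "(int ^ 'd) option list"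
    show "(\<lambda>R. measure (distr (?U R) (count_space UNIV) (first_steps n)) {l}) \<longlonglongrightarrow>
        measure (distr ?C (count_space UNIV) (\<lambda>\<omega>. first_steps n (Some \<circ> \<omega>))) {l}"
      unfolding mU mC
    proof -
      let ?m = "\<lambda>R. measure (krw k x) ({\<omega>. first_steps n \<omega> = l} \<inter> exits_alive (\<Lambda> R)) / exit_prob k (\<Lambda> R) x"
      let ?t = "measure ?C {\<omega>. map Some (first_steps n \<omega>) = l}"
      consider "length l \<noteq> Suc n" | "length l = Suc n" "None \<in> set l"
        | "length l = Suc n" "None \<notin> set l" "l ! 0 \<noteq> Some x"
        | "length l = Suc n" "None \<notin> set l" "l ! 0 = Some x" by blast
      then show "?m \<longlonglongrightarrow> ?t"
      proof cases
        case 1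
        then have "{\<omega>. first_steps n \<omega> = l} = {}" "{\<omega>. map Some (first_steps n \<omega>) = l} = {}"
          by (auto simp: first_steps_def)
        then show ?thesis by simp
      next
        \<comment> \<open>Once \<open>\<Lambda> R\<close> contains every living state of the list, a
          walk following it is dead before it can leave, so it misses the conditioning event. The
          limit chain never dies.\<close>
        case 2
        have "{\<omega>. map Some (first_steps n \<omega>) = l} = {}" using 2 by auto
        moreover have "eventually (\<lambda>R. ?m R = 0) sequentially"
        proof -
          have "finite {y. Some y \<in> set l}"
            by (rule finite_subset[of _ "the ` set l"]) force+
          from eventually_exhaustion_superset[OF \<Lambda> this] show ?thesis
          proof (rule eventually_mono)
            fix R assume R: "{y. Some y \<in> set l} \<subseteq> \<Lambda> R"
            obtain i where i: "i \<le> n" "l ! i = None" using 2 by (auto simp: in_set_conv_nth less_Suc_eq_le)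
            have "{\<omega>. first_steps n \<omega> = l} \<inter> exits_alive (\<Lambda> R) = {}"
            proof (rule ccontr)
              assume "\<not> ?thesis"
              then obtain \<omega> where "first_steps n \<omega> = l" "\<omega> \<in> exits_alive (\<Lambda> R)" by blast
              then obtain m y where \<omega>: "first_steps n \<omega> = l" "\<omega> m = Some y" "y \<notin> \<Lambda> R" "\<forall>j\<le>m. \<omega> j \<noteq> None"
                unfolding exits_alive_iff by blast
              have l: "\<forall>i\<le>n. \<omega> i = l ! i" using \<omega>(1) by (simp add: first_steps_eq_iff)
              have "\<omega> i = None" using l i by simp
              then have "\<not> i \<le> m" using \<omega>(4) by blast
              then have "m \<le> n" using i(1) by linarith
              then have "Some y \<in> set l" using l \<omega>(2) 2(1) by (metis less_Suc_eq_le nth_mem)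
              then show False using R \<omega>(3) by blast
            qed
            then show "?m R = 0" by simp
          qed
        qed
        ultimately show ?thesis by (simp add: tendsto_eventually)
      next
        case 3
        have "measure (krw k x) ({\<omega>. first_steps n \<omega> = l} \<inter> exits_alive (\<Lambda> R)) = 0" for R
          unfolding krw_def by (rule measure_chain_law_start) (use 3 in \<open>auto simp: first_steps_eq_iff\<close>)
        moreover have "?t = 0"
          by (rule measure_chain_law_start)
             (use 3 in \<open>auto simp: map_Some[symmetric] first_steps_eq_iff\<close>)
        ultimately show ?thesis by simp
      next
        case 4
        define p where "p i = the (l ! i)" for i
        have p: "l ! i = Some (p i)" if "i \<le> n" for i
        proof -
          have "l ! i \<in> set l" using that 4 by simp
          then have "l ! i \<noteq> None" using 4(2) by metis
          then show ?thesis by (simp add: p_def)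
        qed
        have p0: "p 0 = x" using 4 by (simp add: p_def)
        have e1: "{\<omega>. first_steps n \<omega> = l} = {\<omega>. \<forall>i\<le>n. \<omega> i = Some (p i)}"
          using 4 p by (auto simp: first_steps_eq_iff)
        have "map Some (first_steps n \<omega>) = l \<longleftrightarrow> (\<forall>i\<le>n. \<omega> i = p i)" for \<omega>
          unfolding map_Some[symmetric] first_steps_eq_iff using 4 p by auto
        then have e2: "{\<omega>. map Some (first_steps n \<omega>) = l} = {\<omega>. \<forall>i\<le>n. \<omega> i = p i}" by simp
        let ?q = "\<Prod>i<n. krw_prob k (Some (p i)) (Some (p (Suc i)))"
        have "emeasure ?C {\<omega>. \<forall>i\<le>n. \<omega> i = p i} = ennreal (\<Prod>i<n. pmf (h_transform k a (p i)) (p (Suc i)))"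
          by (simp add: emeasure_chain_law_path p0 prod_ennreal)
        then have "?t = (\<Prod>i<n. pmf (h_transform k a (p i)) (p (Suc i)))"
          by (simp add: measure_def e2 prod_nonneg)
        also have "\<dots> = ?q * (a (p n) / a x)"
          using h_transform_path[OF k a harm, of p n] x p0 by simp
        finally have t: "?t = ?q * (a (p n) / a x)" .
        have "(\<lambda>R. ?q * (exit_prob k (\<Lambda> R) (p n) / exit_prob k (\<Lambda> R) x)) \<longlonglongrightarrow> ?q * (a (p n) / a x)"
          by (intro tendsto_mult tendsto_const lim)
        moreover have "eventually (\<lambda>R. ?q * (exit_prob k (\<Lambda> R) (p n) / exit_prob k (\<Lambda> R) x) = ?m R) sequentially"
          using eventually_exhaustion_superset[OF \<Lambda> finite_imageI[OF finite_atMost, of p n]]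
        proof (rule eventually_mono)
          fix R assume R: "p ` {..n} \<subseteq> \<Lambda> R"
          have "measure (krw k (p 0)) ({\<omega>. \<forall>i\<le>n. \<omega> i = Some (p i)} \<inter> exits_alive (\<Lambda> R)) = ?q * exit_prob k (\<Lambda> R) (p n)"
            by (rule measure_path_exits_alive[OF k]) (use R in auto)
          then show "?q * (exit_prob k (\<Lambda> R) (p n) / exit_prob k (\<Lambda> R) x) = ?m R"
            by (simp add: e1 p0)
        qed
        ultimately show ?thesis unfolding t by (rule Lim_transform_eventually)
      qed
    qed
  qed simp_all
qed

theorem theorem1p11:
  fixes k :: "int ^ 'd \<Rightarrow> real" and x0 :: "int ^ 'd"
  assumes "CARD('d) \<ge> 2"
    and "\<And>x. k x \<in> {0..1}"
    and "k \<in> o[filtercomap enorm at_top](\<lambda>x. 1 / (enorm x)\<^sup>2)"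
    and "lattice_connected (survival_set k)"
    and "x0 \<in> survival_set k"
  shows "(\<exists>a :: int ^ 'd \<Rightarrow> real.
      (\<forall>\<Lambda>. exhaustion \<Lambda> \<longrightarrow> (\<forall>x.
        (\<lambda>R. measure (krw k x) (exits_alive (\<Lambda> R)) / measure (krw k x0) (exits_alive (\<Lambda> R)))
          \<longlonglongrightarrow> a x)) \<and>
      (\<forall>x\<in>survival_set k. a x > 0) \<and>
      (\<forall>x. x \<notin> survival_set k \<longrightarrow> a x = 0) \<and>
      (\<forall>x\<in>survival_set k. massive_harmonic_at k a x)) \<and>
    conditioned_to_survive_well_defined k"
proof -
  note d = assms(1) and k = assms(2) and conn = assms(4) and x0 = assms(5)
  have "eventually (\<lambda>x. norm (k x) \<le> 1 * norm (1 / (enorm x)\<^sup>2)) (filtercomap enorm at_top)"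
    using landau_o.smallD[OF assms(3), of 1] by simp
  then obtain r where r: "\<And>x. enorm x \<ge> r \<Longrightarrow> k x \<le> 1 / (enorm x)\<^sup>2"
    using k unfolding eventually_filtercomap_at_top_linorder by force
  \<comment> \<open>The summand 2 gives q \<ge> 4 outside the cube, hence k \<le> 1/4 there,
    strictly below 1.\<close>
  define s where "s = nat \<lceil>\<bar>r\<bar>\<rceil> + 2"
  have s: "real s \<ge> r" "real s \<ge> 2" by (auto simp: s_def) linarith
  have big: "k x * of_int (sqn x) \<le> 1" if "(real s)\<^sup>2 \<le> of_int (sqn x)" for x
  proof -
    have "real s \<le> enorm x"
      by (rule power2_le_imp_le) (use that in \<open>simp_all add: enorm_squared, simp add: enorm_def\<close>)
    then have "k x \<le> 1 / (enorm x)\<^sup>2" using r[of x] s by linarith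
    moreover have "enorm x > 0" using \<open>real s \<le> enorm x\<close> s by linarith
    ultimately show ?thesis by (simp add: enorm_squared[symmetric] field_simps)
  qed
  have decay: "k x * of_int (sqn x) \<le> 1" if "sqn x \<ge> int (s\<^sup>2)" for x
  proof (rule big)
    have "real_of_int (int (s\<^sup>2)) \<le> of_int (sqn x)" using that by (simp only: of_int_le_iff)
    then show "(real s)\<^sup>2 \<le> of_int (sqn x)" by simp
  qed
  have far: "k x < 1" if "\<bar>x $ i\<bar> \<ge> int s" for x i
  proof -
    have le: "(int s)\<^sup>2 \<le> sqn x" using sqn_ge_square[of "int s" x i] that by simp
    then have *: "int (s\<^sup>2) \<le> sqn x" by simp
    have "2\<^sup>2 \<le> (int s)\<^sup>2" by (intro power_mono) (auto simp: s_def)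
    then have "sqn x \<ge> 4" using le by simp
    then have "real_of_int (sqn x) \<ge> 4" by simp
    moreover have "k x * 4 \<le> k x * of_int (sqn x)"
      using k[of x] \<open>real_of_int (sqn x) \<ge> 4\<close> by (intro mult_left_mono) auto
    ultimately show ?thesis using decay[OF *] by linarith
  qed
  have decay': "\<forall>x. sqn x \<ge> int (s\<^sup>2) \<longrightarrow> k x * of_int (sqn x) \<le> 1" using decay by blast
  have far': "\<forall>x i. \<bar>x $ i\<bar> \<ge> int s \<longrightarrow> k x < 1" using far by blast
  have "\<forall>x. \<exists>l. \<forall>\<Lambda>. exhaustion \<Lambda> \<longrightarrow> (\<lambda>R. exit_prob k (\<Lambda> R) x / exit_prob k (\<Lambda> R) x0) \<longlonglongrightarrow> l"
    using exit_prob_ratio_limit[OF d k decay' far' conn x0] by blast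
  then obtain a where lim: "\<And>x \<Lambda>. exhaustion \<Lambda> \<Longrightarrow> (\<lambda>R. exit_prob k (\<Lambda> R) x / exit_prob k (\<Lambda> R) x0) \<longlonglongrightarrow> a x"
    by metis
  note limc = lim[OF exhaustion_cube]
  have harm: "massive_harmonic_at k a x" for x
    by (rule limit_massive_harmonic[OF k limc])
  have pos: "a x > 0" if x: "x \<in> survival_set k" for x
  proof -
    have "(x, x0) \<in> {(u, v). u \<in> survival_set k \<and> v \<in> survival_set k \<and> u \<sim>\<^sub>Z v}\<^sup>*"
      using conn x x0 by (simp add: lattice_connected_def)
    from exit_prob_comparison[OF k this] obtain c F
      where c: "c > 0" "finite F" "\<And>L. F \<subseteq> L \<Longrightarrow> c * exit_prob k L x0 \<le> exit_prob k L x" by blast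
    have "eventually (\<lambda>R. c \<le> exit_prob k (cube R) x / exit_prob k (cube R) x0) sequentially"
      using eventually_exhaustion_superset[OF exhaustion_cube c(2)]
    proof (rule eventually_mono)
      fix R assume "F \<subseteq> cube R"
      then show "c \<le> exit_prob k (cube R) x / exit_prob k (cube R) x0"
        using c(3)[of "cube R"] exit_prob_pos[OF k finite_cube x0, of R] by (simp add: field_simps)
    qed
    then have "c \<le> a x" by (intro tendsto_lowerbound[OF limc]) auto
    then show ?thesis using c(1) by simp
  qed
  have zero: "a x = 0" if x: "x \<notin> survival_set k" for x
  proof -
    obtain F where F: "finite F" "\<And>L. F \<subseteq> L \<Longrightarrow> exit_prob k L x = 0"
      using exit_prob_vanishes[OF k far' x] by blast
    have "(\<lambda>R. exit_prob k (cube R) x / exit_prob k (cube R) x0) \<longlonglongrightarrow> 0"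
      by (rule tendsto_eventually)
         (use eventually_exhaustion_superset[OF exhaustion_cube F(1)] F(2) in \<open>auto elim: eventually_mono\<close>)
    then show ?thesis using LIMSEQ_unique[OF limc] by blast
  qed
  have a0: "a x \<ge> 0" for x using pos[of x] zero[of x] by (cases "x \<in> survival_set k") auto
  have "conditioned_to_survive_well_defined k"
    unfolding conditioned_to_survive_well_defined_def
  proof (intro exI[of _ "h_transform k a"] conjI ballI allI impI)
    fix y assume y: "y \<in> survival_set k"
    show "set_pmf (h_transform k a y) \<subseteq> survival_set k"
    proof
      fix z assume "z \<in> set_pmf (h_transform k a y)"
      then have "a z \<noteq> 0" using pmf_h_transform[OF k a0 harm pos[OF y], of z] by (auto simp: set_pmf_iff)
      then show "z \<in> survival_set k" using zero by blast
    qed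
  next
    fix \<Lambda> :: "nat \<Rightarrow> (int ^ 'd) set" and x n assume \<Lambda>: "exhaustion \<Lambda>" and x: "x \<in> survival_set k"
    have fin: "finite (\<Lambda> R)" for R using \<Lambda> by (simp add: exhaustion_def)
    have "(\<lambda>R. exit_prob k (\<Lambda> R) y / exit_prob k (\<Lambda> R) x) \<longlonglongrightarrow> a y / a x" for y
    proof -
      \<comment> \<open>The limits are normalised at x0, the conditional law at the starting point
        x; a quotient of two such ratios changes the normalisation.\<close>
      have "(\<lambda>R. (exit_prob k (\<Lambda> R) y / exit_prob k (\<Lambda> R) x0) / (exit_prob k (\<Lambda> R) x / exit_prob k (\<Lambda> R) x0)) \<longlonglongrightarrow> a y / a x"
        using pos[OF x] by (intro tendsto_divide lim \<Lambda>) auto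
      moreover have "exit_prob k (\<Lambda> R) x0 \<noteq> 0" for R using exit_prob_pos[OF k fin x0, of R] by simp
      ultimately show ?thesis by simp
    qed
    then show "conv_in_dist
        (\<lambda>R. distr (uniform_measure (krw k x) (exits_alive (\<Lambda> R))) (count_space UNIV) (first_steps n))
        (distr (chain_law (h_transform k a) x) (count_space UNIV) (\<lambda>\<omega>. first_steps n (Some \<circ> \<omega>)))"
      by (intro exhaustion_conditioned_converges[OF k a0 harm pos[OF x] x \<Lambda>])
  qed
  then show ?thesis
    using lim pos zero harm by (intro conjI exI[of _ a]) (auto simp: exit_prob_def)
qed

end
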